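(* There is a generically 4-to-1 piecewise isometric map $\phi:T\to\mathbb{R}^3$ from the square torus $T$ onto a square (a filled planar square in $\mathbb{R}^3$) which is approximated arbitrarily closely, in the uniform metric, by 8-vertex paper tori: for every $\epsilon>0$ there is an 8-vertex paper torus $\phi':T'\to\mathbb{R}^3$ whose uniform distance from $\phi$ is less than $\epsilon$.
   Context: A flat torus is a quotient $\mathbb{R}^2/\Lambda$ with $\Lambda$ a lattice of translations. The square torus is (up to scale) $\mathbb{R}^2/\mathbb{Z}^2$. A paper torus is a piecewise linear isometric embedding $\phi':T'\to\mathbb{R}^3$ of a flat torus $T'$; it is an 8-vertex paper torus if it is isometric and affine on each triangle of some triangulation of $T'$ with 8 vertices. A piecewise isometric map from a flat torus is a continuous map that restricts to an isometric affine embedding on each triangle of some finite triangulation by Euclidean triangles. Generically $k$-to-1 means that every point of the image outside a finite union of line segments has exactly $k$ preimages. Uniform distance: given maps $\phi_j:T_j\to\mathbb{R}^3$ ($j=1,2$) on flat tori $T_j$, their uniform distance is the infimal $\epsilon$ such that there is a $(1+\epsilon)$-bilipschitz map $\alpha:T_1\to T_2$ for which the $L_\infty$ distance from $\phi_1$ to $\phi_2\circ\alpha$ is at most $\epsilon$. (The tori $T_1,T_2$ may be different flat tori.) *)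

theory Defs
  imports "HOL-Analysis.Analysis"
begin

section \<open>Flat tori\<close>

definition is_lattice :: "(real^2) set \<Rightarrow> bool" where
  "is_lattice \<Lambda> \<longleftrightarrow>
     (\<exists>a b. a \<noteq> b \<and> independent {a, b} \<and>
            \<Lambda> = {of_int m *\<^sub>R a + of_int n *\<^sub>R b | m n. True})"

definition lattice_rel :: "(real^2) set \<Rightarrow> ((real^2) \<times> (real^2)) set" where
  "lattice_rel \<Lambda> = {(x, y). y - x \<in> \<Lambda>}"

text \<open>The points of the torus are the cosets of the lattice.\<close>

definition flat_torus :: "(real^2) set \<Rightarrow> (real^2) set set" where
  "flat_torus \<Lambda> = UNIV // lattice_rel \<Lambda>"

definition torus_proj :: "(real^2) set \<Rightarrow> real^2 \<Rightarrow> (real^2) set" where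
  "torus_proj \<Lambda> x = lattice_rel \<Lambda> `` {x}"

text \<open>The quotient metric is the distance between cosets as subsets of the plane, that is,
  \<^const>\<open>setdist\<close>; lemma \<open>Metric_space_flat_torus\<close> below confirms that it is a metric.\<close>

definition torus_topology :: "(real^2) set \<Rightarrow> (real^2) set topology" where
  "torus_topology \<Lambda> = Metric_space.mtopology (flat_torus \<Lambda>) setdist"

definition square_lattice :: "(real^2) set" where
  "square_lattice = {x. \<forall>i. x $ i \<in> \<int>}"

section \<open>Triangulations and piecewise isometric maps\<close>

text \<open>A triangle of the torus is given by the vertex set \<open>t\<close> of one of its lifts to the plane;
  the closed triangle itself is \<open>torus_proj \<Lambda> ` (convex hull t)\<close>. Any two triangles of a
  triangulation meet in a common face, which may be empty; a face is spanned by a subset of the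
  vertices, and it is proper because distinct members of \<open>K\<close> are to represent distinct
  triangles.\<close>

definition torus_triangulation :: "(real^2) set \<Rightarrow> (real^2) set set \<Rightarrow> bool" where
  "torus_triangulation \<Lambda> K \<longleftrightarrow>
     finite K \<and>
     (\<forall>t\<in>K. card t = 3 \<and> \<not> affine_dependent t \<and>
             inj_on (torus_proj \<Lambda>) (convex hull t)) \<and>
     (\<Union>t\<in>K. torus_proj \<Lambda> ` (convex hull t)) = flat_torus \<Lambda> \<and>
     (\<forall>s\<in>K. \<forall>t\<in>K. s \<noteq> t \<longrightarrow>
        (\<exists>s' t'. s' \<subset> s \<and> t' \<subset> t \<and>
           torus_proj \<Lambda> ` (convex hull s) \<inter> torus_proj \<Lambda> ` (convex hull t)
             = torus_proj \<Lambda> ` (convex hull s') \<and>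
           torus_proj \<Lambda> ` (convex hull s') = torus_proj \<Lambda> ` (convex hull t')))"

definition torus_vertices :: "(real^2) set \<Rightarrow> (real^2) set set \<Rightarrow> (real^2) set set" where
  "torus_vertices \<Lambda> K = torus_proj \<Lambda> ` (\<Union>K)"

text \<open>``Isometric'' refers to the Euclidean metric of the flat triangle, not to the restriction
  of the metric of the torus, which may be smaller.\<close>

definition affine_isometric_on_triangle ::
    "(real^2) set \<Rightarrow> ((real^2) set \<Rightarrow> real^3) \<Rightarrow> (real^2) set \<Rightarrow> bool" where
  "affine_isometric_on_triangle \<Lambda> \<phi> t \<longleftrightarrow>
     (\<exists>f c. linear f \<and> (\<forall>v. norm (f v) = norm v) \<and>
            (\<forall>x \<in> convex hull t. \<phi> (torus_proj \<Lambda> x) = c + f x))"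

definition piecewise_isometric_map ::
    "(real^2) set \<Rightarrow> ((real^2) set \<Rightarrow> real^3) \<Rightarrow> bool" where
  "piecewise_isometric_map \<Lambda> \<phi> \<longleftrightarrow>
     is_lattice \<Lambda> \<and>
     continuous_map (torus_topology \<Lambda>) euclidean \<phi> \<and>
     (\<exists>K. torus_triangulation \<Lambda> K \<and> (\<forall>t\<in>K. affine_isometric_on_triangle \<Lambda> \<phi> t))"

definition paper_torus :: "(real^2) set \<Rightarrow> ((real^2) set \<Rightarrow> real^3) \<Rightarrow> bool" where
  "paper_torus \<Lambda> \<phi> \<longleftrightarrow>
     piecewise_isometric_map \<Lambda> \<phi> \<and> embedding_map (torus_topology \<Lambda>) euclidean \<phi>"

definition vertex_paper_torus ::
    "nat \<Rightarrow> (real^2) set \<Rightarrow> ((real^2) set \<Rightarrow> real^3) \<Rightarrow> bool" where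
  "vertex_paper_torus n \<Lambda> \<phi> \<longleftrightarrow>
     paper_torus \<Lambda> \<phi> \<and>
     (\<exists>K. torus_triangulation \<Lambda> K \<and> card (torus_vertices \<Lambda> K) = n \<and>
          (\<forall>t\<in>K. affine_isometric_on_triangle \<Lambda> \<phi> t))"

definition generically_to_one ::
    "nat \<Rightarrow> (real^2) set \<Rightarrow> ((real^2) set \<Rightarrow> real^3) \<Rightarrow> bool" where
  "generically_to_one k \<Lambda> \<phi> \<longleftrightarrow>
     (\<exists>S. finite S \<and> (\<forall>s\<in>S. \<exists>a b. s = closed_segment a b) \<and>
          (\<forall>y \<in> \<phi> ` flat_torus \<Lambda> - \<Union>S.
             finite {p \<in> flat_torus \<Lambda>. \<phi> p = y} \<and>
             card {p \<in> flat_torus \<Lambda>. \<phi> p = y} = k))"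

definition is_filled_square :: "(real^3) set \<Rightarrow> bool" where
  "is_filled_square Q \<longleftrightarrow>
     (\<exists>c u v. u \<noteq> 0 \<and> norm u = norm v \<and> orthogonal u v \<and>
              Q = convex hull {c, c + u, c + v, c + u + v})"

section \<open>The uniform distance\<close>

text \<open>A bilipschitz map between flat tori is automatically surjective, by invariance of domain.\<close>

definition torus_bilipschitz ::
    "real \<Rightarrow> (real^2) set \<Rightarrow> (real^2) set \<Rightarrow> ((real^2) set \<Rightarrow> (real^2) set) \<Rightarrow> bool" where
  "torus_bilipschitz L \<Lambda>\<^sub>1 \<Lambda>\<^sub>2 \<alpha> \<longleftrightarrow>
     \<alpha> \<in> flat_torus \<Lambda>\<^sub>1 \<rightarrow> flat_torus \<Lambda>\<^sub>2 \<and>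
     (\<forall>p \<in> flat_torus \<Lambda>\<^sub>1. \<forall>q \<in> flat_torus \<Lambda>\<^sub>1.
        setdist p q / L \<le> setdist (\<alpha> p) (\<alpha> q) \<and> setdist (\<alpha> p) (\<alpha> q) \<le> L * setdist p q)"

definition linfty_dist ::
    "(real^2) set \<Rightarrow> ((real^2) set \<Rightarrow> real^3) \<Rightarrow> ((real^2) set \<Rightarrow> real^3) \<Rightarrow> ereal" where
  "linfty_dist \<Lambda> f g = (SUP p \<in> flat_torus \<Lambda>. ereal (dist (f p) (g p)))"

text \<open>Extended reals make the suprema and infima meaningful without boundedness and
  nonemptiness conditions.\<close>

definition uniform_distance ::
    "(real^2) set \<Rightarrow> ((real^2) set \<Rightarrow> real^3) \<Rightarrow> (real^2) set \<Rightarrow> ((real^2) set \<Rightarrow> real^3) \<Rightarrow> ereal"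
  where
  "uniform_distance \<Lambda>\<^sub>1 \<phi>\<^sub>1 \<Lambda>\<^sub>2 \<phi>\<^sub>2 =
     Inf {ereal e | e. e \<ge> 0 \<and>
            (\<exists>\<alpha>. torus_bilipschitz (1 + e) \<Lambda>\<^sub>1 \<Lambda>\<^sub>2 \<alpha> \<and>
                 linfty_dist \<Lambda>\<^sub>1 \<phi>\<^sub>1 (\<phi>\<^sub>2 \<circ> \<alpha>) \<le> ereal e)}"

section \<open>The quotient metric is a metric\<close>

lemma is_lattice_square_lattice: "is_lattice square_lattice"
proof -
  let ?a = "axis 1 1 :: real^2" and ?b = "axis 2 1 :: real^2"
  have ne: "?a \<noteq> ?b" by (simp add: axis_eq_axis)
  have "independent {?a, ?b}"
    by (rule independent_mono[OF independent_Basis]) (auto simp: axis_in_Basis_iff)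
  moreover have "square_lattice = {of_int m *\<^sub>R ?a + of_int n *\<^sub>R ?b | m n. True}"
  proof (intro equalityI subsetI)
    fix x :: "real^2" assume "x \<in> square_lattice"
    then have "x $ 1 \<in> \<int>" "x $ 2 \<in> \<int>" by (simp_all add: square_lattice_def)
    then obtain m n where "x $ 1 = of_int m" "x $ 2 = of_int n" by (elim Ints_cases)
    then have "x = of_int m *\<^sub>R ?a + of_int n *\<^sub>R ?b"
      by (simp add: vec_eq_iff forall_2 axis_def)
    then show "x \<in> {of_int m *\<^sub>R ?a + of_int n *\<^sub>R ?b | m n. True}" by blast
  qed (auto simp: square_lattice_def forall_2 axis_def)
  ultimately show ?thesis unfolding is_lattice_def using ne by blast
qed

lemma is_lattice_closed:
  assumes "is_lattice \<Lambda>" shows "closed \<Lambda>"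
proof -
  obtain a b where ab: "a \<noteq> b" "independent {a, b}"
    and L: "\<Lambda> = {of_int m *\<^sub>R a + of_int n *\<^sub>R b | m n. True}"
    using assms unfolding is_lattice_def by blast
  define h where "h = (\<lambda>v::real^2. v $ 1 *\<^sub>R a + v $ 2 *\<^sub>R b)"
  have lin: "linear h"
    unfolding h_def by (intro linearI) (auto simp: algebra_simps)
  have "v = 0" if "h v = 0" for v
  proof -
    have *: "(\<Sum>x\<in>{a,b}. (if x = a then v $ 1 else v $ 2) *\<^sub>R x) = 0"
      using that ab(1) by (simp add: h_def)
    have "\<forall>x\<in>{a,b}. (if x = a then v $ 1 else v $ 2) = 0"
      using independent_explicit[THEN iffD1, OF ab(2), THEN conjunct2, THEN spec, THEN mp, OF *] .
    then have "v $ 1 = 0" "v $ 2 = 0" using ab(1) by auto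
    then show ?thesis by (simp add: vec_eq_iff forall_2)
  qed
  then have inj: "inj h" using linear_injective_0[OF lin] by blast
  have "closed (\<Inter>i. {x::real^2. x $ i \<in> \<int>})"
  proof (rule closed_INT, rule ballI)
    fix i :: 2
    have "closed ((\<lambda>x::real^2. x $ i) -` \<int>)"
      by (rule closed_vimage[OF closed_Ints]) (intro continuous_intros)
    then show "closed {x::real^2. x $ i \<in> \<int>}" by (simp add: vimage_def)
  qed
  moreover have "(\<Inter>i. {x::real^2. x $ i \<in> \<int>}) = square_lattice"
    by (auto simp: square_lattice_def)
  moreover have "\<Lambda> = h ` square_lattice"
  proof (intro equalityI subsetI)
    fix x assume "x \<in> \<Lambda>"
    then obtain m n where x: "x = of_int m *\<^sub>R a + of_int n *\<^sub>R b" using L by blast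
    let ?v = "(\<chi> i. if i = 1 then of_int m else of_int n) :: real^2"
    have "?v \<in> square_lattice" "x = h ?v" by (auto simp: square_lattice_def h_def x)
    then show "x \<in> h ` square_lattice" by blast
  next
    fix x assume "x \<in> h ` square_lattice"
    then show "x \<in> \<Lambda>"
      unfolding L h_def square_lattice_def forall_2 by (auto elim!: Ints_cases) blast
  qed
  ultimately show ?thesis using closed_injective_linear_image[OF _ lin inj] by simp
qed

lemma is_lattice_group:
  assumes "is_lattice \<Lambda>"
  shows "0 \<in> \<Lambda>" "x \<in> \<Lambda> \<Longrightarrow> y \<in> \<Lambda> \<Longrightarrow> x - y \<in> \<Lambda>"
proof -
  obtain a b where L: "\<Lambda> = {of_int m *\<^sub>R a + of_int n *\<^sub>R b | m n. True}"
    using assms unfolding is_lattice_def by blast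
  show "0 \<in> \<Lambda>" unfolding L by (auto intro!: exI[of _ 0])
  assume "x \<in> \<Lambda>" "y \<in> \<Lambda>"
  then obtain m n m' n' where "x = of_int m *\<^sub>R a + of_int n *\<^sub>R b"
    "y = of_int m' *\<^sub>R a + of_int n' *\<^sub>R b" unfolding L by blast
  then have "x - y = of_int (m - m') *\<^sub>R a + of_int (n - n') *\<^sub>R b"
    by (simp add: algebra_simps)
  then show "x - y \<in> \<Lambda>" unfolding L by blast
qed

lemma is_lattice_equiv:
  assumes "is_lattice \<Lambda>" shows "equiv UNIV (lattice_rel \<Lambda>)"
proof (rule equivI)
  note g = is_lattice_group[OF assms]
  show "refl (lattice_rel \<Lambda>)" by (auto simp: refl_on_def lattice_rel_def g)
  show "sym (lattice_rel \<Lambda>)"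
    unfolding sym_def lattice_rel_def using g(2)[OF g(1)] by fastforce
  have add: "x + y \<in> \<Lambda>" if "x \<in> \<Lambda>" "y \<in> \<Lambda>" for x y
    using g(2)[OF that(1) g(2)[OF g(1) that(2)]] by simp
  have tr: "z - x \<in> \<Lambda>" if "y - x \<in> \<Lambda>" "z - y \<in> \<Lambda>" for x y z
    using add[OF that(2,1)] by simp
  then show "trans (lattice_rel \<Lambda>)"
    unfolding trans_def lattice_rel_def using tr by blast
qed auto

lemma torus_proj_eq_translate: "torus_proj \<Lambda> x = (+) x ` \<Lambda>"
  by (force simp: torus_proj_def lattice_rel_def image_iff)

lemma setdist_torus_proj:
  assumes "is_lattice \<Lambda>" "a \<in> torus_proj \<Lambda> x"
  shows "setdist (torus_proj \<Lambda> x) (torus_proj \<Lambda> y) = setdist {a} (torus_proj \<Lambda> y)"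
proof -
  note g = is_lattice_group[OF assms(1)]
  have add: "u + v \<in> \<Lambda>" if "u \<in> \<Lambda>" "v \<in> \<Lambda>" for u v
    using g(2)[OF that(1) g(2)[OF g(1) that(2)]] by simp
  have le: "setdist {a} (torus_proj \<Lambda> y) \<le> dist b c"
    if bc: "b \<in> torus_proj \<Lambda> x" "c \<in> torus_proj \<Lambda> y" for b c
  proof -
    obtain l1 l2 l3 where l: "a = x + l1" "b = x + l2" "c = y + l3" "l1 \<in> \<Lambda>" "l2 \<in> \<Lambda>" "l3 \<in> \<Lambda>"
      using assms(2) bc unfolding torus_proj_eq_translate by blast
    have "c + (a - b) = y + (l3 + (l1 - l2))" by (simp add: l)
    then have "c + (a - b) \<in> torus_proj \<Lambda> y"
      unfolding torus_proj_eq_translate using add[OF l(6) g(2)[OF l(4,5)]] by blast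
    then have "setdist {a} (torus_proj \<Lambda> y) \<le> dist a (c + (a - b))"
      by (simp add: setdist_le_dist)
    then show ?thesis by (simp add: dist_norm)
  qed
  have ne: "torus_proj \<Lambda> x \<noteq> {}" "torus_proj \<Lambda> y \<noteq> {}"
    using g(1) by (auto simp: torus_proj_eq_translate)
  have "setdist {a} (torus_proj \<Lambda> y) \<le> setdist (torus_proj \<Lambda> x) (torus_proj \<Lambda> y)"
    by (rule le_setdistI[OF ne le])
  moreover have "setdist (torus_proj \<Lambda> x) (torus_proj \<Lambda> y) \<le> setdist {a} (torus_proj \<Lambda> y)"
    using assms(2) by (intro setdist_subset_left) auto
  ultimately show ?thesis by simp
qed

lemma Metric_space_flat_torus:
  assumes "is_lattice \<Lambda>" shows "Metric_space (flat_torus \<Lambda>) setdist"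
proof
  note g = is_lattice_group[OF assms]
  have self: "x \<in> torus_proj \<Lambda> x" for x
    using g(1) by (auto simp: torus_proj_eq_translate image_iff)
  have ex: "\<exists>x. p = torus_proj \<Lambda> x" if "p \<in> flat_torus \<Lambda>" for p
    using that by (auto simp: flat_torus_def quotient_def torus_proj_def)
  show "0 \<le> setdist p q" for p q :: "(real^2) set" by (rule setdist_pos_le)
  show "setdist p q = setdist q p" for p q :: "(real^2) set" by (rule setdist_sym)
  show "(setdist p q = 0) = (p = q)" if "p \<in> flat_torus \<Lambda>" "q \<in> flat_torus \<Lambda>" for p q
  proof -
    obtain x y where p: "p = torus_proj \<Lambda> x" and q: "q = torus_proj \<Lambda> y"
      using ex[OF \<open>p \<in> flat_torus \<Lambda>\<close>] ex[OF \<open>q \<in> flat_torus \<Lambda>\<close>] by blast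
    have "closed q"
      unfolding q torus_proj_eq_translate
      by (rule closed_translation[OF is_lattice_closed[OF assms]])
    then have "setdist p q = 0 \<longleftrightarrow> x \<in> q"
      unfolding p q setdist_torus_proj[OF assms self]
      using self[of y] by (subst setdist_eq_0_closed) auto
    also have "\<dots> \<longleftrightarrow> p = q"
      unfolding p q torus_proj_def
      using equiv_class_eq_iff[OF is_lattice_equiv[OF assms], of y x] by auto
    finally show ?thesis .
  qed
  show "setdist p r \<le> setdist p q + setdist q r"
    if pqr: "p \<in> flat_torus \<Lambda>" "q \<in> flat_torus \<Lambda>" "r \<in> flat_torus \<Lambda>" for p q r
  proof -
    obtain x y z where p: "p = torus_proj \<Lambda> x" and q: "q = torus_proj \<Lambda> y"
        and r: "r = torus_proj \<Lambda> z"
      using ex[OF pqr(1)] ex[OF pqr(2)] ex[OF pqr(3)] by blast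
    show ?thesis unfolding p q r
      using setdist_triangle[of "torus_proj \<Lambda> x" "torus_proj \<Lambda> z" y]
        setdist_torus_proj[OF assms self, of y z] setdist_torus_proj[OF assms self, of y x]
        setdist_sym[of "torus_proj \<Lambda> x" "torus_proj \<Lambda> y"]
        setdist_sym[of "torus_proj \<Lambda> x" "{y}"] by linarith
  qed
qed

end

theory Submission
  imports Defs
begin

text \<open>
  The map \<open>\<phi>\<close> folds the square torus along two pairs of circles: each of the four quarter
  squares of \<open>[0,1]\<^sup>2\<close> is laid by a reflection onto \<open>[0,1/2]\<^sup>2\<close>, so an interior point of the
  small square has four preimages.

  The paper tori nearby have the same combinatorics as a subdivision of this fold. Eight vertices
  \<open>0,\<dots>,7\<close> and sixteen triangles are distributed over the four quarter squares (the cells), and a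
  triangle of the triangulated torus is spanned by three vertices. Moving the eight vertices
  slightly in space and filling in triangles gives a torus that is symmetric under the half turn
  about the vertical axis (which swaps \<open>0\<close> with \<open>1\<close>, \<open>2\<close> with \<open>3\<close>, \<open>4\<close> with \<open>5\<close>, \<open>6\<close> with \<open>7\<close>).
  Three facts make it a paper torus close to \<open>\<phi>\<close>.

  \<^item> Flatness. The surface is intrinsically a flat torus if its sixteen triangles develop
    consistently into the plane. With the half turn acting on the development by point reflections,
    this is a system of polynomial equations, \<open>pup_tent\<close>. It is solved one unknown after another,
    with an intermediate value argument for the last one; the solutions form a family in
    which all displacements tend to zero (\<open>pup_tents_collapse\<close>). The equality of the edge lengths
    is \<open>pup_tent_edges\<close>.

  \<^item> Embeddedness. Two triangles meet only in their common face as soon as the plane of three of the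
    vertices separates them, which is a statement about signs of determinants of vertex
    quadruples (\<open>tent_weights_eq\<close>). When the thickness \<open>tau\<close> of the tent is much smaller than
    \<open>eps ^ 3\<close>, the determinants have the required signs (\<open>tent_signs_eventually\<close>).

  \<^item> Development. A point of the square torus is described by its barycentric coordinates
    \<open>bary\<close>, with respect to the eight vertices. These are well defined, separate the points of
    the torus and are Lipschitz. Hence a small displacement of the vertices, interpolated linearly, gives a
    map \<open>\<Psi>\<close> of the plane that differs from the identity by a contraction. It is a bilipschitz
    bijection that carries the lattice structure of the square torus to the one of a nearby flat torus
    (locale \<open>development\<close>), and simultaneously provides the triangulation and the
    comparison map needed for the uniform distance.
\<close>

section \<open>Folded square tents and their equations\<close>

text \<open>The equations express that the triangles of the tent in space and of the planar development have equal
  edges. In space (a square of side 1 centred at the origin) vertex \<open>0\<close> is \<open>(-lam, 0, -tau)\<close>, vertex \<open>2\<close> is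
  \<open>(-A, 1/2, 0)\<close>, vertex \<open>4\<close> is \<open>(-qx, -qy, eps - tau)\<close> and vertex \<open>6\<close> is \<open>(hx - del, R, tau)\<close>; the half turn
  gives the odd vertices. In the plane the lattice is spanned by \<open>(2, -2 kap)\<close> and \<open>(0, 2 + 2 n)\<close>, and the
  same vertices are developed to \<open>(-lam, 0)\<close>, \<open>(-A, 1/2 + n)\<close>, \<open>(-cx - 1, kap - cy)\<close> and
  \<open>(hx, hy + 1 + n)\<close>.\<close>

definition pup_tent ::
  "real \<Rightarrow> real \<Rightarrow> real \<Rightarrow> real \<Rightarrow> real \<Rightarrow> real \<Rightarrow> real \<Rightarrow> real \<Rightarrow> real \<Rightarrow> real \<Rightarrow> real \<Rightarrow> real \<Rightarrow> real \<Rightarrow> real \<Rightarrow> bool" where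
  "pup_tent kap lam eps tau n del hx hy R A cx cy qx qy \<longleftrightarrow>
     0 < eps \<and> 0 < tau \<and> n + n\<^sup>2 = tau\<^sup>2 \<and> 2 * lam = 1 + kap\<^sup>2 - eps\<^sup>2 \<and>
     (1 + n) * (hy + 1/2) = lam * del + tau\<^sup>2 \<and>
     2 * hx = 1 + kap\<^sup>2 + tau\<^sup>2 + 2 * kap * hy \<and>
     hy + R = - 2 * A * del \<and>
     tau\<^sup>2 = del * (2 * hx - del + 2 * A * (R - hy)) \<and>
     2 * cy * (1 + n) = (eps - 2 * tau)\<^sup>2 - (1 + n)\<^sup>2 \<and>
     (hx - del) * qx + R * qy = (hx - 1) * cx + (hy + kap) * (cy + 1 + n) \<and>
     - lam * qx = (1 - lam) * cx - kap * cy \<and>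
     qx\<^sup>2 + qy\<^sup>2 = cx\<^sup>2 + cy\<^sup>2 \<and>
     (qx - A)\<^sup>2 + (1/2 + qy)\<^sup>2 + (eps - tau)\<^sup>2 = (1 - A + cx)\<^sup>2 + (cy + 1/2 + n - kap)\<^sup>2"

text \<open>At thickness \<open>tau = 0\<close> and \<open>del = 0\<close> the equations have an explicit solution on the curve \<open>quad\<close>. For
  positive \<open>tau\<close> all unknowns become explicit functions of \<open>tau\<close> and \<open>e = tau\<^sup>2 / del\<close>, except that the last
  equation remains; it changes sign as \<open>e\<close> passes \<open>e0\<close>, so the intermediate value theorem provides a
  solution near the flat one.\<close>

lemma thicken:
  fixes kap E \<beta> eps lam hx0 cx0 cy0 qx0 qy0 A0 :: real
  assumes \<beta>: "\<beta> = 2 * kap - E" "0 < \<beta>" "\<beta> < 1" and E: "0 < E" and eps: "eps = sqrt E"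
    and kap: "0 < kap" "kap < 1/2"
    and quad: "E * (1 - \<beta>) / 4 + \<beta> * (1 - \<beta>) / 2 - (1 - 2 * kap) * \<beta> = 0"
    and lam: "lam = (1 + kap\<^sup>2 - E) / 2" and hx0: "hx0 = (1 + kap\<^sup>2 - kap) / 2"
    and cy0: "cy0 = (E - 1) / 2" and cx0: "cx0 = lam / 2 + kap * cy0"
    and qx0: "qx0 = cx0 - 1/2"
    and qy0: "qy0 = - 2 * kap * cy0 + (2 * kap - 1) * (cy0 + 1) + (E - kap) / 2"
    and A0: "A0 = 1/2 - 5 * kap / 6 + kap\<^sup>2 / 2 - E / 3"
    and A0p: "0 < A0"
  shows "\<exists>tau n del hx hy R A cx cy qx qy :: nat \<Rightarrow> real.
    (\<forall>j. pup_tent kap lam eps (tau j) (n j) (del j) (hx j) (hy j) (R j) (A j) (cx j) (cy j) (qx j) (qy j)) \<and>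
    tau \<longlonglongrightarrow> 0 \<and> n \<longlonglongrightarrow> 0 \<and> del \<longlonglongrightarrow> 0 \<and> hx \<longlonglongrightarrow> hx0 \<and> hy \<longlonglongrightarrow> -1/2 \<and> R \<longlonglongrightarrow> 1/2 \<and>
    A \<longlonglongrightarrow> A0 \<and> cx \<longlonglongrightarrow> cx0 \<and> cy \<longlonglongrightarrow> cy0 \<and> qx \<longlonglongrightarrow> qx0 \<and> qy \<longlonglongrightarrow> qy0"
proof -
  define n where "n = (\<lambda>p::real\<times>real. (sqrt (1 + 4 * (snd p)\<^sup>2) - 1) / 2)"
  define del where "del = (\<lambda>p::real\<times>real. (snd p)\<^sup>2 / fst p)"
  define hy where "hy = (\<lambda>p. - 1/2 + (lam * del p + (snd p)\<^sup>2) / (1 + n p))"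
  define hx where "hx = (\<lambda>p. (1 + kap\<^sup>2 + (snd p)\<^sup>2) / 2 + kap * hy p)"
  define rad where "rad = (\<lambda>p. (hy p)\<^sup>2 - (snd p)\<^sup>2 + del p * (2 * hx p - del p))"
  define R where "R = (\<lambda>p. sqrt (rad p))"
  define A where "A = (\<lambda>p. (fst p - 2 * hx p + del p) / (2 * (R p - hy p)))"
  define cy where "cy = (\<lambda>p. ((eps - 2 * snd p)\<^sup>2 - (1 + n p)\<^sup>2) / (2 * (1 + n p)))"
  define m1 where "m1 = (\<lambda>p. (del p - 1) * lam + hx p - del p)"
  define m0 where "m0 = (\<lambda>p. (del p - 1) * kap * cy p + (hy p + kap) * (cy p + 1 + n p))"
  define a2 where "a2 = (\<lambda>p. (m1 p)\<^sup>2 / (R p)\<^sup>2 - 2 * lam + 1)"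
  define a1 where "a1 = (\<lambda>p. 2 * m0 p * m1 p / (R p)\<^sup>2 - 2 * kap * cy p)"
  define a0 where "a0 = (\<lambda>p. (m0 p)\<^sup>2 / (R p)\<^sup>2 - (cy p)\<^sup>2)"
  define disc where "disc = (\<lambda>p. (a1 p)\<^sup>2 - 4 * a2 p * a0 p)"
  define f where "f = (\<lambda>p. (- a1 p + sqrt (disc p)) / (2 * a2 p))"
  define cx where "cx = (\<lambda>p. lam * f p + kap * cy p)"
  define qx where "qx = (\<lambda>p. cx p - f p)"
  define qy where "qy = (\<lambda>p. (m0 p + m1 p * f p) / R p)"
  define G where "G = (\<lambda>p. A p * (2 + 2 * f p) - (1 + (1/2 + n p - kap)\<^sup>2 - 1/4 - (eps - snd p)\<^sup>2
      + 2 * cx p + 2 * cy p * (1/2 + n p - kap) - qy p))"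
  define e0 where "e0 = 2 * A0 + 2 * hx0"
  have eps2: "eps\<^sup>2 = E" "0 < eps" using E eps by auto
  have np: "1 + n p > 0" for p
  proof -
    have "sqrt (1 + 4 * (snd p)\<^sup>2) \<ge> 1" by simp
    then show ?thesis unfolding n_def by argo
  qed
  have nn: "n p + (n p)\<^sup>2 = (snd p)\<^sup>2" for p
  proof -
    have "(sqrt (1 + 4 * (snd p)\<^sup>2))\<^sup>2 = 1 + 4 * (snd p)\<^sup>2" by simp
    then show ?thesis unfolding n_def by (simp add: power2_eq_square field_simps)
  qed
  text \<open>Values at \<open>\<tau> = 0\<close>.\<close>
  have z: "n (e,0) = 0" "del (e,0) = 0" "hy (e,0) = -1/2" "hx (e,0) = hx0" "rad (e,0) = 1/4" "R (e,0) = 1/2"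
    "cy (e,0) = cy0" for e
    using eps2(1) by (auto simp: n_def del_def hy_def hx_def hx0 rad_def R_def cy_def cy0 power2_eq_square real_sqrt_divide field_simps)
  have zA: "A (e,0) = (e - 2 * hx0) / 2" for e by (simp add: A_def z)
  have b: "E = 2 * kap - \<beta>" using \<beta> by simp
  have za2: "a2 (e,0) = E * (1 - \<beta>)" for e
    unfolding a2_def m1_def z lam hx0 b by (simp add: power2_eq_square field_simps)
  have za1: "a1 (e,0) = \<beta> * (1 - \<beta>)" for e
    unfolding a1_def m0_def m1_def z lam hx0 cy0 b by (simp add: power2_eq_square field_simps)
  have za0: "a0 (e,0) = - (1 - 2 * kap) * \<beta>" for e
    unfolding a0_def m0_def m1_def z lam hx0 cy0 b by (simp add: power2_eq_square field_simps)
  have zdisc: "disc (e,0) = (E * (1 - \<beta>) + \<beta> * (1 - \<beta>))\<^sup>2" for e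
  proof -
    have "4 * (E * (1 - \<beta>)) * ((1 - 2 * kap) * \<beta>)
       = 4 * (E * (1 - \<beta>)) * (E * (1 - \<beta>) / 4 + \<beta> * (1 - \<beta>) / 2)"
      using quad by simp
    then show ?thesis
      unfolding disc_def za2 za1 za0 by (simp add: power2_eq_square field_simps)
  qed
  have a2p: "E * (1 - \<beta>) > 0" "\<beta> * (1 - \<beta>) > 0" using E \<beta> by auto
  have zf: "f (e,0) = 1/2" for e
  proof -
    have "sqrt (disc (e,0)) = E * (1 - \<beta>) + \<beta> * (1 - \<beta>)"
      unfolding zdisc using a2p by (intro real_sqrt_unique) auto
    then show ?thesis using E \<beta> unfolding f_def za2 za1 by simp
  qed
  have zc: "cx (e,0) = cx0" "qx (e,0) = qx0" for e
    by (simp_all add: cx_def qx_def z zf cx0 qx0)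
  have zq: "qy (e,0) = qy0" for e
    by (simp add: qy_def m0_def m1_def z zf qy0 hx0 lam field_simps)
  have zG: "G (e,0) = (e - e0) * (3/2)" for e
    using eps2(1) unfolding G_def zA zf z zc zq e0_def qy0 A0 cx0 hx0 lam cy0 by (simp add: power2_eq_square field_simps)
  have "1 + kap\<^sup>2 - kap > 0" using kap zero_le_power2[of kap] by argo
  then have "hx0 > 0" unfolding hx0 by simp
  then have e0p: "e0 > 0" using A0p unfolding e0_def by simp
  text \<open>Continuity.\<close>
  define U where "U = {p. fst p > 0 \<and> rad p > 0 \<and> R p - hy p > 0 \<and> a2 p > 0 \<and> disc p > 0}"
  have c_n: "isCont n p" for p unfolding n_def by (intro continuous_intros) auto
  have c_del: "isCont del p" if "fst p > 0" for p
    unfolding del_def using that by (intro continuous_intros) auto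
  have c_hy: "isCont hy p" if "fst p > 0" for p
    unfolding hy_def using that np[of p] by (intro continuous_intros c_n c_del) auto
  have c_hx: "isCont hx p" if "fst p > 0" for p
    unfolding hx_def using that by (intro continuous_intros c_hy) auto
  have c_rad: "isCont rad p" if "fst p > 0" for p
    unfolding rad_def using that by (intro continuous_intros c_hy c_hx c_del) auto
  have c_R: "isCont R p" if "fst p > 0" for p
    unfolding R_def using that by (intro continuous_intros c_rad) auto
  have c_cy: "isCont cy p" for p
    unfolding cy_def using np[of p] by (intro continuous_intros c_n) auto
  have c_m1: "isCont m1 p" if "fst p > 0" for p
    unfolding m1_def using that by (intro continuous_intros c_hx c_del) auto
  have c_m0: "isCont m0 p" if "fst p > 0" for p
    unfolding m0_def using that by (intro continuous_intros c_hy c_del c_cy c_n) auto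
  have c_a2: "isCont a2 p" if "fst p > 0" "R p > 0" for p
    unfolding a2_def using that by (intro continuous_intros c_R c_m1) auto
  have c_a1: "isCont a1 p" if "fst p > 0" "R p > 0" for p
    unfolding a1_def using that by (intro continuous_intros c_R c_m1 c_m0 c_cy) auto
  have c_a0: "isCont a0 p" if "fst p > 0" "R p > 0" for p
    unfolding a0_def using that by (intro continuous_intros c_R c_m0 c_cy) auto
  have c_disc: "isCont disc p" if "fst p > 0" "R p > 0" for p
    unfolding disc_def using that by (intro continuous_intros c_a2 c_a1 c_a0) auto
  have RU: "R p > 0" if "p \<in> U" for p using that unfolding U_def R_def by auto
  have c_A: "isCont A p" if "p \<in> U" for p
    unfolding A_def using that unfolding U_def by (intro continuous_intros c_R c_hx c_hy c_del) auto
  have c_f: "isCont f p" if "p \<in> U" for p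
    unfolding f_def using that RU[OF that] unfolding U_def by (intro continuous_intros c_a2 c_a1 c_disc) auto
  have c_cx: "isCont cx p" if "p \<in> U" for p
    unfolding cx_def using that by (intro continuous_intros c_f c_cy) auto
  have c_qx: "isCont qx p" if "p \<in> U" for p
    unfolding qx_def using that by (intro continuous_intros c_f c_cx) auto
  have c_qy: "isCont qy p" if "p \<in> U" for p
    unfolding qy_def using that RU[OF that] unfolding U_def by (intro continuous_intros c_m0 c_m1 c_R c_f[OF that]) auto
  have c_G: "isCont G p" if "p \<in> U" for p
    unfolding G_def using that by (intro continuous_intros c_A c_f c_cx c_qy c_cy c_n) auto
  have U0: "(e0,0) \<in> U"
    using e0p a2p unfolding U_def by (auto simp: z za2 zdisc)
  have evU: "eventually (\<lambda>p. p \<in> U) (nhds (e0,0))"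
  proof -
    have f0: "fst (e0,0::real) > 0" and R0: "R (e0,0) > 0" using e0p by (auto simp: z)
    have ev: "eventually (\<lambda>p. h p > 0) (nhds (e0,0))" if "isCont h (e0,0)" "h (e0,0) > 0" for h :: "real\<times>real \<Rightarrow> real"
      using that by (metis isCont_def order_tendstoD(1) tendsto_at_iff_tendsto_nhds)
    have "isCont (\<lambda>p. R p - hy p) (e0,0)"
      by (rule isCont_diff[OF c_R[OF f0] c_hy[OF f0]])
    moreover have "isCont fst (e0,0::real)" by (intro continuous_intros)
    ultimately have "eventually (\<lambda>p. fst p > 0) (nhds (e0,0::real))" "eventually (\<lambda>p. R p - hy p > 0) (nhds (e0,0))"
      using ev[of fst] ev[of "\<lambda>p. R p - hy p"] f0 by (simp_all add: z)
    moreover have "eventually (\<lambda>p. rad p > 0) (nhds (e0,0))" "eventually (\<lambda>p. a2 p > 0) (nhds (e0,0))"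
      "eventually (\<lambda>p. disc p > 0) (nhds (e0,0))"
      using ev[OF c_rad[OF f0]] ev[OF c_a2[OF f0 R0]] ev[OF c_disc[OF f0 R0]] U0 unfolding U_def by simp_all
    ultimately show ?thesis unfolding U_def by eventually_elim simp
  qed
  then obtain d where d: "d > 0" "\<And>p. dist p (e0,0) < d \<Longrightarrow> p \<in> U"
    unfolding eventually_nhds_metric by blast
  text \<open>Solutions near the base.\<close>
  have ex: "\<exists>e t. \<bar>e - e0\<bar> \<le> \<eta> \<and> 0 < t \<and> t < \<eta> \<and> (e,t) \<in> U \<and> G (e,t) = 0" if \<eta>: "0 < \<eta>" "\<eta> < d/2" for \<eta>
  proof -
    have inU: "(e,t) \<in> U" if "\<bar>e - e0\<bar> \<le> \<eta>" "\<bar>t\<bar> \<le> \<eta>" for e t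
    proof (rule d(2))
      have "dist (e,t) (e0,0) \<le> dist e e0 + dist t 0"
        unfolding dist_Pair_Pair by (rule sqrt_sum_squares_le_sum) auto
      also have "\<dots> < d" using that \<eta> by (simp add: dist_real_def)
      finally show "dist (e,t) (e0,0) < d" .
    qed
    have cont: "((\<lambda>t. G (e,t)) \<longlongrightarrow> G (e,0)) (at_right 0)" if "\<bar>e - e0\<bar> \<le> \<eta>" for e
    proof -
      have "isCont G (e,0)" using c_G inU[OF that, of 0] \<eta> by auto
      moreover have "((\<lambda>t. (e,t)) \<longlongrightarrow> (e,0)) (at_right 0)" by (intro tendsto_intros)
      ultimately show ?thesis by (rule isCont_tendsto_compose)
    qed
    have "eventually (\<lambda>t. G (e0 + \<eta>,t) > 0) (at_right 0)" "eventually (\<lambda>t. G (e0 - \<eta>,t) < 0) (at_right 0)"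
      using order_tendstoD(1)[OF cont[of "e0 + \<eta>"], of 0] order_tendstoD(2)[OF cont[of "e0 - \<eta>"], of 0] \<eta>
      by (auto simp: zG)
    moreover have "eventually (\<lambda>t. t < \<eta> \<and> t > 0) (at_right (0::real))"
      using \<eta> by (auto simp: eventually_at_right intro!: exI[of _ \<eta>])
    ultimately have "eventually (\<lambda>t. G (e0 + \<eta>,t) > 0 \<and> G (e0 - \<eta>,t) < 0 \<and> t < \<eta> \<and> t > 0) (at_right 0)"
      by eventually_elim auto
    then obtain t where t: "G (e0 + \<eta>,t) > 0" "G (e0 - \<eta>,t) < 0" "t < \<eta>" "t > 0"
      using eventually_happens[of _ "at_right (0::real)"] by (auto simp: trivial_limit_at_right_real)
    have "\<exists>e\<ge>e0 - \<eta>. e \<le> e0 + \<eta> \<and> G (e,t) = 0"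
    proof (rule IVT)
      show "\<forall>e. e0 - \<eta> \<le> e \<and> e \<le> e0 + \<eta> \<longrightarrow> isCont (\<lambda>e. G (e,t)) e"
      proof (intro allI impI)
        fix e assume "e0 - \<eta> \<le> e \<and> e \<le> e0 + \<eta>"
        then have "isCont G (e,t)" using c_G inU[of e t] t \<eta> by auto
        moreover have "isCont (\<lambda>e. (e,t)) e" by (intro continuous_intros)
        ultimately show "isCont (\<lambda>e. G (e,t)) e" using isCont_o2[of e "\<lambda>e. (e,t)" G] by simp
      qed
    qed (use t \<eta> in auto)
    then obtain e where "e0 - \<eta> \<le> e" "e \<le> e0 + \<eta>" "G (e,t) = 0" by blast
    moreover from this have "\<bar>e - e0\<bar> \<le> \<eta>" by (simp add: abs_le_iff)
    ultimately show ?thesis using inU[of e t] t by auto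
  qed
  define \<eta> where "\<eta> = (\<lambda>j::nat. d/4 * inverse (real (Suc j)))"
  have \<eta>p: "0 < \<eta> j" "\<eta> j < d/2" for j
  proof -
    have "inverse (real (Suc j)) \<le> 1" by (simp add: field_simps)
    then have "d/4 * inverse (real (Suc j)) \<le> d/4 * 1" using d(1) by (intro mult_left_mono) auto
    then show "0 < \<eta> j" "\<eta> j < d/2" using d(1) unfolding \<eta>_def by auto
  qed
  have \<eta>0: "\<eta> \<longlonglongrightarrow> 0"
    unfolding \<eta>_def using tendsto_mult[OF tendsto_const[of "d/4"] LIMSEQ_inverse_real_of_nat] by simp
  have "\<exists>p. \<forall>j. \<bar>fst (p j) - e0\<bar> \<le> \<eta> j \<and> 0 < snd (p j) \<and> snd (p j) < \<eta> j \<and> p j \<in> U \<and> G (p j) = 0"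
    by (rule choice) (use ex[OF \<eta>p] in force)
  then obtain p where p: "\<And>j. \<bar>fst (p j) - e0\<bar> \<le> \<eta> j" "\<And>j. 0 < snd (p j)" "\<And>j. snd (p j) < \<eta> j"
    "\<And>j. p j \<in> U" "\<And>j. G (p j) = 0" by blast
  have l1: "(\<lambda>j. fst (p j)) \<longlonglongrightarrow> e0"
    by (rule LIM_zero_cancel, rule tendsto_rabs_zero_cancel, rule tendsto_sandwich[OF _ _ tendsto_const \<eta>0]) (use p in auto)
  have l2: "(\<lambda>j. snd (p j)) \<longlonglongrightarrow> 0"
    by (rule tendsto_sandwich[OF _ _ tendsto_const \<eta>0]) (auto intro!: always_eventually less_imp_le p)
  have lp: "p \<longlonglongrightarrow> (e0,0)"
    using tendsto_Pair[OF l1 l2] by simp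
  have lim: "(\<lambda>j. h (p j)) \<longlonglongrightarrow> h (e0,0)" if "isCont h (e0,0)" for h :: "real\<times>real \<Rightarrow> real"
    using isCont_tendsto_compose[OF that lp] .
  have f0: "fst (e0,0::real) > 0" using e0p by simp
  have sol: "pup_tent kap lam eps (snd q) (n q) (del q) (hx q) (hy q) (R q) (A q) (cx q) (cy q) (qx q) (qy q)"
    if q: "q \<in> U" "G q = 0" "snd q > 0" for q
  proof -
    have q': "fst q > 0" "rad q > 0" "R q - hy q > 0" "a2 q > 0" "disc q > 0" using q(1) unfolding U_def by auto
    have Rp: "R q > 0" using RU[OF q(1)] .
    have R2: "(R q)\<^sup>2 = rad q" using q'(2) unfolding R_def by simp
    have de: "del q * fst q = (snd q)\<^sup>2" using q'(1) by (simp add: del_def)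
    have ne: "2 * (R q - hy q) \<noteq> 0" using q'(3) by simp
    have "A q * (2 * (R q - hy q)) = fst q - 2 * hx q + del q"
      by (rule nonzero_eq_divide_eq[OF ne, THEN iffD1]) (simp add: A_def)
    then have Ae: "2 * A q * (R q - hy q) = fst q - 2 * hx q + del q" by (simp add: algebra_simps)
    have e1: "2 * lam = 1 + kap\<^sup>2 - eps\<^sup>2" using eps2 lam by simp
    have e2: "(1 + n q) * (hy q + 1/2) = lam * del q + (snd q)\<^sup>2" using np[of q] by (simp add: hy_def)
    have e3: "2 * hx q = 1 + kap\<^sup>2 + (snd q)\<^sup>2 + 2 * kap * hy q" by (simp add: hx_def)
    have e4: "hy q + R q = - 2 * A q * del q"
    proof -
      have "(R q - hy q) * (hy q + R q) = - del q * (2 * A q * (R q - hy q))"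
        unfolding Ae using R2 de unfolding rad_def by (simp add: power2_eq_square algebra_simps)
      then have "(R q - hy q) * (hy q + R q) = (R q - hy q) * (- 2 * A q * del q)" by (simp add: algebra_simps)
      then show ?thesis using q'(3) by (metis mult_left_cancel less_irrefl)
    qed
    have e5: "(snd q)\<^sup>2 = del q * (2 * hx q - del q + 2 * A q * (R q - hy q))" unfolding Ae using de by simp
    have ne: "2 * (1 + n q) \<noteq> 0" using np[of q] by simp
    have "cy q * (2 * (1 + n q)) = (eps - 2 * snd q)\<^sup>2 - (1 + n q)\<^sup>2"
      by (rule nonzero_eq_divide_eq[OF ne, THEN iffD1]) (simp add: cy_def)
    then have e6: "2 * cy q * (1 + n q) = (eps - 2 * snd q)\<^sup>2 - (1 + n q)\<^sup>2" by (simp add: algebra_simps)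
    have qyR: "R q * qy q = m0 q + m1 q * f q" using Rp by (simp add: qy_def)
    have e7: "(hx q - del q) * qx q + R q * qy q = (hx q - 1) * cx q + (hy q + kap) * (cy q + 1 + n q)"
      unfolding qyR m0_def m1_def qx_def cx_def by (simp add: algebra_simps)
    have e8: "- lam * qx q = (1 - lam) * cx q - kap * cy q"
      unfolding qx_def cx_def by (simp add: algebra_simps)
    have root: "a2 q * (f q)\<^sup>2 + a1 q * f q + a0 q = 0"
    proof -
      have sq: "sqrt (disc q) = 2 * a2 q * f q + a1 q" using q'(4) by (simp add: f_def)
      have "(2 * a2 q * f q + a1 q)\<^sup>2 = disc q" unfolding sq[symmetric] using q'(5) by simp
      then have "4 * a2 q * (a2 q * (f q)\<^sup>2 + a1 q * f q + a0 q) = 0" unfolding disc_def by (simp add: power2_eq_square algebra_simps)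
      then show ?thesis using q'(4) by simp
    qed
    have e9: "(qx q)\<^sup>2 + (qy q)\<^sup>2 = (cx q)\<^sup>2 + (cy q)\<^sup>2"
    proof -
      have "(qy q)\<^sup>2 = (m0 q + m1 q * f q)\<^sup>2 / (R q)\<^sup>2" by (simp add: qy_def power_divide)
      also have "\<dots> = (m0 q)\<^sup>2 / (R q)\<^sup>2 + 2 * m0 q * m1 q / (R q)\<^sup>2 * f q + (m1 q)\<^sup>2 / (R q)\<^sup>2 * (f q)\<^sup>2"
        by (simp add: power2_eq_square field_simps add_divide_distrib)
      finally have "(qy q)\<^sup>2 = (m0 q)\<^sup>2 / (R q)\<^sup>2 + 2 * m0 q * m1 q / (R q)\<^sup>2 * f q + (m1 q)\<^sup>2 / (R q)\<^sup>2 * (f q)\<^sup>2" .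
      moreover have "(m0 q)\<^sup>2 / (R q)\<^sup>2 = a0 q + (cy q)\<^sup>2" "2 * m0 q * m1 q / (R q)\<^sup>2 = a1 q + 2 * kap * cy q"
        "(m1 q)\<^sup>2 / (R q)\<^sup>2 = a2 q + 2 * lam - 1" by (auto simp: a0_def a1_def a2_def)
      ultimately have "(qy q)\<^sup>2 = a0 q + (cy q)\<^sup>2 + (a1 q + 2 * kap * cy q) * f q + (a2 q + 2 * lam - 1) * (f q)\<^sup>2" by simp
      then show ?thesis using root unfolding qx_def cx_def by (simp add: power2_eq_square algebra_simps)
    qed
    have e10: "(qx q - A q)\<^sup>2 + (1/2 + qy q)\<^sup>2 + (eps - snd q)\<^sup>2 = (1 - A q + cx q)\<^sup>2 + (cy q + 1/2 + n q - kap)\<^sup>2"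
    proof -
      have "(qx q - A q)\<^sup>2 + (1/2 + qy q)\<^sup>2 + (eps - snd q)\<^sup>2 - ((1 - A q + cx q)\<^sup>2 + (cy q + 1/2 + n q - kap)\<^sup>2)
        = (A q * (2 + 2 * (cx q - qx q)) - (1 + (1/2 + n q - kap)\<^sup>2 - 1/4 - (eps - snd q)\<^sup>2
           + 2 * cx q + 2 * cy q * (1/2 + n q - kap) - qy q)) + ((qx q)\<^sup>2 + (qy q)\<^sup>2 - ((cx q)\<^sup>2 + (cy q)\<^sup>2))"
        by (simp add: power2_eq_square field_simps)
      moreover have "cx q - qx q = f q" by (simp add: qx_def)
      ultimately show ?thesis using q(2) e9 unfolding G_def by simp
    qed
    show ?thesis unfolding pup_tent_def
      by (intro conjI) (rule eps2(2) q(3) nn e1 e2 e3 e4 e5 e6 e7 e8 e9 e10)+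
  qed
  have lims: "(\<lambda>j. n (p j)) \<longlonglongrightarrow> 0" "(\<lambda>j. del (p j)) \<longlonglongrightarrow> 0" "(\<lambda>j. hx (p j)) \<longlonglongrightarrow> hx0"
    "(\<lambda>j. hy (p j)) \<longlonglongrightarrow> -1/2" "(\<lambda>j. R (p j)) \<longlonglongrightarrow> 1/2"
    "(\<lambda>j. cx (p j)) \<longlonglongrightarrow> cx0" "(\<lambda>j. cy (p j)) \<longlonglongrightarrow> cy0" "(\<lambda>j. qx (p j)) \<longlonglongrightarrow> qx0" "(\<lambda>j. qy (p j)) \<longlonglongrightarrow> qy0"
    using lim[OF c_n] lim[OF c_del[OF f0]] lim[OF c_hx[OF f0]] lim[OF c_hy[OF f0]] lim[OF c_R[OF f0]] lim[OF c_cx[OF U0]]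
      lim[OF c_cy] lim[OF c_qx[OF U0]] lim[OF c_qy[OF U0]] by (simp_all only: z zc zq)
  have limA: "(\<lambda>j. A (p j)) \<longlonglongrightarrow> A0"
    using lim[OF c_A[OF U0]] by (simp add: zA e0_def)
  show ?thesis
    by (rule exI[of _ "\<lambda>j. snd (p j)"], rule exI[of _ "\<lambda>j. n (p j)"], rule exI[of _ "\<lambda>j. del (p j)"],
      rule exI[of _ "\<lambda>j. hx (p j)"], rule exI[of _ "\<lambda>j. hy (p j)"], rule exI[of _ "\<lambda>j. R (p j)"],
      rule exI[of _ "\<lambda>j. A (p j)"], rule exI[of _ "\<lambda>j. cx (p j)"], rule exI[of _ "\<lambda>j. cy (p j)"],
      rule exI[of _ "\<lambda>j. qx (p j)"], rule exI[of _ "\<lambda>j. qy (p j)"])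
      (intro conjI allI sol[OF p(4) p(5) p(2)] l2 lims limA)
qed

lemma tendsto_squeeze_shift:
  fixes x y b :: "nat \<Rightarrow> real"
  assumes "\<And>j. \<bar>x j - y j\<bar> < b j" "y \<longlonglongrightarrow> l" "b \<longlonglongrightarrow> 0"
  shows "x \<longlonglongrightarrow> l"
proof -
  have "(\<lambda>j. \<bar>x j - y j\<bar>) \<longlonglongrightarrow> 0"
    by (rule tendsto_sandwich[OF _ _ tendsto_const assms(3)]) (auto intro!: always_eventually less_imp_le assms(1))
  then have "(\<lambda>j. x j - y j) \<longlonglongrightarrow> 0" by (rule tendsto_rabs_zero_cancel)
  from tendsto_add[OF this assms(2)] show ?thesis by simp
qed

text \<open>A solution is chosen with thickness below \<open>b * sqrt E ^ 3\<close>. The parametrisation of \<open>kap\<close> and \<open>E\<close> by the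
  single number \<open>b\<close> is the rational parametrisation of the curve \<open>quad\<close>.\<close>

lemma thin_pup_tent:
  fixes b :: real
  assumes b: "0 < b" "b < 1/4"
  defines "kap \<equiv> b * (3 + b) / (2 * (1 + 3 * b))" and "E \<equiv> 2 * b * (1 - b) / (1 + 3 * b)"
  defines "cy0 \<equiv> (E - 1) / 2" and "lam \<equiv> (1 + kap\<^sup>2 - E) / 2"
  shows "\<exists>v :: nat \<Rightarrow> real. pup_tent kap lam (sqrt E) (v 0) (v 1) (v 2) (v 3) (v 4) (v 5) (v 6) (v 7) (v 8) (v 9) (v 10) \<and> (v 0) < b * sqrt E ^ 3 \<and>
    \<bar>(v 1)\<bar> < b \<and> \<bar>(v 2)\<bar> < b \<and> \<bar>(v 3) - (1 + kap\<^sup>2 - kap) / 2\<bar> < b \<and> \<bar>(v 4) + 1/2\<bar> < b \<and> \<bar>(v 5) - 1/2\<bar> < b \<and>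
    \<bar>(v 6) - (1/2 - 5 * kap / 6 + kap\<^sup>2 / 2 - E / 3)\<bar> < b \<and> \<bar>(v 7) - (lam / 2 + kap * cy0)\<bar> < b \<and> \<bar>(v 8) - cy0\<bar> < b \<and>
    \<bar>(v 9) - (lam / 2 + kap * cy0 - 1/2)\<bar> < b \<and>
    \<bar>(v 10) - (- 2 * kap * cy0 + (2 * kap - 1) * (cy0 + 1) + (E - kap) / 2)\<bar> < b \<and>
    \<bar>(v 5) * (lam - (v 6)) + (lam - (v 3) + (v 2)) / 2 - b / 3\<bar> < b * E"
proof -
  have d: "1 + 3 * b > 0" using b by simp
  have E: "E > 0" using b unfolding E_def by simp
  have kd: "kap * (2 * (1 + 3 * b)) = b * (3 + b)" using d unfolding kap_def by simp
  have Ed: "E * (1 + 3 * b) = 2 * b * (1 - b)" using d unfolding E_def by simp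
  have "b - 4 * c < 1" if "0 \<le> c" for c using b that by simp
  from this[of "b * b"] have "4 * (b * (1 - b)) < 1 + 3 * b" by (simp add: right_diff_distrib)
  then have E1: "E < 1/2" using d unfolding E_def by (simp add: pos_divide_less_eq)
  have "b * (1 + 3 * b) = (2 * kap - E) * (1 + 3 * b)" using kd Ed by (simp add: algebra_simps)
  then have bb: "b = 2 * kap - E" using d by simp
  have kap: "0 < kap" "kap < 1/2" "kap < 3/8" using bb E E1 b by auto
  have A0: "0 < 1/2 - 5 * kap / 6 + kap\<^sup>2 / 2 - E / 3" using bb E1 b zero_le_power2[of kap] by argo
  have "2 * kap = b + E" using bb by simp
  then have "(1 - 2 * kap) * b = (1 - b - E) * b" by simp
  then have quad: "E * (1 - b) / 4 + b * (1 - b) / 2 - (1 - 2 * kap) * b = 0"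
    using Ed by (simp add: field_simps)
  have b1: "b < 1" using b by simp
  have lam: "lam = (1 + kap\<^sup>2 - E) / 2" and cy: "cy0 = (E - 1) / 2" by (simp_all add: lam_def cy0_def)
  obtain tau n del hx hy R A cx cy qx qy :: "nat \<Rightarrow> real" where
    T: "(\<forall>j. pup_tent kap lam (sqrt E) (tau j) (n j) (del j) (hx j) (hy j) (R j) (A j) (cx j) (cy j) (qx j) (qy j)) \<and>
      tau \<longlonglongrightarrow> 0 \<and> n \<longlonglongrightarrow> 0 \<and> del \<longlonglongrightarrow> 0 \<and> hx \<longlonglongrightarrow> (1 + kap\<^sup>2 - kap) / 2 \<and> hy \<longlonglongrightarrow> -1/2 \<and>
      R \<longlonglongrightarrow> 1/2 \<and> A \<longlonglongrightarrow> 1/2 - 5 * kap / 6 + kap\<^sup>2 / 2 - E / 3 \<and> cx \<longlonglongrightarrow> lam / 2 + kap * cy0 \<and> cy \<longlonglongrightarrow> cy0 \<and>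
      qx \<longlonglongrightarrow> lam / 2 + kap * cy0 - 1/2 \<and>
      qy \<longlonglongrightarrow> - 2 * kap * cy0 + (2 * kap - 1) * (cy0 + 1) + (E - kap) / 2"
    using thicken[OF bb b(1) b1 E refl kap(1,2) quad lam refl cy refl refl refl refl A0]
    by (elim exE) (rule that, assumption)
  have s: "pup_tent kap lam (sqrt E) (tau j) (n j) (del j) (hx j) (hy j) (R j) (A j) (cx j) (cy j) (qx j) (qy j)" for j
    using T by (elim conjE) (rule spec)
  have lim: "tau \<longlonglongrightarrow> 0" "n \<longlonglongrightarrow> 0" "del \<longlonglongrightarrow> 0" "hx \<longlonglongrightarrow> (1 + kap\<^sup>2 - kap) / 2" "hy \<longlonglongrightarrow> -1/2"
      "R \<longlonglongrightarrow> 1/2" "A \<longlonglongrightarrow> 1/2 - 5 * kap / 6 + kap\<^sup>2 / 2 - E / 3" "cx \<longlonglongrightarrow> lam / 2 + kap * cy0" "cy \<longlonglongrightarrow> cy0"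
      "qx \<longlonglongrightarrow> lam / 2 + kap * cy0 - 1/2"
      "qy \<longlonglongrightarrow> - 2 * kap * cy0 + (2 * kap - 1) * (cy0 + 1) + (E - kap) / 2"
    using T by (simp_all only: simp_thms)
  have off: "(\<lambda>j. R j * (lam - A j) + (lam - hx j + del j) / 2) \<longlonglongrightarrow> b / 3"
    by (rule tendsto_eq_intros lim refl | simp add: lam_def bb power2_eq_square field_simps)+
  have ev: "eventually (\<lambda>j. \<bar>x j - l\<bar> < c) sequentially" if "x \<longlonglongrightarrow> l" "c > 0" for x :: "nat \<Rightarrow> real" and l c
    using tendstoD[OF that] by (simp add: dist_real_def)
  have ev': "eventually (\<lambda>j. tau j < b * sqrt E ^ 3) sequentially"
    using order_tendstoD(2)[OF lim(1), of "b * sqrt E ^ 3"] b E by simp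
  have bE: "b * E > 0" using b E by simp
  have "eventually (\<lambda>j. tau j < b * sqrt E ^ 3 \<and>
    \<bar>n j\<bar> < b \<and> \<bar>del j\<bar> < b \<and> \<bar>hx j - (1 + kap\<^sup>2 - kap) / 2\<bar> < b \<and> \<bar>hy j + 1/2\<bar> < b \<and> \<bar>R j - 1/2\<bar> < b \<and>
    \<bar>A j - (1/2 - 5 * kap / 6 + kap\<^sup>2 / 2 - E / 3)\<bar> < b \<and> \<bar>cx j - (lam / 2 + kap * cy0)\<bar> < b \<and> \<bar>cy j - cy0\<bar> < b \<and>
    \<bar>qx j - (lam / 2 + kap * cy0 - 1/2)\<bar> < b \<and>
    \<bar>qy j - (- 2 * kap * cy0 + (2 * kap - 1) * (cy0 + 1) + (E - kap) / 2)\<bar> < b \<and>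
    \<bar>R j * (lam - A j) + (lam - hx j + del j) / 2 - b / 3\<bar> < b * E) sequentially"
    using ev' ev[OF lim(2) b(1)] ev[OF lim(3) b(1)] ev[OF lim(4) b(1)] ev[OF lim(5) b(1)] ev[OF lim(6) b(1)]
      ev[OF lim(7) b(1)] ev[OF lim(8) b(1)] ev[OF lim(9) b(1)] ev[OF lim(10) b(1)] ev[OF lim(11) b(1)] ev[OF off bE]
    by eventually_elim simp
  from eventually_happens'[OF sequentially_bot this] obtain j where J: "tau j < b * sqrt E ^ 3 \<and>
    \<bar>n j\<bar> < b \<and> \<bar>del j\<bar> < b \<and> \<bar>hx j - (1 + kap\<^sup>2 - kap) / 2\<bar> < b \<and> \<bar>hy j + 1/2\<bar> < b \<and> \<bar>R j - 1/2\<bar> < b \<and>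
    \<bar>A j - (1/2 - 5 * kap / 6 + kap\<^sup>2 / 2 - E / 3)\<bar> < b \<and> \<bar>cx j - (lam / 2 + kap * cy0)\<bar> < b \<and> \<bar>cy j - cy0\<bar> < b \<and>
    \<bar>qx j - (lam / 2 + kap * cy0 - 1/2)\<bar> < b \<and>
    \<bar>qy j - (- 2 * kap * cy0 + (2 * kap - 1) * (cy0 + 1) + (E - kap) / 2)\<bar> < b \<and>
    \<bar>R j * (lam - A j) + (lam - hx j + del j) / 2 - b / 3\<bar> < b * E" by (elim exE) (rule that)
  define v where "v = (\<lambda>i. [tau j, n j, del j, hx j, hy j, R j, A j, cx j, cy j, qx j, qy j] ! i)"
  have v: "v 0 = tau j" "v 1 = n j" "v 2 = del j" "v 3 = hx j" "v 4 = hy j" "v 5 = R j" "v 6 = A j" "v 7 = cx j"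
    "v 8 = cy j" "v 9 = qx j" "v 10 = qy j"
    by (simp_all add: v_def)
  show ?thesis
    by (rule exI[of _ v], unfold v) (rule conjI[OF s J])
qed

text \<open>The last limit is the second order information that decides the sign of the determinants of quadruples whose
  vertices become collinear or coplanar already to first order.\<close>

lemma pup_tents_collapse:
  "\<exists>kap lam eps tau n del hx hy R A cx cy qx qy :: nat \<Rightarrow> real.
    (\<forall>j. pup_tent (kap j) (lam j) (eps j) (tau j) (n j) (del j) (hx j) (hy j) (R j) (A j) (cx j) (cy j) (qx j) (qy j)) \<and>
    kap \<longlonglongrightarrow> 0 \<and> lam \<longlonglongrightarrow> 1/2 \<and> eps \<longlonglongrightarrow> 0 \<and> (\<lambda>j. tau j / eps j ^ 3) \<longlonglongrightarrow> 0 \<and> n \<longlonglongrightarrow> 0 \<and> del \<longlonglongrightarrow> 0 \<and>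
    hx \<longlonglongrightarrow> 1/2 \<and> hy \<longlonglongrightarrow> -1/2 \<and> R \<longlonglongrightarrow> 1/2 \<and> A \<longlonglongrightarrow> 1/2 \<and> cx \<longlonglongrightarrow> 1/4 \<and> cy \<longlonglongrightarrow> -1/2 \<and> qx \<longlonglongrightarrow> -1/4 \<and> qy \<longlonglongrightarrow> -1/2 \<and>
    (\<lambda>j. (R j * (lam j - A j) + (lam j - hx j + del j) / 2) / (eps j)\<^sup>2) \<longlonglongrightarrow> 1/6"
proof -
  define b where "b = (\<lambda>j::nat. inverse (real (Suc (j + 4))))"
  define kap where "kap = (\<lambda>j. b j * (3 + b j) / (2 * (1 + 3 * b j)))"
  define E where "E = (\<lambda>j. 2 * b j * (1 - b j) / (1 + 3 * b j))"
  define cy0 where "cy0 = (\<lambda>j. (E j - 1) / 2)"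
  define lam where "lam = (\<lambda>j. (1 + (kap j)\<^sup>2 - E j) / 2)"
  have b0: "0 < b j" "b j < 1/4" for j unfolding b_def by (auto simp: field_simps)
  have lb: "b \<longlonglongrightarrow> 0" unfolding b_def using LIMSEQ_ignore_initial_segment[OF LIMSEQ_inverse_real_of_nat, of 4] by simp
  have E0: "E j > 0" for j using b0[of j] unfolding E_def by simp
  have "\<forall>j. \<exists>v :: nat \<Rightarrow> real. pup_tent (kap j) (lam j) (sqrt (E j)) (v 0) (v 1) (v 2) (v 3) (v 4) (v 5) (v 6) (v 7) (v 8) (v 9) (v 10) \<and> (v 0) < b j * sqrt (E j) ^ 3 \<and>
    \<bar>(v 1)\<bar> < b j \<and> \<bar>(v 2)\<bar> < b j \<and> \<bar>(v 3) - (1 + (kap j)\<^sup>2 - kap j) / 2\<bar> < b j \<and> \<bar>(v 4) + 1/2\<bar> < b j \<and> \<bar>(v 5) - 1/2\<bar> < b j \<and>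
    \<bar>(v 6) - (1/2 - 5 * kap j / 6 + (kap j)\<^sup>2 / 2 - E j / 3)\<bar> < b j \<and> \<bar>(v 7) - (lam j / 2 + kap j * cy0 j)\<bar> < b j \<and> \<bar>(v 8) - cy0 j\<bar> < b j \<and>
    \<bar>(v 9) - (lam j / 2 + kap j * cy0 j - 1/2)\<bar> < b j \<and>
    \<bar>(v 10) - (- 2 * kap j * cy0 j + (2 * kap j - 1) * (cy0 j + 1) + (E j - kap j) / 2)\<bar> < b j \<and>
    \<bar>(v 5) * (lam j - (v 6)) + (lam j - (v 3) + (v 2)) / 2 - b j / 3\<bar> < b j * E j"
    unfolding lam_def cy0_def kap_def E_def by (intro allI) (rule thin_pup_tent[OF b0])
  from choice[OF this] obtain f :: "nat \<Rightarrow> nat \<Rightarrow> real" where Q: "\<And>j. pup_tent (kap j) (lam j) (sqrt (E j)) (f j 0) (f j 1) (f j 2) (f j 3) (f j 4) (f j 5) (f j 6) (f j 7) (f j 8) (f j 9) (f j 10) \<and> (f j 0) < b j * sqrt (E j) ^ 3 \<and>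
    \<bar>(f j 1)\<bar> < b j \<and> \<bar>(f j 2)\<bar> < b j \<and> \<bar>(f j 3) - (1 + (kap j)\<^sup>2 - kap j) / 2\<bar> < b j \<and> \<bar>(f j 4) + 1/2\<bar> < b j \<and> \<bar>(f j 5) - 1/2\<bar> < b j \<and>
    \<bar>(f j 6) - (1/2 - 5 * kap j / 6 + (kap j)\<^sup>2 / 2 - E j / 3)\<bar> < b j \<and> \<bar>(f j 7) - (lam j / 2 + kap j * cy0 j)\<bar> < b j \<and> \<bar>(f j 8) - cy0 j\<bar> < b j \<and>
    \<bar>(f j 9) - (lam j / 2 + kap j * cy0 j - 1/2)\<bar> < b j \<and>
    \<bar>(f j 10) - (- 2 * kap j * cy0 j + (2 * kap j - 1) * (cy0 j + 1) + (E j - kap j) / 2)\<bar> < b j \<and>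
    \<bar>(f j 5) * (lam j - (f j 6)) + (lam j - (f j 3) + (f j 2)) / 2 - b j / 3\<bar> < b j * E j" by blast
  define tau where "tau = (\<lambda>j. f j 0)"
  define n where "n = (\<lambda>j. f j 1)"
  define del where "del = (\<lambda>j. f j 2)"
  define hx where "hx = (\<lambda>j. f j 3)"
  define hy where "hy = (\<lambda>j. f j 4)"
  define R where "R = (\<lambda>j. f j 5)"
  define A where "A = (\<lambda>j. f j 6)"
  define cx where "cx = (\<lambda>j. f j 7)"
  define cy where "cy = (\<lambda>j. f j 8)"
  define qx where "qx = (\<lambda>j. f j 9)"
  define qy where "qy = (\<lambda>j. f j 10)"
  note defs = tau_def n_def del_def hx_def hy_def R_def A_def cx_def cy_def qx_def qy_def
  have s: "pup_tent (kap j) (lam j) (sqrt (E j)) (tau j) (n j) (del j) (hx j) (hy j) (R j) (A j) (cx j) (cy j) (qx j) (qy j)" for j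
    unfolding defs using Q[of j] by (elim conjE)
  have c: "tau j < b j * sqrt (E j) ^ 3" "\<bar>n j\<bar> < b j" "\<bar>del j\<bar> < b j" "\<bar>hx j - (1 + (kap j)\<^sup>2 - kap j) / 2\<bar> < b j"
      "\<bar>hy j + 1/2\<bar> < b j" "\<bar>R j - 1/2\<bar> < b j"
      "\<bar>A j - (1/2 - 5 * kap j / 6 + (kap j)\<^sup>2 / 2 - E j / 3)\<bar> < b j" "\<bar>cx j - (lam j / 2 + kap j * cy0 j)\<bar> < b j"
      "\<bar>cy j - cy0 j\<bar> < b j" "\<bar>qx j - (lam j / 2 + kap j * cy0 j - 1/2)\<bar> < b j"
      "\<bar>qy j - (- 2 * kap j * cy0 j + (2 * kap j - 1) * (cy0 j + 1) + (E j - kap j) / 2)\<bar> < b j"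
      "\<bar>R j * (lam j - A j) + (lam j - hx j + del j) / 2 - b j / 3\<bar> < b j * E j" for j
    unfolding defs using Q[of j] by (simp_all only: simp_thms)
  have lk: "kap \<longlonglongrightarrow> 0" unfolding kap_def by (rule tendsto_eq_intros lb refl | simp)+
  have lE: "E \<longlonglongrightarrow> 0" unfolding E_def by (rule tendsto_eq_intros lb refl | simp)+
  have ll: "lam \<longlonglongrightarrow> 1/2" unfolding lam_def by (rule tendsto_eq_intros lk lE refl | simp)+
  have lc: "cy0 \<longlonglongrightarrow> -1/2" unfolding cy0_def by (rule tendsto_eq_intros lE refl | simp)+
  have le: "(\<lambda>j. sqrt (E j)) \<longlonglongrightarrow> 0" by (rule tendsto_eq_intros lE refl | simp)+
  have t0: "0 < tau j" for j using s[of j] unfolding pup_tent_def by simp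
  have lt: "(\<lambda>j. tau j / sqrt (E j) ^ 3) \<longlonglongrightarrow> 0"
  proof (rule tendsto_squeeze_shift[OF _ tendsto_const lb])
    show "\<bar>tau j / sqrt (E j) ^ 3 - 0\<bar> < b j" for j
      using c(1)[of j] t0[of j] E0[of j] by (simp add: pos_divide_less_eq)
  qed
  have lo: "(\<lambda>j. (R j * (lam j - A j) + (lam j - hx j + del j) / 2) / (sqrt (E j))\<^sup>2) \<longlonglongrightarrow> 1/6"
  proof (rule tendsto_squeeze_shift[OF _ _ lb])
    show "(\<lambda>j. (1 + 3 * b j) / (6 * (1 - b j))) \<longlonglongrightarrow> 1/6" by (rule tendsto_eq_intros lb refl | simp)+
    show "\<bar>(R j * (lam j - A j) + (lam j - hx j + del j) / 2) / (sqrt (E j))\<^sup>2 - (1 + 3 * b j) / (6 * (1 - b j))\<bar> < b j" for j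
    proof -
      have "(1 + 3 * b j) / (6 * (1 - b j)) = b j / 3 / E j"
        using b0[of j] unfolding E_def by (simp add: field_simps)
      then have "(R j * (lam j - A j) + (lam j - hx j + del j) / 2) / (sqrt (E j))\<^sup>2 - (1 + 3 * b j) / (6 * (1 - b j))
        = (R j * (lam j - A j) + (lam j - hx j + del j) / 2 - b j / 3) / E j"
        using E0[of j] by (simp add: diff_divide_distrib)
      then show ?thesis using c(12)[of j] E0[of j] by (simp add: pos_divide_less_eq)
    qed
  qed
  have l_n: "n \<longlonglongrightarrow> 0" by (rule tendsto_squeeze_shift[OF _ tendsto_const lb]) (use c(2) in simp)
  have l_del: "del \<longlonglongrightarrow> 0" by (rule tendsto_squeeze_shift[OF _ tendsto_const lb]) (use c(3) in simp)
  have l_hx: "hx \<longlonglongrightarrow> 1/2" by (rule tendsto_squeeze_shift[OF c(4) _ lb]) (rule tendsto_eq_intros lk refl | simp)+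
  have l_hy: "hy \<longlonglongrightarrow> -1/2" by (rule tendsto_squeeze_shift[OF _ tendsto_const lb]) (use c(5) in simp)
  have l_R: "R \<longlonglongrightarrow> 1/2" by (rule tendsto_squeeze_shift[OF c(6) tendsto_const lb])
  have l_A: "A \<longlonglongrightarrow> 1/2" by (rule tendsto_squeeze_shift[OF c(7) _ lb]) (rule tendsto_eq_intros lk lE refl | simp)+
  have l_cx: "cx \<longlonglongrightarrow> 1/4" by (rule tendsto_squeeze_shift[OF c(8) _ lb]) (rule tendsto_eq_intros lk ll lc refl | simp)+
  have l_cy: "cy \<longlonglongrightarrow> -1/2" by (rule tendsto_squeeze_shift[OF c(9) lc lb])
  have l_qx: "qx \<longlonglongrightarrow> -1/4" by (rule tendsto_squeeze_shift[OF c(10) _ lb]) (rule tendsto_eq_intros lk ll lc refl | simp)+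
  have l_qy: "qy \<longlonglongrightarrow> -1/2" by (rule tendsto_squeeze_shift[OF c(11) _ lb]) (rule tendsto_eq_intros lk lE lc refl | simp)+
  show ?thesis
    by (rule exI[of _ kap], rule exI[of _ lam], rule exI[of _ "\<lambda>j. sqrt (E j)"], rule exI[of _ tau], rule exI[of _ n],
      rule exI[of _ del], rule exI[of _ hx], rule exI[of _ hy], rule exI[of _ R], rule exI[of _ A], rule exI[of _ cx],
      rule exI[of _ cy], rule exI[of _ qx], rule exI[of _ qy])
      (intro conjI allI s lk ll le lt l_n l_del l_hx l_hy l_R l_A l_cx l_cy l_qx l_qy lo)
qed

section \<open>Separating the facets of a tent by planes\<close>

text \<open>The Boolean arguments say whether the cell is the right column and the top row of the unit square, where the
  fold reflects the corresponding coordinate.\<close>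

definition cell_facets :: "bool \<Rightarrow> bool \<Rightarrow> nat set set" where
  "cell_facets i j =
     (if j then if i then {{2,4,7}, {4,6,7}, {5,6,7}, {3,5,6}} else {{2,3,6}, {2,3,7}}
      else if i then {{0,2,4}, {0,5,7}, {0,4,5}, {1,4,5}, {1,4,6}, {1,3,5}}
      else {{0,3,7}, {0,1,3}, {0,1,2}, {1,2,6}})"

definition facets :: "nat set set" where
  "facets = (\<Union>i j. cell_facets i j)"

text \<open>Six times the signed volume of a tetrahedron; as a function of \<open>d\<close> it is an affine function vanishing on the plane
  of the first three vertices.\<close>

definition det4 :: "(nat \<Rightarrow> real) \<Rightarrow> (nat \<Rightarrow> real) \<Rightarrow> (nat \<Rightarrow> real) \<Rightarrow> nat \<Rightarrow> nat \<Rightarrow> nat \<Rightarrow> nat \<Rightarrow> real" where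
  "det4 X Y Z a b c d =
     (X b - X a) * ((Y c - Y a) * (Z d - Z a) - (Z c - Z a) * (Y d - Y a)) -
     (Y b - Y a) * ((X c - X a) * (Z d - Z a) - (Z c - Z a) * (X d - X a)) +
     (Z b - Z a) * ((X c - X a) * (Y d - Y a) - (Y c - Y a) * (X d - X a))"

lemma det4_eq_0 [simp]: "det4 X Y Z a b c a = 0" "det4 X Y Z a b c b = 0" "det4 X Y Z a b c c = 0"
  by (simp_all add: det4_def algebra_simps)

lemma det4_swap12: "det4 X Y Z b a c d = - det4 X Y Z a b c d"
  and det4_swap23: "det4 X Y Z a c b d = - det4 X Y Z a b c d"
  and det4_swap34: "det4 X Y Z a b d c = - det4 X Y Z a b c d"
  by (simp_all add: det4_def algebra_simps)

lemma det4_sort: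
  "b < a \<Longrightarrow> det4 X Y Z a b c d = - det4 X Y Z b a c d"
  "c < b \<Longrightarrow> det4 X Y Z a b c d = - det4 X Y Z a c b d"
  "d < c \<Longrightarrow> det4 X Y Z a b c d = - det4 X Y Z a b d c"
  by (rule det4_swap12 det4_swap23 det4_swap34)+

text \<open>The orientations of vertex quadruples that are used to separate pairs of facets.\<close>

definition tent_signs :: "(nat \<Rightarrow> real) \<Rightarrow> (nat \<Rightarrow> real) \<Rightarrow> (nat \<Rightarrow> real) \<Rightarrow> bool" where
  "tent_signs X Y Z \<longleftrightarrow>
     0 < det4 X Y Z 0 1 2 3 \<and>
     0 < det4 X Y Z 0 1 2 4 \<and>
     0 < det4 X Y Z 0 1 2 5 \<and>
     0 < det4 X Y Z 0 1 2 6 \<and>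
     0 < det4 X Y Z 0 1 2 7 \<and>
     det4 X Y Z 0 1 3 4 < 0 \<and>
     det4 X Y Z 0 1 3 5 < 0 \<and>
     det4 X Y Z 0 1 3 6 < 0 \<and>
     det4 X Y Z 0 1 3 7 < 0 \<and>
     0 < det4 X Y Z 0 1 4 5 \<and>
     det4 X Y Z 0 2 3 4 < 0 \<and>
     det4 X Y Z 0 2 3 7 < 0 \<and>
     det4 X Y Z 0 2 4 5 < 0 \<and>
     0 < det4 X Y Z 0 2 4 6 \<and>
     0 < det4 X Y Z 0 2 4 7 \<and>
     0 < det4 X Y Z 0 2 5 7 \<and>
     det4 X Y Z 0 2 6 7 < 0 \<and>
     0 < det4 X Y Z 0 3 4 5 \<and>
     0 < det4 X Y Z 0 3 4 7 \<and>
     0 < det4 X Y Z 0 3 5 7 \<and>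
     0 < det4 X Y Z 0 3 6 7 \<and>
     0 < det4 X Y Z 0 4 5 6 \<and>
     0 < det4 X Y Z 0 4 5 7 \<and>
     det4 X Y Z 0 5 6 7 < 0 \<and>
     0 < det4 X Y Z 1 2 3 5 \<and>
     0 < det4 X Y Z 1 2 3 6 \<and>
     det4 X Y Z 1 2 4 5 < 0 \<and>
     0 < det4 X Y Z 1 2 4 6 \<and>
     det4 X Y Z 1 2 6 7 < 0 \<and>
     0 < det4 X Y Z 1 3 4 5 \<and>
     0 < det4 X Y Z 1 3 4 6 \<and>
     0 < det4 X Y Z 1 3 5 6 \<and>
     0 < det4 X Y Z 1 3 5 7 \<and>
     det4 X Y Z 1 4 5 6 < 0 \<and>
     det4 X Y Z 1 4 5 7 < 0 \<and>
     0 < det4 X Y Z 1 4 6 7 \<and>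
     0 < det4 X Y Z 2 3 4 7 \<and>
     det4 X Y Z 2 3 5 6 < 0 \<and>
     0 < det4 X Y Z 2 3 6 7 \<and>
     det4 X Y Z 2 4 6 7 < 0 \<and>
     det4 X Y Z 2 5 6 7 < 0 \<and>
     0 < det4 X Y Z 3 5 6 7 \<and>
     det4 X Y Z 4 5 6 7 < 0"

text \<open>The facets may touch the plane only in the three vertices that span it. The last clause says that the plane
  is nondegenerate.\<close>

definition separating :: "(nat \<Rightarrow> real) \<Rightarrow> (nat \<Rightarrow> real) \<Rightarrow> (nat \<Rightarrow> real) \<Rightarrow> nat \<Rightarrow> nat \<Rightarrow> nat \<Rightarrow> nat set \<Rightarrow> nat set \<Rightarrow> bool" where
  "separating X Y Z a b c s t \<longleftrightarrow>
     (\<forall>v\<in>s. 0 \<le> det4 X Y Z a b c v) \<and> (\<forall>v\<in>t. det4 X Y Z a b c v \<le> 0) \<and>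
     (\<forall>v\<in>s \<union> t. det4 X Y Z a b c v = 0 \<longrightarrow> v \<in> {a, b, c}) \<and> (\<exists>d. det4 X Y Z a b c d \<noteq> 0)"

lemma separatingI:
  assumes "\<forall>v\<in>s. 0 \<le> det4 X Y Z a b c v" "\<forall>v\<in>t. det4 X Y Z a b c v \<le> 0"
    "\<forall>v\<in>s \<union> t. det4 X Y Z a b c v = 0 \<longrightarrow> v \<in> {a, b, c}" "\<exists>d\<in>s \<union> t. det4 X Y Z a b c d \<noteq> 0"
  shows "separating X Y Z a b c s t"
  using assms unfolding separating_def by blast

lemma separating_refl: "det4 X Y Z a b c d \<noteq> 0 \<Longrightarrow> separating X Y Z a b c {a, b, c} {a, b, c}"
  unfolding separating_def by auto

lemma separating_sym: "separating X Y Z a b c s t \<Longrightarrow> separating X Y Z b a c t s"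
  unfolding separating_def det4_swap12[of X Y Z b a c] by auto

text \<open>Barycentric coordinates supported in \<open>s\<close>. Sums range over all eight vertices, so that coordinates with respect to
  different facets can be compared directly.\<close>

definition weights_on :: "nat set \<Rightarrow> (nat \<Rightarrow> real) \<Rightarrow> bool" where
  "weights_on s w \<longleftrightarrow> (\<forall>v. 0 \<le> w v) \<and> (\<forall>v. v \<notin> s \<longrightarrow> w v = 0) \<and> (\<Sum>v<8. w v) = 1"

text \<open>An affine dependence annihilates every affine function.\<close>

lemma det4_affine_dependence:
  assumes "(\<Sum>v<n. u v) = 0" "(\<Sum>v<n. u v * X v) = 0" "(\<Sum>v<n. u v * Y v) = 0" "(\<Sum>v<n. u v * Z v) = 0"
  shows "(\<Sum>v<n. u v * det4 X Y Z a b c v) = 0"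
proof -
  obtain \<alpha> \<beta> \<gamma> \<delta> where *: "\<And>v. det4 X Y Z a b c v = \<alpha> + \<beta> * X v + \<gamma> * Y v + \<delta> * Z v"
  proof
    let ?A = "(Y b - Y a) * (Z c - Z a) - (Z b - Z a) * (Y c - Y a)"
    let ?B = "(Z b - Z a) * (X c - X a) - (X b - X a) * (Z c - Z a)"
    let ?C = "(X b - X a) * (Y c - Y a) - (Y b - Y a) * (X c - X a)"
    show "det4 X Y Z a b c v = - (?A * X a + ?B * Y a + ?C * Z a) + ?A * X v + ?B * Y v + ?C * Z v" for v
      by (simp add: det4_def algebra_simps)
  qed
  have "(\<Sum>v<n. u v * det4 X Y Z a b c v)
      = \<alpha> * (\<Sum>v<n. u v) + \<beta> * (\<Sum>v<n. u v * X v) + \<gamma> * (\<Sum>v<n. u v * Y v) + \<delta> * (\<Sum>v<n. u v * Z v)"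
    unfolding * sum_distrib_left sum.distrib[symmetric] by (rule sum.cong) (auto simp: algebra_simps)
  then show ?thesis using assms by simp
qed

text \<open>A common point of two triangles on opposite sides of a plane lies in that plane, hence is a combination of
  \<open>a\<close>, \<open>b\<close>, \<open>c\<close> in both triangles; these three are affinely independent, so the coordinates agree.\<close>

lemma separating_weights_eq:
  assumes sep: "separating X Y Z a b c s t" and sub: "s \<subseteq> {..<8}" "t \<subseteq> {..<8}"
    and w: "weights_on s w" "weights_on t w'"
    and eq: "(\<Sum>v<8. w v * X v) = (\<Sum>v<8. w' v * X v)" "(\<Sum>v<8. w v * Y v) = (\<Sum>v<8. w' v * Y v)"
      "(\<Sum>v<8. w v * Z v) = (\<Sum>v<8. w' v * Z v)"
  shows "w = w'"
proof -
  define u where "u = (\<lambda>v. w v - w' v)"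
  let ?f = "det4 X Y Z a b c"
  have dep: "(\<Sum>v<8. u v * det4 X Y Z p q r v) = 0" for p q r
    by (rule det4_affine_dependence) (use w eq in \<open>simp_all add: u_def weights_on_def left_diff_distrib sum_subtractf\<close>)
  have w0: "0 \<le> w v" "v \<notin> s \<Longrightarrow> w v = 0" "0 \<le> w' v" "v \<notin> t \<Longrightarrow> w' v = 0" for v
    using w unfolding weights_on_def by simp_all
  have f0: "v \<in> s \<Longrightarrow> 0 \<le> ?f v" "v \<in> t \<Longrightarrow> ?f v \<le> 0"
    "v \<in> s \<or> v \<in> t \<Longrightarrow> ?f v = 0 \<Longrightarrow> v \<in> {a, b, c}" for v
    using sep unfolding separating_def by blast+
  have wf: "0 \<le> w v * ?f v" for v
    by (cases "v \<in> s") (simp_all add: w0 f0)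
  have wf': "w' v * ?f v \<le> 0" for v
    by (cases "v \<in> t") (simp_all add: w0 f0 mult_nonneg_nonpos)
  have "(\<Sum>v<8. w v * ?f v - w' v * ?f v) = 0"
    using dep[of a b c] by (simp only: u_def left_diff_distrib)
  moreover have "0 \<le> w v * ?f v - w' v * ?f v" for v
    using wf[of v] wf'[of v] by simp
  ultimately have "w v * ?f v - w' v * ?f v = 0" if "v < 8" for v
    using sum_nonneg_eq_0_iff[of "{..<8}" "\<lambda>v. w v * ?f v - w' v * ?f v"] that by simp
  then have z: "w v * ?f v = 0" "w' v * ?f v = 0" if "v < 8" for v
    using wf[of v] wf'[of v] that by (metis diff_ge_0_iff_ge eq_iff_diff_eq_0 order_antisym)+
  have out: "u v = 0" if "\<not> v < 8" for v
    using w0[of v] sub that unfolding u_def by (metis diff_self lessThan_iff subsetD)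
  have u0: "u v = 0" if "v \<notin> {a, b, c}" for v
  proof (cases "v < 8")
    case True
    have "w v = 0" using z(1)[OF True] f0(3)[of v] w0(2)[of v] that by (metis mult_eq_0_iff)
    moreover have "w' v = 0" using z(2)[OF True] f0(3)[of v] w0(4)[of v] that by (metis mult_eq_0_iff)
    ultimately show ?thesis by (simp add: u_def)
  qed (rule out)
  obtain d where d: "?f d \<noteq> 0" using sep unfolding separating_def by blast
  have ne: "a \<noteq> b" "a \<noteq> c" "b \<noteq> c"
    using d by (auto simp: det4_def algebra_simps)
  have one: "u r = 0" if r: "det4 X Y Z p q d r \<noteq> 0" "{p, q, r} = {a, b, c}" for p q r
  proof (cases "r < 8")
    case True
    have "(\<Sum>v<8. u v * det4 X Y Z p q d v) = (\<Sum>v<8. if v = r then u r * det4 X Y Z p q d r else 0)"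
    proof (rule sum.cong)
      fix v
      show "u v * det4 X Y Z p q d v = (if v = r then u r * det4 X Y Z p q d r else 0)"
      proof (cases "v \<in> {a, b, c}")
        case True
        then have "v = p \<or> v = q \<or> v = r" using r(2) by blast
        then show ?thesis by auto
      qed (use u0 r(2) in auto)
    qed simp
    then show ?thesis using dep[of p q d] r(1) True by (simp add: sum.delta)
  next
    case False
    then show ?thesis by (rule out)
  qed
  have "det4 X Y Z a b d c \<noteq> 0" "det4 X Y Z a c d b \<noteq> 0" "det4 X Y Z b c d a \<noteq> 0"
    using d by (simp_all add: det4_def algebra_simps)
  then have "u a = 0" "u b = 0" "u c = 0" using one by blast+
  then have "u v = 0" for v using u0 by (cases "v \<in> {a, b, c}") auto
  then show ?thesis unfolding u_def by (auto simp: fun_eq_iff)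
qed

text \<open>One plane for each pair of distinct facets. A plane through three vertices is found by inspecting
  all triples in a numerical model of the tent.\<close>

lemma separating_planes:
  assumes signs: "tent_signs X Y Z"
  defines "sep \<equiv> separating X Y Z"
  shows
    "sep 0 3 7 {0,3,7} {0,1,3}" "sep 0 1 7 {0,3,7} {0,1,2}" "sep 2 1 6 {0,3,7} {1,2,6}"
    "sep 2 3 7 {0,3,7} {2,3,6}" "sep 0 3 7 {0,3,7} {2,3,7}" "sep 0 3 7 {0,3,7} {2,4,7}"
    "sep 0 3 7 {0,3,7} {4,6,7}" "sep 0 6 7 {0,3,7} {5,6,7}" "sep 6 3 7 {0,3,7} {3,5,6}"
    "sep 0 2 4 {0,3,7} {0,2,4}" "sep 0 3 7 {0,3,7} {0,5,7}" "sep 0 3 7 {0,3,7} {0,4,5}"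
    "sep 0 3 5 {0,3,7} {1,4,5}" "sep 0 3 7 {0,3,7} {1,4,6}" "sep 1 3 7 {0,3,7} {1,3,5}"
    "sep 0 1 2 {0,1,3} {0,1,2}" "sep 2 1 6 {0,1,3} {1,2,6}" "sep 0 1 3 {0,1,3} {2,3,6}"
    "sep 0 1 3 {0,1,3} {2,3,7}" "sep 0 2 3 {0,1,3} {2,4,7}" "sep 0 1 3 {0,1,3} {4,6,7}"
    "sep 0 1 3 {0,1,3} {5,6,7}" "sep 0 1 3 {0,1,3} {3,5,6}" "sep 0 2 4 {0,1,3} {0,2,4}"
    "sep 3 0 5 {0,1,3} {0,5,7}" "sep 0 1 5 {0,1,3} {0,4,5}" "sep 0 1 5 {0,1,3} {1,4,5}"
    "sep 1 3 6 {0,1,3} {1,4,6}" "sep 1 3 5 {0,1,3} {1,3,5}" "sep 2 1 6 {0,1,2} {1,2,6}"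
    "sep 2 1 3 {0,1,2} {2,3,6}" "sep 1 0 2 {0,1,2} {2,3,7}" "sep 0 2 7 {0,1,2} {2,4,7}"
    "sep 1 0 2 {0,1,2} {4,6,7}" "sep 1 0 2 {0,1,2} {5,6,7}" "sep 1 3 6 {0,1,2} {3,5,6}"
    "sep 1 0 2 {0,1,2} {0,2,4}" "sep 0 2 7 {0,1,2} {0,5,7}" "sep 1 0 4 {0,1,2} {0,4,5}"
    "sep 1 0 4 {0,1,2} {1,4,5}" "sep 1 0 2 {0,1,2} {1,4,6}" "sep 2 1 3 {0,1,2} {1,3,5}"
    "sep 3 2 6 {1,2,6} {2,3,6}" "sep 3 2 6 {1,2,6} {2,3,7}" "sep 1 2 6 {1,2,6} {2,4,7}"
    "sep 1 2 6 {1,2,6} {4,6,7}" "sep 2 6 7 {1,2,6} {5,6,7}" "sep 3 2 6 {1,2,6} {3,5,6}"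
    "sep 0 2 4 {1,2,6} {0,2,4}" "sep 0 2 7 {1,2,6} {0,5,7}" "sep 1 2 4 {1,2,6} {0,4,5}"
    "sep 4 1 5 {1,2,6} {1,4,5}" "sep 1 4 6 {1,2,6} {1,4,6}" "sep 1 3 6 {1,2,6} {1,3,5}"
    "sep 3 2 6 {2,3,6} {2,3,7}" "sep 2 4 7 {2,3,6} {2,4,7}" "sep 2 6 7 {2,3,6} {4,6,7}"
    "sep 3 2 6 {2,3,6} {5,6,7}" "sep 3 5 6 {2,3,6} {3,5,6}" "sep 0 2 4 {2,3,6} {0,2,4}"
    "sep 0 5 7 {2,3,6} {0,5,7}" "sep 0 2 4 {2,3,6} {0,4,5}" "sep 1 3 5 {2,3,6} {1,4,5}"
    "sep 1 4 6 {2,3,6} {1,4,6}" "sep 1 3 6 {2,3,6} {1,3,5}" "sep 2 4 7 {2,3,7} {2,4,7}"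
    "sep 2 3 7 {2,3,7} {4,6,7}" "sep 6 3 7 {2,3,7} {5,6,7}" "sep 6 3 7 {2,3,7} {3,5,6}"
    "sep 0 2 7 {2,3,7} {0,2,4}" "sep 0 2 7 {2,3,7} {0,5,7}" "sep 0 4 7 {2,3,7} {0,4,5}"
    "sep 1 3 5 {2,3,7} {1,4,5}" "sep 1 4 6 {2,3,7} {1,4,6}" "sep 1 3 5 {2,3,7} {1,3,5}"
    "sep 4 6 7 {2,4,7} {4,6,7}" "sep 4 6 7 {2,4,7} {5,6,7}" "sep 5 6 7 {2,4,7} {3,5,6}"
    "sep 0 2 4 {2,4,7} {0,2,4}" "sep 0 5 7 {2,4,7} {0,5,7}" "sep 0 2 4 {2,4,7} {0,4,5}"
    "sep 4 1 5 {2,4,7} {1,4,5}" "sep 1 4 6 {2,4,7} {1,4,6}" "sep 4 1 5 {2,4,7} {1,3,5}"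
    "sep 4 6 7 {4,6,7} {5,6,7}" "sep 5 6 7 {4,6,7} {3,5,6}" "sep 0 2 4 {4,6,7} {0,2,4}"
    "sep 0 5 7 {4,6,7} {0,5,7}" "sep 0 4 5 {4,6,7} {0,4,5}" "sep 5 4 6 {4,6,7} {1,4,5}"
    "sep 4 6 7 {4,6,7} {1,4,6}" "sep 4 1 5 {4,6,7} {1,3,5}" "sep 5 6 7 {5,6,7} {3,5,6}"
    "sep 6 5 7 {5,6,7} {0,2,4}" "sep 6 5 7 {5,6,7} {0,5,7}" "sep 4 5 7 {5,6,7} {0,4,5}"
    "sep 5 4 6 {5,6,7} {1,4,5}" "sep 5 4 6 {5,6,7} {1,4,6}" "sep 3 5 6 {5,6,7} {1,3,5}"
    "sep 0 4 5 {3,5,6} {0,2,4}" "sep 0 5 7 {3,5,6} {0,5,7}" "sep 0 4 5 {3,5,6} {0,4,5}"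
    "sep 1 5 6 {3,5,6} {1,4,5}" "sep 1 5 6 {3,5,6} {1,4,6}" "sep 1 3 5 {3,5,6} {1,3,5}"
    "sep 0 4 7 {0,2,4} {0,5,7}" "sep 4 0 5 {0,2,4} {0,4,5}" "sep 4 0 5 {0,2,4} {1,4,5}"
    "sep 2 1 4 {0,2,4} {1,4,6}" "sep 4 1 5 {0,2,4} {1,3,5}" "sep 5 0 7 {0,5,7} {0,4,5}"
    "sep 5 4 7 {0,5,7} {1,4,5}" "sep 5 4 7 {0,5,7} {1,4,6}" "sep 1 3 5 {0,5,7} {1,3,5}"
    "sep 4 1 5 {0,4,5} {1,4,5}" "sep 5 4 6 {0,4,5} {1,4,6}" "sep 4 1 5 {0,4,5} {1,3,5}"
    "sep 1 4 5 {1,4,5} {1,4,6}" "sep 4 1 5 {1,4,5} {1,3,5}" "sep 4 1 5 {1,4,6} {1,3,5}"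
proof -
  note p = signs[unfolded tent_signs_def]
  have q: "0 < det4 X Y Z 0 1 2 3" "0 < det4 X Y Z 0 1 2 4" "0 < det4 X Y Z 0 1 2 5" "0 < det4 X Y Z 0 1 2 6" "0 < det4 X Y Z 0 1 2 7" "det4 X Y Z 0 1 3 4 < 0" "det4 X Y Z 0 1 3 5 < 0" "det4 X Y Z 0 1 3 6 < 0" "det4 X Y Z 0 1 3 7 < 0" "0 < det4 X Y Z 0 1 4 5" "det4 X Y Z 0 2 3 4 < 0" "det4 X Y Z 0 2 3 7 < 0" "det4 X Y Z 0 2 4 5 < 0" "0 < det4 X Y Z 0 2 4 6" "0 < det4 X Y Z 0 2 4 7" "0 < det4 X Y Z 0 2 5 7" "det4 X Y Z 0 2 6 7 < 0" "0 < det4 X Y Z 0 3 4 5" "0 < det4 X Y Z 0 3 4 7" "0 < det4 X Y Z 0 3 5 7" "0 < det4 X Y Z 0 3 6 7" "0 < det4 X Y Z 0 4 5 6" "0 < det4 X Y Z 0 4 5 7" "det4 X Y Z 0 5 6 7 < 0" "0 < det4 X Y Z 1 2 3 5" "0 < det4 X Y Z 1 2 3 6" "det4 X Y Z 1 2 4 5 < 0" "0 < det4 X Y Z 1 2 4 6" "det4 X Y Z 1 2 6 7 < 0" "0 < det4 X Y Z 1 3 4 5" "0 < det4 X Y Z 1 3 4 6" "0 < det4 X Y Z 1 3 5 6" "0 < det4 X Y Z 1 3 5 7" "det4 X Y Z 1 4 5 6 < 0" "det4 X Y Z 1 4 5 7 < 0" "0 < det4 X Y Z 1 4 6 7" "0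 < det4 X Y Z 2 3 4 7" "det4 X Y Z 2 3 5 6 < 0" "0 < det4 X Y Z 2 3 6 7" "det4 X Y Z 2 4 6 7 < 0" "det4 X Y Z 2 5 6 7 < 0" "0 < det4 X Y Z 3 5 6 7" "det4 X Y Z 4 5 6 7 < 0"
    using p by (simp_all only: simp_thms)
  note le = q[THEN less_imp_le] and ne = q[THEN less_imp_neq] q[THEN less_imp_neq, symmetric]
  show "sep 0 3 7 {0,3,7} {0,1,3}" "sep 0 1 7 {0,3,7} {0,1,2}" "sep 2 1 6 {0,3,7} {1,2,6}"
    "sep 2 3 7 {0,3,7} {2,3,6}" "sep 0 3 7 {0,3,7} {2,3,7}" "sep 0 3 7 {0,3,7} {2,4,7}"
    "sep 0 3 7 {0,3,7} {4,6,7}" "sep 0 6 7 {0,3,7} {5,6,7}" "sep 6 3 7 {0,3,7} {3,5,6}"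
    "sep 0 2 4 {0,3,7} {0,2,4}" "sep 0 3 7 {0,3,7} {0,5,7}" "sep 0 3 7 {0,3,7} {0,4,5}"
    "sep 0 3 5 {0,3,7} {1,4,5}" "sep 0 3 7 {0,3,7} {1,4,6}" "sep 1 3 7 {0,3,7} {1,3,5}"
    "sep 0 1 2 {0,1,3} {0,1,2}" "sep 2 1 6 {0,1,3} {1,2,6}" "sep 0 1 3 {0,1,3} {2,3,6}"
    "sep 0 1 3 {0,1,3} {2,3,7}" "sep 0 2 3 {0,1,3} {2,4,7}" "sep 0 1 3 {0,1,3} {4,6,7}"
    "sep 0 1 3 {0,1,3} {5,6,7}" "sep 0 1 3 {0,1,3} {3,5,6}" "sep 0 2 4 {0,1,3} {0,2,4}"
    "sep 3 0 5 {0,1,3} {0,5,7}" "sep 0 1 5 {0,1,3} {0,4,5}" "sep 0 1 5 {0,1,3} {1,4,5}"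
    "sep 1 3 6 {0,1,3} {1,4,6}" "sep 1 3 5 {0,1,3} {1,3,5}" "sep 2 1 6 {0,1,2} {1,2,6}"
    "sep 2 1 3 {0,1,2} {2,3,6}" "sep 1 0 2 {0,1,2} {2,3,7}" "sep 0 2 7 {0,1,2} {2,4,7}"
    "sep 1 0 2 {0,1,2} {4,6,7}" "sep 1 0 2 {0,1,2} {5,6,7}" "sep 1 3 6 {0,1,2} {3,5,6}"
    "sep 1 0 2 {0,1,2} {0,2,4}" "sep 0 2 7 {0,1,2} {0,5,7}" "sep 1 0 4 {0,1,2} {0,4,5}"
    "sep 1 0 4 {0,1,2} {1,4,5}" "sep 1 0 2 {0,1,2} {1,4,6}" "sep 2 1 3 {0,1,2} {1,3,5}"
    "sep 3 2 6 {1,2,6} {2,3,6}" "sep 3 2 6 {1,2,6} {2,3,7}" "sep 1 2 6 {1,2,6} {2,4,7}"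
    "sep 1 2 6 {1,2,6} {4,6,7}" "sep 2 6 7 {1,2,6} {5,6,7}" "sep 3 2 6 {1,2,6} {3,5,6}"
    "sep 0 2 4 {1,2,6} {0,2,4}" "sep 0 2 7 {1,2,6} {0,5,7}" "sep 1 2 4 {1,2,6} {0,4,5}"
    "sep 4 1 5 {1,2,6} {1,4,5}" "sep 1 4 6 {1,2,6} {1,4,6}" "sep 1 3 6 {1,2,6} {1,3,5}"
    "sep 3 2 6 {2,3,6} {2,3,7}" "sep 2 4 7 {2,3,6} {2,4,7}" "sep 2 6 7 {2,3,6} {4,6,7}"
    "sep 3 2 6 {2,3,6} {5,6,7}" "sep 3 5 6 {2,3,6} {3,5,6}" "sep 0 2 4 {2,3,6} {0,2,4}"
    "sep 0 5 7 {2,3,6} {0,5,7}" "sep 0 2 4 {2,3,6} {0,4,5}" "sep 1 3 5 {2,3,6} {1,4,5}"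
    "sep 1 4 6 {2,3,6} {1,4,6}" "sep 1 3 6 {2,3,6} {1,3,5}" "sep 2 4 7 {2,3,7} {2,4,7}"
    "sep 2 3 7 {2,3,7} {4,6,7}" "sep 6 3 7 {2,3,7} {5,6,7}" "sep 6 3 7 {2,3,7} {3,5,6}"
    "sep 0 2 7 {2,3,7} {0,2,4}" "sep 0 2 7 {2,3,7} {0,5,7}" "sep 0 4 7 {2,3,7} {0,4,5}"
    "sep 1 3 5 {2,3,7} {1,4,5}" "sep 1 4 6 {2,3,7} {1,4,6}" "sep 1 3 5 {2,3,7} {1,3,5}"
    "sep 4 6 7 {2,4,7} {4,6,7}" "sep 4 6 7 {2,4,7} {5,6,7}" "sep 5 6 7 {2,4,7} {3,5,6}"
    "sep 0 2 4 {2,4,7} {0,2,4}" "sep 0 5 7 {2,4,7} {0,5,7}" "sep 0 2 4 {2,4,7} {0,4,5}"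
    "sep 4 1 5 {2,4,7} {1,4,5}" "sep 1 4 6 {2,4,7} {1,4,6}" "sep 4 1 5 {2,4,7} {1,3,5}"
    "sep 4 6 7 {4,6,7} {5,6,7}" "sep 5 6 7 {4,6,7} {3,5,6}" "sep 0 2 4 {4,6,7} {0,2,4}"
    "sep 0 5 7 {4,6,7} {0,5,7}" "sep 0 4 5 {4,6,7} {0,4,5}" "sep 5 4 6 {4,6,7} {1,4,5}"
    "sep 4 6 7 {4,6,7} {1,4,6}" "sep 4 1 5 {4,6,7} {1,3,5}" "sep 5 6 7 {5,6,7} {3,5,6}"
    "sep 6 5 7 {5,6,7} {0,2,4}" "sep 6 5 7 {5,6,7} {0,5,7}" "sep 4 5 7 {5,6,7} {0,4,5}"
    "sep 5 4 6 {5,6,7} {1,4,5}" "sep 5 4 6 {5,6,7} {1,4,6}" "sep 3 5 6 {5,6,7} {1,3,5}"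
    "sep 0 4 5 {3,5,6} {0,2,4}" "sep 0 5 7 {3,5,6} {0,5,7}" "sep 0 4 5 {3,5,6} {0,4,5}"
    "sep 1 5 6 {3,5,6} {1,4,5}" "sep 1 5 6 {3,5,6} {1,4,6}" "sep 1 3 5 {3,5,6} {1,3,5}"
    "sep 0 4 7 {0,2,4} {0,5,7}" "sep 4 0 5 {0,2,4} {0,4,5}" "sep 4 0 5 {0,2,4} {1,4,5}"
    "sep 2 1 4 {0,2,4} {1,4,6}" "sep 4 1 5 {0,2,4} {1,3,5}" "sep 5 0 7 {0,5,7} {0,4,5}"
    "sep 5 4 7 {0,5,7} {1,4,5}" "sep 5 4 7 {0,5,7} {1,4,6}" "sep 1 3 5 {0,5,7} {1,3,5}"
    "sep 4 1 5 {0,4,5} {1,4,5}" "sep 5 4 6 {0,4,5} {1,4,6}" "sep 4 1 5 {0,4,5} {1,3,5}"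
    "sep 1 4 5 {1,4,5} {1,4,6}" "sep 4 1 5 {1,4,5} {1,3,5}" "sep 4 1 5 {1,4,6} {1,3,5}"
    unfolding sep_def
    by (simp_all add: separatingI det4_sort q le ne del: One_nat_def)
qed


lemma separating_facets:
  assumes signs: "tent_signs X Y Z"
  shows "separating X Y Z 0 3 7 {0,3,7} {0,3,7}" "separating X Y Z 0 1 3 {0,1,3} {0,1,3}"
    "separating X Y Z 0 1 2 {0,1,2} {0,1,2}" "separating X Y Z 1 2 6 {1,2,6} {1,2,6}"
    "separating X Y Z 2 3 6 {2,3,6} {2,3,6}" "separating X Y Z 2 3 7 {2,3,7} {2,3,7}"
    "separating X Y Z 2 4 7 {2,4,7} {2,4,7}" "separating X Y Z 4 6 7 {4,6,7} {4,6,7}"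
    "separating X Y Z 5 6 7 {5,6,7} {5,6,7}" "separating X Y Z 3 5 6 {3,5,6} {3,5,6}"
    "separating X Y Z 0 2 4 {0,2,4} {0,2,4}" "separating X Y Z 0 5 7 {0,5,7} {0,5,7}"
    "separating X Y Z 0 4 5 {0,4,5} {0,4,5}" "separating X Y Z 1 4 5 {1,4,5} {1,4,5}"
    "separating X Y Z 1 4 6 {1,4,6} {1,4,6}" "separating X Y Z 1 3 5 {1,3,5} {1,3,5}"
  using signs[unfolded tent_signs_def]
  by (simp_all add: separating_refl[of X Y Z 0 3 7 1] separating_refl[of X Y Z 0 1 3 2] separating_refl[of X Y Z 0 1 2 3]
      separating_refl[of X Y Z 1 2 6 0] separating_refl[of X Y Z 2 3 6 1] separating_refl[of X Y Z 2 3 7 0]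
      separating_refl[of X Y Z 2 4 7 0] separating_refl[of X Y Z 4 6 7 1] separating_refl[of X Y Z 5 6 7 0]
      separating_refl[of X Y Z 3 5 6 1] separating_refl[of X Y Z 0 2 4 1] separating_refl[of X Y Z 0 5 7 2]
      separating_refl[of X Y Z 0 4 5 1] separating_refl[of X Y Z 1 4 5 0] separating_refl[of X Y Z 1 4 6 2]
      separating_refl[of X Y Z 1 3 5 0]
      det4_sort del: One_nat_def)

lemma facets_eq: "facets = {{0,3,7}, {0,1,3}, {0,1,2}, {1,2,6}, {2,3,6}, {2,3,7}, {2,4,7}, {4,6,7}, {5,6,7}, {3,5,6},
    {0,2,4}, {0,5,7}, {0,4,5}, {1,4,5}, {1,4,6}, {1,3,5}}" (is "_ = ?R")
proof -
  have "facets = cell_facets False False \<union> cell_facets False True \<union> cell_facets True True \<union> cell_facets True False"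
    unfolding facets_def by (simp only: UNIV_bool UN_insert UN_empty Un_empty_left Un_empty_right Un_ac)
  also have "\<dots> = ?R" unfolding cell_facets_def by (simp only: if_True if_False Un_insert_left Un_empty_left)
  finally show ?thesis .
qed

lemma facet_subset: "s \<in> facets \<Longrightarrow> s \<subseteq> {..<8}" and facet_card: "s \<in> facets \<Longrightarrow> card s = 3"
  unfolding facets_eq by auto

text \<open>This is embeddedness: two triangles of the tent share only the points of their common face.\<close>

lemma tent_weights_eq:
  assumes signs: "tent_signs X Y Z" and st: "s \<in> facets" "t \<in> facets"
    and w: "weights_on s w" "weights_on t w'"
    and eq: "(\<Sum>v<8. w v * X v) = (\<Sum>v<8. w' v * X v)" "(\<Sum>v<8. w v * Y v) = (\<Sum>v<8. w' v * Y v)"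
      "(\<Sum>v<8. w v * Z v) = (\<Sum>v<8. w' v * Z v)"
  shows "w = w'"
proof -
  define P where "P s t \<longleftrightarrow> (\<exists>a b c. separating X Y Z a b c s t)" for s t
  have P: "separating X Y Z a b c s t \<Longrightarrow> P s t" "separating X Y Z a b c s t \<Longrightarrow> P t s" for a b c s t
    unfolding P_def using separating_sym by blast+
  note rows = separating_planes[OF signs, THEN P(1)] separating_planes[OF signs, THEN P(2)] separating_facets[OF signs, THEN P(1)]
  have "\<forall>s\<in>facets. \<forall>t\<in>facets. P s t"
    unfolding facets_eq by (simp only: ball_simps rows simp_thms)
  then obtain a b c where "separating X Y Z a b c s t" using st unfolding P_def by blast
  then show ?thesis
    by (rule separating_weights_eq[OF _ facet_subset[OF st(1)] facet_subset[OF st(2)] w eq])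
qed

section \<open>Thin tents satisfy the sign conditions\<close>

definition tent_x :: "real \<Rightarrow> real \<Rightarrow> real \<Rightarrow> real \<Rightarrow> real \<Rightarrow> nat \<Rightarrow> real" where
  "tent_x lam A hx del qx v = [- lam, lam, - A, A, - qx, qx, hx - del, del - hx] ! v"

definition tent_y :: "real \<Rightarrow> real \<Rightarrow> nat \<Rightarrow> real" where
  "tent_y R qy v = [0, 0, 1/2, - 1/2, - qy, qy, R, - R] ! v"

definition tent_z :: "real \<Rightarrow> real \<Rightarrow> nat \<Rightarrow> real" where
  "tent_z eps tau v = [- tau, - tau, 0, 0, eps - tau, eps - tau, tau, tau] ! v"

text \<open>The tent becomes flat, so its determinants tend to zero; rescaling the heights by \<open>e\<close> restores a limit without
  affecting the sign.\<close>

lemma det4_sign_eventually: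
  fixes X Y Z :: "nat \<Rightarrow> nat \<Rightarrow> real" and x y z :: "nat \<Rightarrow> real" and e :: "nat \<Rightarrow> real"
  assumes lim: "\<And>v. v \<in> S \<Longrightarrow> (\<lambda>j. X j v) \<longlonglongrightarrow> x v" "\<And>v. v \<in> S \<Longrightarrow> (\<lambda>j. Y j v) \<longlonglongrightarrow> y v"
      "\<And>v. v \<in> S \<Longrightarrow> (\<lambda>j. Z j v / e j) \<longlonglongrightarrow> z v"
    and e: "\<And>j. 0 < e j" and S: "{a, b, c, d} \<subseteq> S"
  shows "0 < det4 x y z a b c d \<Longrightarrow> \<forall>\<^sub>F j in sequentially. 0 < det4 (X j) (Y j) (Z j) a b c d"
    and "det4 x y z a b c d < 0 \<Longrightarrow> \<forall>\<^sub>F j in sequentially. det4 (X j) (Y j) (Z j) a b c d < 0"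
proof -
  have "(\<lambda>j. det4 (X j) (Y j) (\<lambda>v. Z j v / e j) a b c d) \<longlonglongrightarrow> det4 x y z a b c d"
    unfolding det4_def using S by (intro tendsto_intros lim) auto
  moreover have "det4 (X j) (Y j) (\<lambda>v. Z j v / e j) a b c d = det4 (X j) (Y j) (Z j) a b c d / e j" for j
    using e[of j] by (simp add: det4_def field_simps)
  ultimately have l: "(\<lambda>j. det4 (X j) (Y j) (Z j) a b c d / e j) \<longlonglongrightarrow> det4 x y z a b c d" by simp
  have e': "0 < r / e j \<longleftrightarrow> 0 < r" "r / e j < 0 \<longleftrightarrow> r < 0" for r j
    using e[of j] by (simp_all add: zero_less_divide_iff divide_less_0_iff not_less_iff_gr_or_eq)
  show "\<forall>\<^sub>F j in sequentially. 0 < det4 (X j) (Y j) (Z j) a b c d" if "0 < det4 x y z a b c d"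
    using order_tendstoD(1)[OF l that] by eventually_elim (simp only: e')
  show "\<forall>\<^sub>F j in sequentially. det4 (X j) (Y j) (Z j) a b c d < 0" if "det4 x y z a b c d < 0"
    using order_tendstoD(2)[OF l that] by eventually_elim (simp only: e')
qed

text \<open>Heights are rescaled by \<open>eps\<close> for most quadruples. Those that avoid the vertices \<open>4\<close> and \<open>5\<close> have height of order
  \<open>tau\<close> and are rescaled by \<open>tau\<close>; for the quadruples that are still degenerate the sign is read off
  from the expanded determinant and the limit \<open>off\<close>.\<close>

lemma tent_signs_eventually:
  fixes lam eps tau del hx R A qx qy :: "nat \<Rightarrow> real"
  assumes pos: "\<And>j. 0 < eps j" "\<And>j. 0 < tau j"
    and lim: "lam \<longlonglongrightarrow> 1/2" "eps \<longlonglongrightarrow> 0" "(\<lambda>j. tau j / eps j ^ 3) \<longlonglongrightarrow> 0" "del \<longlonglongrightarrow> 0" "hx \<longlonglongrightarrow> 1/2"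
      "R \<longlonglongrightarrow> 1/2" "A \<longlonglongrightarrow> 1/2" "qx \<longlonglongrightarrow> -1/4" "qy \<longlonglongrightarrow> -1/2"
    and off: "(\<lambda>j. (R j * (lam j - A j) + (lam j - hx j + del j) / 2) / (eps j)\<^sup>2) \<longlonglongrightarrow> 1/6"
  shows "\<forall>\<^sub>F j in sequentially. tent_signs (tent_x (lam j) (A j) (hx j) (del j) (qx j)) (tent_y (R j) (qy j)) (tent_z (eps j) (tau j))"
proof -
  define X where "X = (\<lambda>j. tent_x (lam j) (A j) (hx j) (del j) (qx j))"
  define Y where "Y = (\<lambda>j. tent_y (R j) (qy j))"
  define Z where "Z = (\<lambda>j. tent_z (eps j) (tau j))"
  define x where "x = (\<lambda>v. [- 1/2, 1/2, - 1/2, 1/2, 1/4, - 1/4, 1/2, - 1/2 :: real] ! v)"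
  define y where "y = (\<lambda>v. [0, 0, 1/2, - 1/2, 1/2, - 1/2, 1/2, - 1/2 :: real] ! v)"
  define z where "z = (\<lambda>v. [0, 0, 0, 0, 1, 1, 0, 0 :: real] ! v)"
  define z' where "z' = (\<lambda>v. [- 1, - 1, 0, 0, 0, 0, 1, 1 :: real] ! v)"
  have te: "(\<lambda>j. tau j / eps j) \<longlonglongrightarrow> 0"
  proof -
    have "(\<lambda>j. tau j / eps j ^ 3 * (eps j)\<^sup>2) \<longlonglongrightarrow> 0" by (rule tendsto_eq_intros lim refl | simp)+
    moreover have "tau j / eps j ^ 3 * (eps j)\<^sup>2 = tau j / eps j" for j
      using pos(1)[of j] by (simp add: power2_eq_square power3_eq_cube)
    ultimately show ?thesis by simp
  qed
  have lists: "v \<in> {..<8} \<Longrightarrow> v = 0 \<or> v = 1 \<or> v = 2 \<or> v = 3 \<or> v = 4 \<or> v = 5 \<or> v = 6 \<or> v = 7" for v :: nat by auto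
  have aux: "(\<lambda>j. - lam j) \<longlonglongrightarrow> - (1/2)" "(\<lambda>j. - A j) \<longlonglongrightarrow> - (1/2)" "(\<lambda>j. - qx j) \<longlonglongrightarrow> 1/4" "(\<lambda>j. - qy j) \<longlonglongrightarrow> 1/2"
    "(\<lambda>j. - R j) \<longlonglongrightarrow> - (1/2)" "(\<lambda>j. hx j - del j) \<longlonglongrightarrow> 1/2" "(\<lambda>j. del j - hx j) \<longlonglongrightarrow> - (1/2)"
    using tendsto_minus[OF lim(1)] tendsto_minus[OF lim(7)] tendsto_minus[OF lim(8)] tendsto_minus[OF lim(9)] tendsto_minus[OF lim(6)]
      tendsto_diff[OF lim(5,4)] tendsto_diff[OF lim(4,5)] by simp_all
  have lX: "(\<lambda>j. X j v) \<longlonglongrightarrow> x v" if "v \<in> {..<8}" for v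
    using lists[OF that] aux lim by (elim disjE) (simp_all add: X_def x_def tent_x_def)
  have lY: "(\<lambda>j. Y j v) \<longlonglongrightarrow> y v" if "v \<in> {..<8}" for v
    using lists[OF that] aux lim by (elim disjE) (simp_all add: Y_def y_def tent_y_def)
  have lZ: "(\<lambda>j. Z j v / eps j) \<longlonglongrightarrow> z v" if "v \<in> {..<8}" for v
  proof -
    have "eps j / eps j = 1" for j using pos(1)[of j] by simp
    then show ?thesis
      using lists[OF that] tendsto_minus[OF te] tendsto_diff[OF tendsto_const[of 1] te] te
      by (elim disjE) (simp_all add: Z_def z_def tent_z_def diff_divide_distrib)
  qed
  have lZ': "(\<lambda>j. Z j v / tau j) \<longlonglongrightarrow> z' v" if "v \<in> {0, 1, 2, 3, 6, 7}" for v
  proof -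
    have "tau j / tau j = 1" "tau j \<noteq> 0" for j using pos(2)[of j] by simp_all
    then show ?thesis using that by (auto simp: Z_def z'_def tent_z_def)
  qed
  have lXb: "(\<lambda>j. X j v) \<longlonglongrightarrow> x v" and lYb: "(\<lambda>j. Y j v) \<longlonglongrightarrow> y v" if "v \<in> {0, 1, 2, 3, 6, 7}" for v
    using that by (auto intro!: lX lY)
  note base = det4_sign_eventually[of "{0, 1, 2, 3, 6, 7}" X x Y y Z tau z', OF lXb lYb lZ' pos(2)]
  note tent = det4_sign_eventually[of "{..<8}" X x Y y Z eps z, OF lX lY lZ pos(1)]
  have b1: "\<forall>\<^sub>F j in sequentially. 0 < det4 (X j) (Y j) (Z j) 0 1 2 3"
    "\<forall>\<^sub>F j in sequentially. 0 < det4 (X j) (Y j) (Z j) 0 1 2 6"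
    "\<forall>\<^sub>F j in sequentially. 0 < det4 (X j) (Y j) (Z j) 0 1 2 7"
    "\<forall>\<^sub>F j in sequentially. 0 < det4 (X j) (Y j) (Z j) 0 3 6 7"
    "\<forall>\<^sub>F j in sequentially. 0 < det4 (X j) (Y j) (Z j) 1 2 3 6"
    "\<forall>\<^sub>F j in sequentially. 0 < det4 (X j) (Y j) (Z j) 2 3 6 7"
    by (rule base(1); simp add: det4_def x_def y_def z'_def)+
  have b2: "\<forall>\<^sub>F j in sequentially. det4 (X j) (Y j) (Z j) 0 1 3 6 < 0"
    "\<forall>\<^sub>F j in sequentially. det4 (X j) (Y j) (Z j) 0 1 3 7 < 0"
    "\<forall>\<^sub>F j in sequentially. det4 (X j) (Y j) (Z j) 0 2 3 7 < 0"
    "\<forall>\<^sub>F j in sequentially. det4 (X j) (Y j) (Z j) 0 2 6 7 < 0"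
    "\<forall>\<^sub>F j in sequentially. det4 (X j) (Y j) (Z j) 1 2 6 7 < 0"
    by (rule base(2); simp add: det4_def x_def y_def z'_def)+
  have t1: "\<forall>\<^sub>F j in sequentially. 0 < det4 (X j) (Y j) (Z j) 0 1 2 4"
    "\<forall>\<^sub>F j in sequentially. 0 < det4 (X j) (Y j) (Z j) 0 1 2 5"
    "\<forall>\<^sub>F j in sequentially. 0 < det4 (X j) (Y j) (Z j) 0 1 4 5"
    "\<forall>\<^sub>F j in sequentially. 0 < det4 (X j) (Y j) (Z j) 0 2 4 6"
    "\<forall>\<^sub>F j in sequentially. 0 < det4 (X j) (Y j) (Z j) 0 3 4 5"
    "\<forall>\<^sub>F j in sequentially. 0 < det4 (X j) (Y j) (Z j) 0 3 4 7"
    "\<forall>\<^sub>F j in sequentially. 0 < det4 (X j) (Y j) (Z j) 0 3 5 7"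
    "\<forall>\<^sub>F j in sequentially. 0 < det4 (X j) (Y j) (Z j) 0 4 5 6"
    "\<forall>\<^sub>F j in sequentially. 0 < det4 (X j) (Y j) (Z j) 0 4 5 7"
    "\<forall>\<^sub>F j in sequentially. 0 < det4 (X j) (Y j) (Z j) 1 2 3 5"
    "\<forall>\<^sub>F j in sequentially. 0 < det4 (X j) (Y j) (Z j) 1 2 4 6"
    "\<forall>\<^sub>F j in sequentially. 0 < det4 (X j) (Y j) (Z j) 1 3 4 5"
    "\<forall>\<^sub>F j in sequentially. 0 < det4 (X j) (Y j) (Z j) 1 3 5 7"
    "\<forall>\<^sub>F j in sequentially. 0 < det4 (X j) (Y j) (Z j) 1 4 6 7"
    "\<forall>\<^sub>F j in sequentially. 0 < det4 (X j) (Y j) (Z j) 2 3 4 7"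
    "\<forall>\<^sub>F j in sequentially. 0 < det4 (X j) (Y j) (Z j) 3 5 6 7"
    by (rule tent(1); simp add: det4_def x_def y_def z_def)+
  have t2: "\<forall>\<^sub>F j in sequentially. det4 (X j) (Y j) (Z j) 0 1 3 4 < 0"
    "\<forall>\<^sub>F j in sequentially. det4 (X j) (Y j) (Z j) 0 1 3 5 < 0"
    "\<forall>\<^sub>F j in sequentially. det4 (X j) (Y j) (Z j) 0 2 3 4 < 0"
    "\<forall>\<^sub>F j in sequentially. det4 (X j) (Y j) (Z j) 0 2 4 5 < 0"
    "\<forall>\<^sub>F j in sequentially. det4 (X j) (Y j) (Z j) 0 5 6 7 < 0"
    "\<forall>\<^sub>F j in sequentially. det4 (X j) (Y j) (Z j) 1 2 4 5 < 0"
    "\<forall>\<^sub>F j in sequentially. det4 (X j) (Y j) (Z j) 1 4 5 6 < 0"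
    "\<forall>\<^sub>F j in sequentially. det4 (X j) (Y j) (Z j) 1 4 5 7 < 0"
    "\<forall>\<^sub>F j in sequentially. det4 (X j) (Y j) (Z j) 2 3 5 6 < 0"
    "\<forall>\<^sub>F j in sequentially. det4 (X j) (Y j) (Z j) 2 4 6 7 < 0"
    "\<forall>\<^sub>F j in sequentially. det4 (X j) (Y j) (Z j) 2 5 6 7 < 0"
    "\<forall>\<^sub>F j in sequentially. det4 (X j) (Y j) (Z j) 4 5 6 7 < 0"
    by (rule tent(2); simp add: det4_def x_def y_def z_def)+
  define D where "D = (\<lambda>j. R j * (lam j - A j) + (lam j - hx j + del j) / 2)"
  have hard: "\<forall>\<^sub>F j in sequentially. 0 < d j"
    if d: "\<And>j. d j = eps j * D j + tau j * M j" and M: "M \<longlonglongrightarrow> m" for d M :: "nat \<Rightarrow> real" and m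
  proof -
    have "(\<lambda>j. D j / (eps j)\<^sup>2 + tau j / eps j ^ 3 * M j) \<longlonglongrightarrow> 1/6 + 0 * m"
      using off unfolding D_def by (rule tendsto_add[OF _ tendsto_mult[OF lim(3) M]])
    then have "\<forall>\<^sub>F j in sequentially. 0 < D j / (eps j)\<^sup>2 + tau j / eps j ^ 3 * M j" by (rule order_tendstoD) simp
    then show ?thesis
    proof eventually_elim
      case (elim j)
      have "d j = eps j ^ 3 * (D j / (eps j)\<^sup>2 + tau j / eps j ^ 3 * M j)"
        using pos(1)[of j] unfolding d by (simp add: field_simps power2_eq_square power3_eq_cube)
      then show ?case using elim pos(1)[of j] by simp
    qed
  qed
  have h1: "\<forall>\<^sub>F j in sequentially. 0 < det4 (X j) (Y j) (Z j) 0 2 4 7"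
    by (rule hard[where M = "\<lambda>j. 2 * ((lam j - A j) * (- qy j) - 1/2 * (lam j - qx j)) + ((lam j - qx j) * (- R j) + qy j * (lam j - hx j + del j))"])
      (simp add: det4_def X_def Y_def Z_def D_def tent_x_def tent_y_def tent_z_def field_simps, (rule tendsto_intros lim)+)
  have h2: "\<forall>\<^sub>F j in sequentially. 0 < det4 (X j) (Y j) (Z j) 0 2 5 7"
    by (rule hard[where M = "\<lambda>j. 2 * ((lam j - A j) * qy j - 1/2 * (lam j + qx j)) + ((lam j + qx j) * (- R j) - qy j * (lam j - hx j + del j))"])
      (simp add: det4_def X_def Y_def Z_def D_def tent_x_def tent_y_def tent_z_def field_simps, (rule tendsto_intros lim)+)
  have h3: "det4 (X j) (Y j) (Z j) 1 3 5 6 = det4 (X j) (Y j) (Z j) 0 2 4 7" "det4 (X j) (Y j) (Z j) 1 3 4 6 = det4 (X j) (Y j) (Z j) 0 2 5 7" for j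
    by (simp_all add: det4_def X_def Y_def Z_def tent_x_def tent_y_def tent_z_def algebra_simps)
  have "\<forall>\<^sub>F j in sequentially. tent_signs (X j) (Y j) (Z j)"
    unfolding tent_signs_def h3 eventually_conj_iff by (intro conjI b1 b2 t1 t2 h1 h2)
  then show ?thesis unfolding X_def Y_def Z_def .
qed

lemma pup_tent_exists:
  assumes "0 < \<eta>"
  shows "\<exists>kap lam eps tau n del hx hy R A cx cy qx qy.
    pup_tent kap lam eps tau n del hx hy R A cx cy qx qy \<and>
    tent_signs (tent_x lam A hx del qx) (tent_y R qy) (tent_z eps tau) \<and>
    \<bar>kap\<bar> < \<eta> \<and> \<bar>lam - 1/2\<bar> < \<eta> \<and> \<bar>eps\<bar> < \<eta> \<and> \<bar>tau\<bar> < \<eta> \<and> \<bar>n\<bar> < \<eta> \<and> \<bar>del\<bar> < \<eta> \<and> \<bar>hx - 1/2\<bar> < \<eta> \<and> \<bar>hy + 1/2\<bar> < \<eta> \<and>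
    \<bar>R - 1/2\<bar> < \<eta> \<and> \<bar>A - 1/2\<bar> < \<eta> \<and> \<bar>cx - 1/4\<bar> < \<eta> \<and> \<bar>cy + 1/2\<bar> < \<eta> \<and> \<bar>qx + 1/4\<bar> < \<eta> \<and> \<bar>qy + 1/2\<bar> < \<eta>"
proof -
  obtain kap lam eps tau n del hx hy R A cx cy qx qy :: "nat \<Rightarrow> real" where
    T: "(\<forall>j. pup_tent (kap j) (lam j) (eps j) (tau j) (n j) (del j) (hx j) (hy j) (R j) (A j) (cx j) (cy j) (qx j) (qy j)) \<and>
    kap \<longlonglongrightarrow> 0 \<and> lam \<longlonglongrightarrow> 1/2 \<and> eps \<longlonglongrightarrow> 0 \<and> (\<lambda>j. tau j / eps j ^ 3) \<longlonglongrightarrow> 0 \<and> n \<longlonglongrightarrow> 0 \<and> del \<longlonglongrightarrow> 0 \<and>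
    hx \<longlonglongrightarrow> 1/2 \<and> hy \<longlonglongrightarrow> -1/2 \<and> R \<longlonglongrightarrow> 1/2 \<and> A \<longlonglongrightarrow> 1/2 \<and> cx \<longlonglongrightarrow> 1/4 \<and> cy \<longlonglongrightarrow> -1/2 \<and> qx \<longlonglongrightarrow> -1/4 \<and> qy \<longlonglongrightarrow> -1/2 \<and>
    (\<lambda>j. (R j * (lam j - A j) + (lam j - hx j + del j) / 2) / (eps j)\<^sup>2) \<longlonglongrightarrow> 1/6"
    using pup_tents_collapse by (elim exE) (rule that, assumption)
  note lims = T[THEN conjunct2]
  have s: "pup_tent (kap j) (lam j) (eps j) (tau j) (n j) (del j) (hx j) (hy j) (R j) (A j) (cx j) (cy j) (qx j) (qy j)" for j
    using T by (elim conjE) (rule spec)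
  have lim: "kap \<longlonglongrightarrow> 0" "lam \<longlonglongrightarrow> 1/2" "eps \<longlonglongrightarrow> 0" "(\<lambda>j. tau j / eps j ^ 3) \<longlonglongrightarrow> 0" "n \<longlonglongrightarrow> 0" "del \<longlonglongrightarrow> 0"
    "hx \<longlonglongrightarrow> 1/2" "hy \<longlonglongrightarrow> -1/2" "R \<longlonglongrightarrow> 1/2" "A \<longlonglongrightarrow> 1/2" "cx \<longlonglongrightarrow> 1/4" "cy \<longlonglongrightarrow> -1/2" "qx \<longlonglongrightarrow> -1/4" "qy \<longlonglongrightarrow> -1/2"
    "(\<lambda>j. (R j * (lam j - A j) + (lam j - hx j + del j) / 2) / (eps j)\<^sup>2) \<longlonglongrightarrow> 1/6"
    using lims by (simp_all only: simp_thms)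
  have pos: "0 < eps j" "0 < tau j" for j
    using s[of j, unfolded pup_tent_def, THEN conjunct1] s[of j, unfolded pup_tent_def, THEN conjunct2, THEN conjunct1] by simp_all
  have tau: "tau \<longlonglongrightarrow> 0"
  proof -
    have "(\<lambda>j. tau j / eps j ^ 3 * eps j ^ 3) \<longlonglongrightarrow> 0" by (rule tendsto_eq_intros lim refl | simp)+
    moreover have "tau j / eps j ^ 3 * eps j ^ 3 = tau j" for j using pos(1)[of j] by simp
    ultimately show ?thesis by simp
  qed
  have ev: "\<forall>\<^sub>F j in sequentially. \<bar>f j - l\<bar> < \<eta>" if "f \<longlonglongrightarrow> l" for f :: "nat \<Rightarrow> real" and l
    using tendstoD[OF that assms] by (simp add: dist_real_def)
  have "\<forall>\<^sub>F j in sequentially. tent_signs (tent_x (lam j) (A j) (hx j) (del j) (qx j)) (tent_y (R j) (qy j)) (tent_z (eps j) (tau j)) \<and>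
    \<bar>kap j\<bar> < \<eta> \<and> \<bar>lam j - 1/2\<bar> < \<eta> \<and> \<bar>eps j\<bar> < \<eta> \<and> \<bar>tau j\<bar> < \<eta> \<and> \<bar>n j\<bar> < \<eta> \<and> \<bar>del j\<bar> < \<eta> \<and> \<bar>hx j - 1/2\<bar> < \<eta> \<and> \<bar>hy j + 1/2\<bar> < \<eta> \<and>
    \<bar>R j - 1/2\<bar> < \<eta> \<and> \<bar>A j - 1/2\<bar> < \<eta> \<and> \<bar>cx j - 1/4\<bar> < \<eta> \<and> \<bar>cy j + 1/2\<bar> < \<eta> \<and> \<bar>qx j + 1/4\<bar> < \<eta> \<and> \<bar>qy j + 1/2\<bar> < \<eta>"
    using tent_signs_eventually[OF pos lim(2,3,4,6,7,9,10,13,14,15)] ev[OF lim(1)] ev[OF lim(2)] ev[OF lim(3)] ev[OF tau] ev[OF lim(5)] ev[OF lim(6)]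
      ev[OF lim(7)] ev[OF lim(8)] ev[OF lim(9)] ev[OF lim(10)] ev[OF lim(11)] ev[OF lim(12)] ev[OF lim(13)] ev[OF lim(14)]
    by eventually_elim simp
  from eventually_happens'[OF sequentially_bot this] obtain j where
    J: "tent_signs (tent_x (lam j) (A j) (hx j) (del j) (qx j)) (tent_y (R j) (qy j)) (tent_z (eps j) (tau j)) \<and>
    \<bar>kap j\<bar> < \<eta> \<and> \<bar>lam j - 1/2\<bar> < \<eta> \<and> \<bar>eps j\<bar> < \<eta> \<and> \<bar>tau j\<bar> < \<eta> \<and> \<bar>n j\<bar> < \<eta> \<and> \<bar>del j\<bar> < \<eta> \<and> \<bar>hx j - 1/2\<bar> < \<eta> \<and> \<bar>hy j + 1/2\<bar> < \<eta> \<and>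
    \<bar>R j - 1/2\<bar> < \<eta> \<and> \<bar>A j - 1/2\<bar> < \<eta> \<and> \<bar>cx j - 1/4\<bar> < \<eta> \<and> \<bar>cy j + 1/2\<bar> < \<eta> \<and> \<bar>qx j + 1/4\<bar> < \<eta> \<and> \<bar>qy j + 1/2\<bar> < \<eta>"
    by (elim exE) (rule that)
  show ?thesis
    by (rule exI[of _ "kap j"], rule exI[of _ "lam j"], rule exI[of _ "eps j"], rule exI[of _ "tau j"], rule exI[of _ "n j"],
      rule exI[of _ "del j"], rule exI[of _ "hx j"], rule exI[of _ "hy j"], rule exI[of _ "R j"], rule exI[of _ "A j"],
      rule exI[of _ "cx j"], rule exI[of _ "cy j"], rule exI[of _ "qx j"], rule exI[of _ "qy j"]) (rule conjI[OF s J])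
qed

section \<open>The fold of the unit square\<close>

text \<open>Vertex positions in the folded square \<open>[0,1/2]\<^sup>2\<close>.\<close>

definition fold_x :: "nat \<Rightarrow> real" where
  "fold_x v = (if v \<in> {1, 3, 6} then 1/2 else if v = 4 then 3/8 else if v = 5 then 1/8 else 0)"

definition fold_y :: "nat \<Rightarrow> real" where
  "fold_y v = (if v \<in> {2, 4, 6} then 1/2 else if v \<in> {0, 1} then 1/4 else 0)"

text \<open>An extra vertex above the plane, so that lines in the plane become planes through vertex \<open>8\<close> and the results on
  separating planes apply to the flat configuration.\<close>

definition apex :: "nat \<Rightarrow> real" where
  "apex v = (if v = 8 then 1 else 0)"

lemma fold_vals [simp]:
  "fold_x 0 = 0" "fold_x 1 = 1/2" "fold_x (Suc 0) = 1/2" "fold_x 2 = 0" "fold_x 3 = 1/2"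
  "fold_x 4 = 3/8" "fold_x 5 = 1/8" "fold_x 6 = 1/2" "fold_x 7 = 0"
  "fold_y 0 = 1/4" "fold_y 1 = 1/4" "fold_y (Suc 0) = 1/4" "fold_y 2 = 1/2" "fold_y 3 = 0"
  "fold_y 4 = 1/2" "fold_y 5 = 0" "fold_y 6 = 1/2" "fold_y 7 = 0"
  by (simp_all add: fold_x_def fold_y_def)

lemma fold_bounds: "0 \<le> fold_x v" "fold_x v \<le> 1/2" "0 \<le> fold_y v" "fold_y v \<le> 1/2"
  by (auto simp: fold_x_def fold_y_def)

lemma separating_lines:
  defines "sep \<equiv> separating fold_x fold_y apex"
  shows
    "sep 0 3 8 {0,3,7} {0,1,3}" "sep 0 3 8 {0,3,7} {0,1,2}" "sep 2 3 8 {0,3,7} {1,2,6}"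
    "sep 0 1 8 {0,1,3} {0,1,2}" "sep 2 1 8 {0,1,3} {1,2,6}" "sep 2 1 8 {0,1,2} {1,2,6}"
    "sep 3 2 8 {2,3,6} {2,3,7}" "sep 4 7 8 {2,4,7} {4,6,7}" "sep 6 7 8 {2,4,7} {5,6,7}"
    "sep 6 7 8 {2,4,7} {3,5,6}" "sep 6 7 8 {4,6,7} {5,6,7}" "sep 6 7 8 {4,6,7} {3,5,6}"
    "sep 6 5 8 {5,6,7} {3,5,6}" "sep 5 0 8 {0,2,4} {0,5,7}" "sep 4 0 8 {0,2,4} {0,4,5}"
    "sep 4 5 8 {0,2,4} {1,4,5}" "sep 4 1 8 {0,2,4} {1,4,6}" "sep 4 5 8 {0,2,4} {1,3,5}"
    "sep 0 5 8 {0,5,7} {0,4,5}" "sep 4 5 8 {0,5,7} {1,4,5}" "sep 4 5 8 {0,5,7} {1,4,6}"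
    "sep 1 5 8 {0,5,7} {1,3,5}" "sep 4 5 8 {0,4,5} {1,4,5}" "sep 4 5 8 {0,4,5} {1,4,6}"
    "sep 4 5 8 {0,4,5} {1,3,5}" "sep 4 1 8 {1,4,5} {1,4,6}" "sep 1 5 8 {1,4,5} {1,3,5}"
    "sep 1 5 8 {1,4,6} {1,3,5}"
  unfolding sep_def
  by (simp_all add: separatingI det4_def fold_x_def fold_y_def apex_def)

lemma separating_cell_facets:
  defines "sep \<equiv> separating fold_x fold_y apex"
  shows
    "sep 0 3 7 {0,3,7} {0,3,7}" "sep 0 1 3 {0,1,3} {0,1,3}" "sep 0 1 2 {0,1,2} {0,1,2}"
    "sep 1 2 6 {1,2,6} {1,2,6}" "sep 2 3 6 {2,3,6} {2,3,6}" "sep 2 3 7 {2,3,7} {2,3,7}"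
    "sep 2 4 7 {2,4,7} {2,4,7}" "sep 4 6 7 {4,6,7} {4,6,7}" "sep 5 6 7 {5,6,7} {5,6,7}"
    "sep 3 5 6 {3,5,6} {3,5,6}" "sep 0 2 4 {0,2,4} {0,2,4}" "sep 0 5 7 {0,5,7} {0,5,7}"
    "sep 0 4 5 {0,4,5} {0,4,5}" "sep 1 4 5 {1,4,5} {1,4,5}" "sep 1 4 6 {1,4,6} {1,4,6}"
    "sep 1 3 5 {1,3,5} {1,3,5}"
  unfolding sep_def
  by (rule separating_refl[where d = 8], simp add: det4_def fold_x_def fold_y_def apex_def)+

lemma cell_weights_eq:
  assumes st: "s \<in> cell_facets i j" "t \<in> cell_facets i j" and w: "weights_on s w" "weights_on t w'"
    and eq: "(\<Sum>v<8. w v * fold_x v) = (\<Sum>v<8. w' v * fold_x v)" "(\<Sum>v<8. w v * fold_y v) = (\<Sum>v<8. w' v * fold_y v)"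
  shows "w = w'"
proof -
  define P where "P s t \<longleftrightarrow> (\<exists>a b c. separating fold_x fold_y apex a b c s t)" for s t
  have P: "separating fold_x fold_y apex a b c s t \<Longrightarrow> P s t" "separating fold_x fold_y apex a b c s t \<Longrightarrow> P t s" for a b c s t
    unfolding P_def using separating_sym by blast+
  note rows = separating_lines[THEN P(1)] separating_lines[THEN P(2)] separating_cell_facets[THEN P(1)]
  have "\<forall>s\<in>cell_facets i j. \<forall>t\<in>cell_facets i j. P s t"
    unfolding cell_facets_def by (cases i; cases j) (simp_all only: if_True if_False ball_simps rows simp_thms)
  then obtain a b c where sep: "separating fold_x fold_y apex a b c s t" using st unfolding P_def by blast
  have f: "s \<in> facets" "t \<in> facets" using st unfolding facets_def by auto
  have z: "(\<Sum>v<8. u v * apex v) = 0" for u by (rule sum.neutral) (simp add: apex_def)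
  show ?thesis
    by (rule separating_weights_eq[OF sep facet_subset[OF f(1)] facet_subset[OF f(2)] w eq]) (simp add: z)
qed

text \<open>The triangulations of adjacent cells agree along the common side.\<close>

lemma cell_border:
  shows "\<forall>t\<in>cell_facets i j. \<exists>t'\<in>cell_facets (\<not> i) j. \<forall>v\<in>t. fold_x v = 0 \<longrightarrow> v \<in> t'"
    and "\<forall>t\<in>cell_facets i j. \<exists>t'\<in>cell_facets (\<not> i) j. \<forall>v\<in>t. fold_x v = 1/2 \<longrightarrow> v \<in> t'"
    and "\<forall>t\<in>cell_facets i j. \<exists>t'\<in>cell_facets i (\<not> j). \<forall>v\<in>t. fold_y v = 0 \<longrightarrow> v \<in> t'"
    and "\<forall>t\<in>cell_facets i j. \<exists>t'\<in>cell_facets i (\<not> j). \<forall>v\<in>t. fold_y v = 1/2 \<longrightarrow> v \<in> t'"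
  unfolding cell_facets_def by (cases i; cases j; simp)+

lemma weights_onD:
  assumes "weights_on s w"
  shows "0 \<le> w v" "v \<notin> s \<Longrightarrow> w v = 0" "(\<Sum>v<8. w v) = 1"
  using assms unfolding weights_on_def by auto

lemma weights_on_mono: "weights_on s w \<Longrightarrow> (\<And>v. w v \<noteq> 0 \<Longrightarrow> v \<in> t) \<Longrightarrow> weights_on t w"
  unfolding weights_on_def by blast

lemma weights_extreme:
  assumes w: "weights_on s w" and s: "s \<subseteq> {..<8}" and f: "\<And>v. f v \<le> c" and eq: "(\<Sum>v<8. w v * f v) = (c::real)" and v: "w v \<noteq> 0"
  shows "f v = c"
proof -
  have "(\<Sum>v<8. w v * (c - f v)) = 0"
    using eq weights_onD(3)[OF w] by (simp add: right_diff_distrib sum_subtractf sum_distrib_right[symmetric])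
  moreover have "0 \<le> w v * (c - f v)" for v using weights_onD(1)[OF w] f by simp
  ultimately have "\<forall>v\<in>{..<8}. w v * (c - f v) = 0" by (subst (asm) sum_nonneg_eq_0_iff) auto
  moreover have "v \<in> {..<8}" using weights_onD(2)[OF w] s v by blast
  ultimately have "w v * (c - f v) = 0" by blast
  then show ?thesis using v by simp
qed

text \<open>A point on a side of its cell has the same coordinates in the reflected cell.\<close>

lemma border_transport:
  assumes t: "t \<in> cell_facets i j" and w: "weights_on t w"
    and X: "i \<noteq> i' \<Longrightarrow> (\<Sum>v<8. w v * fold_x v) = 0 \<or> (\<Sum>v<8. w v * fold_x v) = 1/2"
    and Y: "j \<noteq> j' \<Longrightarrow> (\<Sum>v<8. w v * fold_y v) = 0 \<or> (\<Sum>v<8. w v * fold_y v) = 1/2"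
  shows "\<exists>t'\<in>cell_facets i' j'. weights_on t' w"
proof -
  have low: "(\<Sum>v<8. w v * f v) = 0 \<Longrightarrow> w v \<noteq> 0 \<Longrightarrow> f v = 0"
    if "weights_on s w" "s \<subseteq> {..<8}" "\<And>v. 0 \<le> f v" for s f v
    using weights_extreme[OF that(1,2), of "\<lambda>v. - f v" 0 v] that(3) by (simp add: sum_negf)
  have sub: "s \<subseteq> {..<8}" if "s \<in> cell_facets i j" for s i j
    using that facet_subset unfolding facets_def by blast
  have "\<exists>t1\<in>cell_facets i' j. weights_on t1 w"
  proof (cases "i = i'")
    case False
    then have i': "i' = (\<not> i)" by auto
    from X[OF False] show ?thesis
    proof
      assume 0: "(\<Sum>v<8. w v * fold_x v) = 0"
      obtain t1 where "t1 \<in> cell_facets i' j" and sub1: "\<forall>v\<in>t. fold_x v = 0 \<longrightarrow> v \<in> t1"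
        using bspec[OF cell_border(1) t] unfolding i' by blast
      moreover have "weights_on t1 w"
        by (rule weights_on_mono[OF w]) (use low[OF w sub[OF t] fold_bounds(1) 0] weights_onD(2)[OF w] sub1 in blast)
      ultimately show ?thesis by blast
    next
      assume 0: "(\<Sum>v<8. w v * fold_x v) = 1/2"
      obtain t1 where "t1 \<in> cell_facets i' j" and sub2: "\<forall>v\<in>t. fold_x v = 1/2 \<longrightarrow> v \<in> t1"
        using bspec[OF cell_border(2) t] unfolding i' by blast
      moreover have "weights_on t1 w"
        by (rule weights_on_mono[OF w]) (use weights_extreme[OF w sub[OF t] fold_bounds(2) 0] weights_onD(2)[OF w] sub2 in blast)
      ultimately show ?thesis by blast
    qed
  qed (use t w in blast)
  then obtain t1 where t1: "t1 \<in> cell_facets i' j" and w1: "weights_on t1 w" by blast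
  show ?thesis
  proof (cases "j = j'")
    case False
    then have j': "j' = (\<not> j)" by auto
    from Y[OF False] show ?thesis
    proof
      assume 0: "(\<Sum>v<8. w v * fold_y v) = 0"
      obtain t2 where "t2 \<in> cell_facets i' j'" and sub3: "\<forall>v\<in>t1. fold_y v = 0 \<longrightarrow> v \<in> t2"
        using bspec[OF cell_border(3) t1] unfolding j' by blast
      moreover have "weights_on t2 w"
        by (rule weights_on_mono[OF w1]) (use low[OF w1 sub[OF t1] fold_bounds(3) 0] weights_onD(2)[OF w1] sub3 in blast)
      ultimately show ?thesis by blast
    next
      assume 0: "(\<Sum>v<8. w v * fold_y v) = 1/2"
      obtain t2 where "t2 \<in> cell_facets i' j'" and sub4: "\<forall>v\<in>t1. fold_y v = 1/2 \<longrightarrow> v \<in> t2"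
        using bspec[OF cell_border(4) t1] unfolding j' by blast
      moreover have "weights_on t2 w"
        by (rule weights_on_mono[OF w1]) (use weights_extreme[OF w1 sub[OF t1] fold_bounds(4) 0] weights_onD(2)[OF w1] sub4 in blast)
      ultimately show ?thesis by blast
    qed
  qed (use t1 w1 in blast)
qed

definition unfold :: "bool \<Rightarrow> real \<Rightarrow> real" where
  "unfold b x = (if b then 1 - x else x)"

text \<open>The two sheets of the fold of a circle meet only over the end points of the interval.\<close>

lemma unfold_congruent:
  assumes "unfold b x - unfold b' x' \<in> \<int>" "0 \<le> x" "x \<le> 1/2" "0 \<le> x'" "x' \<le> 1/2"
  shows "x = x'" and "b \<noteq> b' \<Longrightarrow> x = 0 \<or> x = 1/2"
proof -
  obtain m where m: "unfold b x - unfold b' x' = of_int m" using assms(1) by (elim Ints_cases)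
  have "x = x' \<and> (b \<noteq> b' \<longrightarrow> x = 0 \<or> x = 1/2)"
  proof (cases "b = b'")
    case True
    then have "\<bar>x - x'\<bar> = \<bar>of_int m\<bar>" using m unfolding unfold_def by (auto split: if_splits)
    moreover have "\<bar>x - x'\<bar> < 1" using assms by auto
    ultimately have "\<bar>m\<bar> < 1" by linarith
    then show ?thesis using True m unfolding unfold_def by (auto split: if_splits)
  next
    case False
    define k where "k = (if b then 1 - m else m + 1)"
    have k: "x + x' = of_int k"
      using m False unfolding unfold_def k_def by (cases b; cases b') auto
    have "0 \<le> x + x'" "x + x' \<le> 1" using assms by auto
    then have "k = 0 \<or> k = 1" using k by linarith
    then show ?thesis
    proof
      assume "k = 0" then show ?thesis using k assms(2,4) by simp
    next
      assume "k = 1" then show ?thesis using k assms(3,5) by simp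
    qed
  qed
  then show "x = x'" and "b \<noteq> b' \<Longrightarrow> x = 0 \<or> x = 1/2" by auto
qed

lemma vec2_eq: "(x::real^2) = y \<longleftrightarrow> x $ 1 = y $ 1 \<and> x $ 2 = y $ 2"
  by (simp add: vec_eq_iff forall_2)

definition pos :: "bool \<Rightarrow> bool \<Rightarrow> nat \<Rightarrow> real^2" where
  "pos i j v = vector [unfold i (fold_x v), unfold j (fold_y v)]"

definition comb :: "(nat \<Rightarrow> real) \<Rightarrow> (nat \<Rightarrow> 'a) \<Rightarrow> 'a::real_vector" where
  "comb w p = (\<Sum>v<8. w v *\<^sub>R p v)"

lemma comb_nth: "comb w p $ k = (\<Sum>v<8. w v * (p v $ k))"
  by (simp add: comb_def)

lemma comb_pos_nth:
  assumes "weights_on s w"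
  shows "comb w (pos i j) $ 1 = unfold i (\<Sum>v<8. w v * fold_x v)" "comb w (pos i j) $ 2 = unfold j (\<Sum>v<8. w v * fold_y v)"
  using weights_onD(3)[OF assms]
  by (simp_all add: comb_nth pos_def unfold_def right_diff_distrib sum_subtractf)

lemma fold_comb_bounds:
  assumes "weights_on s w"
  shows "0 \<le> (\<Sum>v<8. w v * fold_x v)" "(\<Sum>v<8. w v * fold_x v) \<le> 1/2" "0 \<le> (\<Sum>v<8. w v * fold_y v)" "(\<Sum>v<8. w v * fold_y v) \<le> 1/2"
proof -
  have "(\<Sum>v<8. w v * f v) \<le> 1/2" if "\<And>v. f v \<le> 1/2" for f :: "nat \<Rightarrow> real"
  proof -
    have "(\<Sum>v<8. w v * f v) \<le> (\<Sum>v<8. w v * (1/2))"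
      by (intro sum_mono mult_left_mono that weights_onD(1)[OF assms])
    also have "\<dots> = (\<Sum>v<8. w v) * (1/2)" by (rule sum_distrib_right[symmetric])
    finally show ?thesis using weights_onD(3)[OF assms] by simp
  qed
  then show "(\<Sum>v<8. w v * fold_x v) \<le> 1/2" "(\<Sum>v<8. w v * fold_y v) \<le> 1/2" using fold_bounds by auto
  show "0 \<le> (\<Sum>v<8. w v * fold_x v)" "0 \<le> (\<Sum>v<8. w v * fold_y v)"
    by (auto intro!: sum_nonneg mult_nonneg_nonneg weights_onD(1)[OF assms] fold_bounds)
qed

definition located :: "real^2 \<Rightarrow> bool \<Rightarrow> bool \<Rightarrow> nat set \<Rightarrow> (nat \<Rightarrow> real) \<Rightarrow> bool" where
  "located x i j t w \<longleftrightarrow> t \<in> cell_facets i j \<and> weights_on t w \<and> x - comb w (pos i j) \<in> square_lattice"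

lemma square_lattice_iff: "x \<in> square_lattice \<longleftrightarrow> x $ 1 \<in> \<int> \<and> x $ 2 \<in> \<int>"
  by (simp add: square_lattice_def forall_2)

lemma square_lattice_add: "x \<in> square_lattice \<Longrightarrow> y \<in> square_lattice \<Longrightarrow> x + y \<in> square_lattice"
  and square_lattice_diff: "x \<in> square_lattice \<Longrightarrow> y \<in> square_lattice \<Longrightarrow> x - y \<in> square_lattice"
  by (simp_all add: square_lattice_iff)

lemma located_unique:
  assumes a: "located x i j t w" and b: "located y i' j' t' w'" and xy: "x - y \<in> square_lattice"
  shows "w = w'"
proof -
  have w: "weights_on t w" "weights_on t' w'" and t: "t \<in> cell_facets i j" "t' \<in> cell_facets i' j'"
    using a b unfolding located_def by auto
  have l: "x - comb w (pos i j) \<in> square_lattice" "y - comb w' (pos i' j') \<in> square_lattice"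
    using a b unfolding located_def by auto
  let ?X = "\<Sum>v<8. w v * fold_x v" and ?Y = "\<Sum>v<8. w v * fold_y v" and ?X' = "\<Sum>v<8. w' v * fold_x v" and ?Y' = "\<Sum>v<8. w' v * fold_y v"
  have "comb w (pos i j) - comb w' (pos i' j') = (y - comb w' (pos i' j')) - (x - comb w (pos i j)) + (x - y)" by simp
  then have "comb w (pos i j) - comb w' (pos i' j') \<in> square_lattice"
    using square_lattice_add[OF square_lattice_diff[OF l(2,1)] xy] by simp
  then have "unfold i ?X - unfold i' ?X' \<in> \<int>" "unfold j ?Y - unfold j' ?Y' \<in> \<int>"
    unfolding square_lattice_iff by (simp_all add: comb_pos_nth[OF w(1)] comb_pos_nth[OF w(2)])
  note cx = unfold_congruent[OF this(1) fold_comb_bounds(1,2)[OF w(1)] fold_comb_bounds(1,2)[OF w(2)]]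
    and cy = unfold_congruent[OF this(2) fold_comb_bounds(3,4)[OF w(1)] fold_comb_bounds(3,4)[OF w(2)]]
  obtain t'' where "t'' \<in> cell_facets i' j'" "weights_on t'' w"
    using border_transport[OF t(1) w(1) cx(2) cy(2)] by blast
  then show ?thesis using cell_weights_eq[OF _ t(2) _ w(2) cx(1) cy(1)] by blast
qed

text \<open>The coordinates are the solutions of the linear equations for the triangle that contains the point.\<close>

lemma cell_cover:
  assumes "0 \<le> X" "X \<le> 1/2" "0 \<le> Y" "Y \<le> 1/2"
  shows "\<exists>t\<in>cell_facets i j. \<exists>w. weights_on t w \<and> (\<Sum>v<8. w v * fold_x v) = X \<and> (\<Sum>v<8. w v * fold_y v) = Y"
proof -
  have tri: "\<exists>t\<in>T. \<exists>w. weights_on t w \<and> (\<Sum>v<8. w v * fold_x v) = X \<and> (\<Sum>v<8. w v * fold_y v) = Y"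
    if "{a, b, c} \<in> T" "a < b" "b < c" "c < 8" "0 \<le> p" "0 \<le> q" "0 \<le> r" "p + q + r = 1"
      "p * fold_x a + q * fold_x b + r * fold_x c = X" "p * fold_y a + q * fold_y b + r * fold_y c = Y" for a b c :: nat and p q r :: real and T
  proof (intro bexI exI conjI)
    let ?w = "\<lambda>v. if v = a then p else if v = b then q else if v = c then r else 0"
    have s: "(\<Sum>v<8. ?w v * f v) = p * f a + q * f b + r * f c" for f :: "nat \<Rightarrow> real"
    proof -
      have "(\<Sum>v<8. ?w v * f v) = (\<Sum>v\<in>{a, b, c}. ?w v * f v)"
        by (rule sum.mono_neutral_right) (use that in auto)
      then show ?thesis using that by (simp add: add.assoc)
    qed
    show "weights_on {a, b, c} ?w"
      unfolding weights_on_def using s[of "\<lambda>_. 1"] that by auto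
    show "(\<Sum>v<8. ?w v * fold_x v) = X" "(\<Sum>v<8. ?w v * fold_y v) = Y" unfolding s using that by auto
  qed (use that in auto)
  show ?thesis
  proof (cases j; cases i)
    assume c: "\<not> j" "\<not> i"
    consider "Y \<le> 1/4 - X/2" | "1/4 - X/2 \<le> Y" "Y \<le> 1/4" | "1/4 \<le> Y" "Y \<le> 1/2 - X/2" | "1/2 - X/2 \<le> Y" by linarith
    then show ?thesis
    proof cases
      case 1 then show ?thesis using assms c by (intro tri[of 0 3 7 _ "4*Y" "2*X" "1 - 2*X - 4*Y"]) (simp_all add: cell_facets_def fold_x_def fold_y_def)
    next
      case 2 then show ?thesis using assms c by (intro tri[of 0 1 3 _ "1 - 2*X" "2*X + 4*Y - 1" "1 - 4*Y"]) (simp_all add: cell_facets_def fold_x_def fold_y_def field_simps)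
    next
      case 3 then show ?thesis using assms c by (intro tri[of 0 1 2 _ "2 - 4*Y - 2*X" "2*X" "4*Y - 1"]) (simp_all add: cell_facets_def fold_x_def fold_y_def field_simps)
    next
      case 4 then show ?thesis using assms c by (intro tri[of 1 2 6 _ "2 - 4*Y" "1 - 2*X" "4*Y + 2*X - 2"]) (simp_all add: cell_facets_def fold_x_def fold_y_def field_simps)
    qed
  next
    assume c: "j" "\<not> i"
    consider "X + Y \<le> 1/2" | "1/2 \<le> X + Y" by linarith
    then show ?thesis
    proof cases
      case 1 then show ?thesis using assms c by (intro tri[of 2 3 7 _ "2*Y" "2*X" "1 - 2*X - 2*Y"]) (simp_all add: cell_facets_def fold_x_def fold_y_def field_simps)
    next
      case 2 then show ?thesis using assms c by (intro tri[of 2 3 6 _ "1 - 2*X" "1 - 2*Y" "2*X + 2*Y - 1"]) (simp_all add: cell_facets_def fold_x_def fold_y_def field_simps)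
    qed
  next
    assume c: "j" "i"
    consider "4*X \<le> 3*Y" | "3*Y \<le> 4*X" "X \<le> Y" | "Y \<le> X" "8*X - 1 \<le> 6*Y" | "6*Y \<le> 8*X - 1" by linarith
    then show ?thesis
    proof cases
      case 1 then show ?thesis using assms c by (intro tri[of 2 4 7 _ "2*Y - 8*X/3" "8*X/3" "1 - 2*Y"]) (simp_all add: cell_facets_def fold_x_def fold_y_def field_simps)
    next
      case 2 then show ?thesis using assms c by (intro tri[of 4 6 7 _ "8*(Y - X)" "8*X - 6*Y" "1 - 2*Y"]) (simp_all add: cell_facets_def fold_x_def fold_y_def field_simps)
    next
      case 3 then show ?thesis using assms c by (intro tri[of 5 6 7 _ "8*(X - Y)" "2*Y" "1 - 8*X + 6*Y"]) (simp_all add: cell_facets_def fold_x_def fold_y_def field_simps)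
    next
      case 4 then show ?thesis using assms c by (intro tri[of 3 5 6 _ "8*X/3 - 2*Y - 1/3" "4/3 - 8*X/3" "2*Y"]) (simp_all add: cell_facets_def fold_x_def fold_y_def field_simps)
    qed
  next
    assume c: "\<not> j" "i"
    consider "3 + 8*X \<le> 12*Y" | "4*Y \<le> 1 - 8*X" | "12*Y \<le> 8*X - 1" | "5 \<le> 4*Y + 8*X"
      | "12*Y \<le> 3 + 8*X" "1 - 8*X \<le> 4*Y" "8*X - 1 \<le> 4*Y"
      | "8*X - 1 \<le> 12*Y" "4*Y + 8*X \<le> 5" "4*Y \<le> 8*X - 1" by linarith
    then show ?thesis
    proof cases
      case 1 then show ?thesis using assms c by (intro tri[of 0 2 4 _ "2 - 4*Y" "4*Y - 1 - 8*X/3" "8*X/3"]) (simp_all add: cell_facets_def fold_x_def fold_y_def field_simps)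
    next
      case 2 then show ?thesis using assms c by (intro tri[of 0 5 7 _ "4*Y" "8*X" "1 - 4*Y - 8*X"]) (simp_all add: cell_facets_def fold_x_def fold_y_def field_simps)
    next
      case 3 then show ?thesis using assms c by (intro tri[of 1 3 5 _ "4*Y" "8*X/3 - 4*Y - 1/3" "4/3 - 8*X/3"]) (simp_all add: cell_facets_def fold_x_def fold_y_def field_simps)
    next
      case 4 then show ?thesis using assms c by (intro tri[of 1 4 6 _ "2 - 4*Y" "4 - 8*X" "4*Y + 8*X - 5"]) (simp_all add: cell_facets_def fold_x_def fold_y_def field_simps)
    next
      case 5 then show ?thesis using assms c by (intro tri[of 0 4 5 _ "2*Y - 4*X + 1/2" "Y + 2*X - 1/4" "3/4 - 3*Y + 2*X"]) (simp_all add: cell_facets_def fold_x_def fold_y_def field_simps)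
    next
      case 6 then show ?thesis using assms c by (intro tri[of 1 4 5 _ "4*X - 2*Y - 1/2" "1/4 + 3*Y - 2*X" "5/4 - Y - 2*X"]) (simp_all add: cell_facets_def fold_x_def fold_y_def field_simps)
    qed
  qed
qed

lemma unfold_exists: "\<exists>b X. 0 \<le> X \<and> X \<le> 1/2 \<and> x - unfold b X \<in> \<int>"
proof (cases "frac x \<le> 1/2")
  case True
  then show ?thesis by (intro exI[of _ False] exI[of _ "frac x"]) (simp add: unfold_def frac_def frac_ge_0)
next
  case False
  have "x - unfold True (1 - frac x) \<in> \<int>" by (simp add: unfold_def frac_def)
  then show ?thesis using False frac_lt_1[of x] by (intro exI[of _ True] exI[of _ "1 - frac x"]) auto
qed

lemma located_exists: "\<exists>i j t w. located x i j t w"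
proof -
  obtain i X where X: "0 \<le> X" "X \<le> 1/2" "x $ 1 - unfold i X \<in> \<int>" using unfold_exists by blast
  obtain j Y where Y: "0 \<le> Y" "Y \<le> 1/2" "x $ 2 - unfold j Y \<in> \<int>" using unfold_exists by blast
  obtain t w where t: "t \<in> cell_facets i j" and w: "weights_on t w"
    and eq: "(\<Sum>v<8. w v * fold_x v) = X" "(\<Sum>v<8. w v * fold_y v) = Y"
    using cell_cover[OF X(1,2) Y(1,2), of i j] by blast
  have "located x i j t w"
    unfolding located_def square_lattice_iff using t w X(3) Y(3) by (simp add: comb_pos_nth[OF w] eq)
  then show ?thesis by blast
qed

definition bary :: "real^2 \<Rightarrow> nat \<Rightarrow> real" where
  "bary x = (SOME w. \<exists>i j t. located x i j t w)"

text \<open>Well-definedness of the barycentric coordinates of a point of the torus.\<close>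

lemma bary_eq: "located x i j t w \<Longrightarrow> bary x = w"
proof -
  assume a: "located x i j t w"
  have "\<exists>i j t. located x i j t (bary x)"
    using someI_ex[of "\<lambda>w. \<exists>i j t. located x i j t w"] located_exists[of x] unfolding bary_def by blast
  then show ?thesis using located_unique[OF _ a, of x] by (auto simp: square_lattice_iff)
qed

lemma located_bary: "\<exists>i j t. located x i j t (bary x)"
  using located_exists bary_eq by metis

lemma bary_comb: "t \<in> cell_facets i j \<Longrightarrow> weights_on t w \<Longrightarrow> bary (comb w (pos i j)) = w"
  by (rule bary_eq) (auto simp: located_def square_lattice_iff)

lemma bary_periodic:
  assumes "x - y \<in> square_lattice"
  shows "bary x = bary y"
  using located_bary[of x] located_bary[of y] located_unique[OF _ _ assms] by blast

text \<open>A set of vertices common to two facets spans the same face of the torus in both: the vertices in it have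
  positions that differ by one lattice vector.\<close>

lemma facet_common:
  assumes "t \<in> cell_facets i j" "t' \<in> cell_facets i' j'"
  shows "\<exists>m n::int. \<forall>v\<in>t \<inter> t'. unfold i (fold_x v) - unfold i' (fold_x v) = of_int m \<and> unfold j (fold_y v) - unfold j' (fold_y v) = of_int n"
proof -
  have *: "\<exists>m::int. \<forall>v\<in>t \<inter> t'. unfold b (f v) - unfold b' (f v) = of_int m"
    if "b = b' \<or> (\<forall>v\<in>t \<inter> t'. f v = 0) \<or> (\<forall>v\<in>t \<inter> t'. f v = 1/2)" for b b' and f :: "nat \<Rightarrow> real"
  proof -
    let ?m = "\<lambda>c::int. if b = b' then 0 else if b then 1 - c else c - 1"
    from that consider "b = b'" | "\<forall>v\<in>t \<inter> t'. f v = 0" | "\<forall>v\<in>t \<inter> t'. f v = 1/2" by blast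
    then show ?thesis
    proof cases
      case 1 then show ?thesis by (auto intro!: exI[of _ 0])
    next
      case 2 then show ?thesis by (intro exI[of _ "?m 0"] ballI) (simp add: unfold_def)
    next
      case 3
      then have "unfold b (f v) = unfold b' (f v)" if "v \<in> t \<inter> t'" for v
        using bspec[OF 3 that] by (simp add: unfold_def)
      then show ?thesis by (intro exI[of _ 0]) simp
    qed
  qed
  have all: "\<forall>t\<in>cell_facets i j. \<forall>t'\<in>cell_facets i' j'.
        (i = i' \<or> (\<forall>v\<in>t. v \<in> t' \<longrightarrow> fold_x v = 0) \<or> (\<forall>v\<in>t. v \<in> t' \<longrightarrow> fold_x v = 1/2)) \<and>
        (j = j' \<or> (\<forall>v\<in>t. v \<in> t' \<longrightarrow> fold_y v = 0) \<or> (\<forall>v\<in>t. v \<in> t' \<longrightarrow> fold_y v = 1/2))"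
    unfolding cell_facets_def by (cases i; cases j; cases i'; cases j'; simp)
  from bspec[OF bspec[OF all assms(1)] assms(2)] have "(i = i' \<or> (\<forall>v\<in>t \<inter> t'. fold_x v = 0) \<or> (\<forall>v\<in>t \<inter> t'. fold_x v = 1/2))"
    and "(j = j' \<or> (\<forall>v\<in>t \<inter> t'. fold_y v = 0) \<or> (\<forall>v\<in>t \<inter> t'. fold_y v = 1/2))" by blast+
  from *[OF this(1)] *[OF this(2)] obtain m n :: int
    where "\<forall>v\<in>t \<inter> t'. unfold i (fold_x v) - unfold i' (fold_x v) = of_int m"
      and "\<forall>v\<in>t \<inter> t'. unfold j (fold_y v) - unfold j' (fold_y v) = of_int n" by blast
  then show ?thesis by blast
qed

text \<open>The facets form an abstract triangulation without two faces on the same vertices, so that a point of the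
  torus is determined by its weights.\<close>

lemma bary_inj:
  assumes "bary x = bary y"
  shows "x - y \<in> square_lattice"
proof -
  obtain i j t i' j' t' where a: "located x i j t (bary x)" and b: "located y i' j' t' (bary x)"
    using located_bary[of x] located_bary[of y] assms by metis
  let ?w = "bary x"
  have w: "weights_on t ?w" "weights_on t' ?w" and t: "t \<in> cell_facets i j" "t' \<in> cell_facets i' j'"
    using a b unfolding located_def by auto
  obtain m n :: int where mn: "\<forall>v\<in>t \<inter> t'. unfold i (fold_x v) - unfold i' (fold_x v) = of_int m \<and> unfold j (fold_y v) - unfold j' (fold_y v) = of_int n"
    using facet_common[OF t] by blast
  have "(\<Sum>v<8. ?w v * f v) = of_int k" if "\<forall>v\<in>t \<inter> t'. f v = of_int k" for f and k :: int
  proof -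
    have "(\<Sum>v<8. ?w v * f v) = (\<Sum>v<8. ?w v * of_int k)"
      proof (rule sum.cong[OF refl])
      fix v show "?w v * f v = ?w v * of_int k"
        using that weights_onD(2)[OF w(1), of v] weights_onD(2)[OF w(2), of v] by (cases "v \<in> t \<inter> t'") auto
    qed
    also have "\<dots> = (\<Sum>v<8. ?w v) * of_int k" by (rule sum_distrib_right[symmetric])
    finally show ?thesis using weights_onD(3)[OF w(1)] by simp
  qed
  from this[of "\<lambda>v. unfold i (fold_x v) - unfold i' (fold_x v)" m] this[of "\<lambda>v. unfold j (fold_y v) - unfold j' (fold_y v)" n] mn
  have "comb ?w (pos i j) - comb ?w (pos i' j') \<in> square_lattice"
    unfolding square_lattice_iff by (simp add: comb_nth pos_def right_diff_distrib sum_subtractf)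
  moreover have "x - comb ?w (pos i j) \<in> square_lattice" "y - comb ?w (pos i' j') \<in> square_lattice"
    using a b unfolding located_def by auto
  ultimately show ?thesis
    using square_lattice_add[OF square_lattice_diff[of "x - comb ?w (pos i j)" "y - comb ?w (pos i' j')"], of "comb ?w (pos i j) - comb ?w (pos i' j')"] by simp
qed

section \<open>Edge lengths of a tent and of its development\<close>

text \<open>Twice the displacement of the developed vertices from the sheared square grid.\<close>

definition shift_x :: "real \<Rightarrow> real \<Rightarrow> real \<Rightarrow> real \<Rightarrow> nat \<Rightarrow> real" where
  "shift_x lam A hx cx v = [1/2 - lam, lam - 1/2, 1/2 - A, A - 1/2, 1/4 - cx, cx - 1/4, hx - 1/2, 1/2 - hx] ! v"

definition shift_y :: "real \<Rightarrow> real \<Rightarrow> real \<Rightarrow> real \<Rightarrow> nat \<Rightarrow> real" where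
  "shift_y kap n hy cy v =
     [- kap/2, kap/2, n/2 - kap/2, kap/2 - n/2, - cy - kap/4 - 1/2 - n/2, cy + kap/4 + 1/2 + n/2,
      hy + 1/2 + n/2 + kap/2, - hy - 1/2 - n/2 - kap/2] ! v"

definition vec3 :: "(nat \<Rightarrow> real) \<Rightarrow> (nat \<Rightarrow> real) \<Rightarrow> (nat \<Rightarrow> real) \<Rightarrow> nat \<Rightarrow> real^3" where
  "vec3 X Y Z v = vector [X v, Y v, Z v]"

definition develop_x :: "real \<Rightarrow> real \<Rightarrow> real \<Rightarrow> real \<Rightarrow> bool \<Rightarrow> nat \<Rightarrow> real" where
  "develop_x lam A hx cx i v = 2 * unfold i (fold_x v) + shift_x lam A hx cx v"

definition develop_y :: "real \<Rightarrow> real \<Rightarrow> real \<Rightarrow> real \<Rightarrow> bool \<Rightarrow> bool \<Rightarrow> nat \<Rightarrow> real" where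
  "develop_y kap n hy cy i j v = - kap * (2 * unfold i (fold_x v)) + (1 + n) * (2 * unfold j (fold_y v)) + shift_y kap n hy cy v"

lemma develop_x_values:
  "develop_x lam A hx cx i 0 = 2 * unfold i 0 + (1/2 - lam)" "develop_x lam A hx cx i 1 = 2 * unfold i (1/2) + (lam - 1/2)"
  "develop_x lam A hx cx i 2 = 2 * unfold i 0 + (1/2 - A)" "develop_x lam A hx cx i 3 = 2 * unfold i (1/2) + (A - 1/2)"
  "develop_x lam A hx cx i 4 = 2 * unfold i (3/8) + (1/4 - cx)" "develop_x lam A hx cx i 5 = 2 * unfold i (1/8) + (cx - 1/4)"
  "develop_x lam A hx cx i 6 = 2 * unfold i (1/2) + (hx - 1/2)" "develop_x lam A hx cx i 7 = 2 * unfold i 0 + (1/2 - hx)"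
  by (simp_all add: develop_x_def shift_x_def)

lemma develop_y_values:
  "develop_y kap n hy cy i j 0 = - kap * (2 * unfold i 0) + (1 + n) * (2 * unfold j (1/4)) - kap/2"
  "develop_y kap n hy cy i j 1 = - kap * (2 * unfold i (1/2)) + (1 + n) * (2 * unfold j (1/4)) + kap/2"
  "develop_y kap n hy cy i j 2 = - kap * (2 * unfold i 0) + (1 + n) * (2 * unfold j (1/2)) + (n/2 - kap/2)"
  "develop_y kap n hy cy i j 3 = - kap * (2 * unfold i (1/2)) + (1 + n) * (2 * unfold j 0) + (kap/2 - n/2)"
  "develop_y kap n hy cy i j 4 = - kap * (2 * unfold i (3/8)) + (1 + n) * (2 * unfold j (1/2)) + (- cy - kap/4 - 1/2 - n/2)"
  "develop_y kap n hy cy i j 5 = - kap * (2 * unfold i (1/8)) + (1 + n) * (2 * unfold j 0) + (cy + kap/4 + 1/2 + n/2)"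
  "develop_y kap n hy cy i j 6 = - kap * (2 * unfold i (1/2)) + (1 + n) * (2 * unfold j (1/2)) + (hy + 1/2 + n/2 + kap/2)"
  "develop_y kap n hy cy i j 7 = - kap * (2 * unfold i 0) + (1 + n) * (2 * unfold j 0) + (- hy - 1/2 - n/2 - kap/2)"
  by (simp_all add: develop_y_def shift_y_def)

lemma tent_values:
  "tent_x lam A hx del qx 0 = - lam" "tent_x lam A hx del qx 1 = lam" "tent_x lam A hx del qx 2 = - A" "tent_x lam A hx del qx 3 = A"
  "tent_x lam A hx del qx 4 = - qx" "tent_x lam A hx del qx 5 = qx" "tent_x lam A hx del qx 6 = hx - del" "tent_x lam A hx del qx 7 = del - hx"
  "tent_y R qy 0 = 0" "tent_y R qy 1 = 0" "tent_y R qy 2 = 1/2" "tent_y R qy 3 = -1/2" "tent_y R qy 4 = - qy" "tent_y R qy 5 = qy" "tent_y R qy 6 = R" "tent_y R qy 7 = - R"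
  "tent_z eps tau 0 = - tau" "tent_z eps tau 1 = - tau" "tent_z eps tau 2 = 0" "tent_z eps tau 3 = 0" "tent_z eps tau 4 = eps - tau" "tent_z eps tau 5 = eps - tau" "tent_z eps tau 6 = tau" "tent_z eps tau 7 = tau"
  by (simp_all add: tent_x_def tent_y_def tent_z_def)

text \<open>The difference of the two sides is, for every edge, a combination of the defining equations and
  of their consequence \<open>k\<close> with integer coefficients.\<close>

lemma pup_tent_edges:
  assumes tent: "pup_tent kap lam eps tau n del hx hy R A cx cy qx qy" and t: "t \<in> cell_facets i j" and ab: "a \<in> t" "b \<in> t"
  shows "(develop_x lam A hx cx i a - develop_x lam A hx cx i b)\<^sup>2 + (develop_y kap n hy cy i j a - develop_y kap n hy cy i j b)\<^sup>2 =
    (tent_x lam A hx del qx a - tent_x lam A hx del qx b)\<^sup>2 + (tent_y R qy a - tent_y R qy b)\<^sup>2 + (tent_z eps tau a - tent_z eps tau b)\<^sup>2"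
proof -
  let ?p = "develop_x lam A hx cx" and ?q = "develop_y kap n hy cy"
    and ?x = "tent_x lam A hx del qx" and ?y = "tent_y R qy" and ?z = "tent_z eps tau"
  define E where "E i j a b \<longleftrightarrow> (?p i a - ?p i b)\<^sup>2 + (?q i j a - ?q i j b)\<^sup>2 = (?x a - ?x b)\<^sup>2 + (?y a - ?y b)\<^sup>2 + (?z a - ?z b)\<^sup>2" for i j a b
  note T = tent[unfolded pup_tent_def]
  have h: "n + n\<^sup>2 = tau\<^sup>2" "2 * lam = 1 + kap\<^sup>2 - eps\<^sup>2" "(1 + n) * (hy + 1/2) = lam * del + tau\<^sup>2"
     "2 * hx = 1 + kap\<^sup>2 + tau\<^sup>2 + 2 * kap * hy" "hy + R = - 2 * A * del"
     "tau\<^sup>2 = del * (2 * hx - del + 2 * A * (R - hy))"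
     "2 * cy * (1 + n) = (eps - 2 * tau)\<^sup>2 - (1 + n)\<^sup>2"
     "(hx - del) * qx + R * qy = (hx - 1) * cx + (hy + kap) * (cy + 1 + n)"
     "- lam * qx = (1 - lam) * cx - kap * cy"
     "qx\<^sup>2 + qy\<^sup>2 = cx\<^sup>2 + cy\<^sup>2"
     "(qx - A)\<^sup>2 + (1/2 + qy)\<^sup>2 + (eps - tau)\<^sup>2 = (1 - A + cx)\<^sup>2 + (cy + 1/2 + n - kap)\<^sup>2"
    by (insert T, elim conjE, assumption)+
  have k: "tau\<^sup>2 + R\<^sup>2 - hy\<^sup>2 = 2 * hx * del - del\<^sup>2"
    using h(5,6) by algebra
  have sym: "E i j a b \<Longrightarrow> E i j b a" for i j a b
    unfolding E_def power2_commute[of "?p i b"] power2_commute[of "?q i j b"] power2_commute[of "?x b"] power2_commute[of "?y b"] power2_commute[of "?z b"] .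
  have refl: "E i j a a" for i j a by (simp add: E_def)
  note vals = E_def develop_x_values develop_y_values tent_values unfold_def if_True if_False
  note r = h[THEN right_minus_eq[THEN iffD2]] k[THEN right_minus_eq[THEN iffD2]]
  have tr: "L - M = c \<Longrightarrow> c = 0 \<Longrightarrow> L = M" for L M c :: real by simp
  have z0: "(n + n\<^sup>2 - tau\<^sup>2) = 0"
    unfolding r by simp
  have e0: "E False False 0 3" "E False False 1 3" "E False False 0 2" "E False False 1 2"
    "E True False 0 2" "E True False 1 3"
    unfolding vals by (rule tr[OF _ z0], simp add: power2_eq_square field_simps)+
  have z1: "- (tau\<^sup>2 + R\<^sup>2 - hy\<^sup>2 - (2 * hx * del - del\<^sup>2)) + (n + n\<^sup>2 - tau\<^sup>2) + 2 * ((1 + n) * (hy + 1/2) - (lam * del + tau\<^sup>2)) = 0"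
    unfolding r by simp
  have e1: "E False False 0 7" "E False False 1 6" "E True False 0 7" "E True False 1 6"
    unfolding vals by (rule tr[OF _ z1], simp add: power2_eq_square field_simps)+
  have z2: "- (tau\<^sup>2 + R\<^sup>2 - hy\<^sup>2 - (2 * hx * del - del\<^sup>2)) + (hy + R - (- 2 * A * del)) = 0"
    unfolding r by simp
  have e2: "E False False 3 7" "E False False 2 6" "E False True 2 6" "E False True 3 7"
    unfolding vals by (rule tr[OF _ z2], simp add: power2_eq_square field_simps)+
  have e3: "E False False 0 1" "E False True 2 3"
    unfolding vals by (simp_all add: power2_eq_square field_simps)
  have z4: "- (tau\<^sup>2 + R\<^sup>2 - hy\<^sup>2 - (2 * hx * del - del\<^sup>2)) - (hy + R - (- 2 * A * del)) = 0"
    unfolding r by simp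
  have e4: "E False True 3 6" "E False True 2 7" "E True True 2 7" "E True True 3 6"
    unfolding vals by (rule tr[OF _ z4], simp add: power2_eq_square field_simps)+
  have z5: "- ((qx - A)\<^sup>2 + (1/2 + qy)\<^sup>2 + (eps - tau)\<^sup>2 - ((1 - A + cx)\<^sup>2 + (cy + 1/2 + n - kap)\<^sup>2)) = 0"
    unfolding r by simp
  have e5: "E True True 2 4" "E True True 3 5" "E True False 2 4" "E True False 3 5"
    unfolding vals by (rule tr[OF _ z5], simp add: power2_eq_square field_simps)+
  have z6: "- (tau\<^sup>2 + R\<^sup>2 - hy\<^sup>2 - (2 * hx * del - del\<^sup>2)) - (qx\<^sup>2 + qy\<^sup>2 - (cx\<^sup>2 + cy\<^sup>2)) - (2 * hx - (1 + kap\<^sup>2 + tau\<^sup>2 + 2 * kap * hy)) + (2 * cy * (1 + n) - ((eps - 2 * tau)\<^sup>2 - (1 + n)\<^sup>2)) + 2 * ((hx - del) * qx + R * qy - ((hx - 1) * cx + (hy + kap) * (cy + 1 + n))) = 0"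
    unfolding r by simp
  have e6: "E True True 4 7" "E True True 5 6"
    unfolding vals by (rule tr[OF _ z6], simp add: power2_eq_square field_simps)+
  have z7: "- (tau\<^sup>2 + R\<^sup>2 - hy\<^sup>2 - (2 * hx * del - del\<^sup>2)) - (qx\<^sup>2 + qy\<^sup>2 - (cx\<^sup>2 + cy\<^sup>2)) - (2 * hx - (1 + kap\<^sup>2 + tau\<^sup>2 + 2 * kap * hy)) + (2 * cy * (1 + n) - ((eps - 2 * tau)\<^sup>2 - (1 + n)\<^sup>2)) - 2 * ((hx - del) * qx + R * qy - ((hx - 1) * cx + (hy + kap) * (cy + 1 + n))) = 0"
    unfolding r by simp
  have e7: "E True True 4 6" "E True True 5 7" "E True False 5 7" "E True False 4 6"
    unfolding vals by (rule tr[OF _ z7], simp add: power2_eq_square field_simps)+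
  have z8: "- 4 * (tau\<^sup>2 + R\<^sup>2 - hy\<^sup>2 - (2 * hx * del - del\<^sup>2)) - 4 * (2 * hx - (1 + kap\<^sup>2 + tau\<^sup>2 + 2 * kap * hy)) = 0"
    unfolding r by simp
  have e8: "E True True 6 7"
    unfolding vals by (rule tr[OF _ z8], simp add: power2_eq_square field_simps)+
  have z9: "- (qx\<^sup>2 + qy\<^sup>2 - (cx\<^sup>2 + cy\<^sup>2)) - (2 * lam - (1 + kap\<^sup>2 - eps\<^sup>2)) - 2 * (- lam * qx - ((1 - lam) * cx - kap * cy)) = 0"
    unfolding r by simp
  have e9: "E True False 0 4" "E True False 1 5"
    unfolding vals by (rule tr[OF _ z9], simp add: power2_eq_square field_simps)+
  have z10: "- (qx\<^sup>2 + qy\<^sup>2 - (cx\<^sup>2 + cy\<^sup>2)) - (2 * lam - (1 + kap\<^sup>2 - eps\<^sup>2)) + 2 * (- lam * qx - ((1 - lam) * cx - kap * cy)) = 0"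
    unfolding r by simp
  have e10: "E True False 0 5" "E True False 1 4"
    unfolding vals by (rule tr[OF _ z10], simp add: power2_eq_square field_simps)+
  have z11: "- 4 * (qx\<^sup>2 + qy\<^sup>2 - (cx\<^sup>2 + cy\<^sup>2)) = 0"
    unfolding r by simp
  have e11: "E True False 4 5"
    unfolding vals by (rule tr[OF _ z11], simp add: power2_eq_square field_simps)+
  note edges = e0 e1 e2 e3 e4 e5 e6 e7 e8 e9 e10 e11
  have "\<forall>t\<in>cell_facets i j. \<forall>a\<in>t. \<forall>b\<in>t. E i j a b"
    unfolding cell_facets_def
    by (cases i; cases j) (simp_all only: if_True if_False ball_simps simp_thms refl edges edges[THEN sym])
  then show ?thesis using t ab unfolding E_def by blast
qed

definition shear :: "real \<Rightarrow> real \<Rightarrow> real^2 \<Rightarrow> real^2" where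
  "shear kap n x = vector [x $ 1, - kap * x $ 1 + (1 + n) * x $ 2]"

text \<open>The tents are halved and translated so that the limit is the fold onto \<open>[0,1/2]\<^sup>2\<close>. The shear \<open>S\<close> maps
  the square lattice to the lattice of the flat torus, and \<open>D\<close> displaces the vertices in addition.\<close>

lemma paper_data_exist:
  assumes "0 < \<eta>"
  shows "\<exists>S D P. linear S \<and> (\<forall>x. norm (S x - x) \<le> \<eta> * norm x) \<and> (\<forall>v<8. norm (D v) \<le> \<eta>) \<and>
    (\<forall>v<8. norm (vec3 fold_x fold_y (\<lambda>_. 0) v - P v) \<le> \<eta>) \<and>
    (\<forall>i j. \<forall>t\<in>cell_facets i j. \<forall>a\<in>t. \<forall>b\<in>t. norm (S (pos i j a) + D a - (S (pos i j b) + D b)) = norm (P a - (P b :: real^3))) \<and>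
    (\<forall>s\<in>facets. \<forall>t\<in>facets. \<forall>w w'. weights_on s w \<longrightarrow> weights_on t w' \<longrightarrow> comb w P = comb w' P \<longrightarrow> w = w')"
proof -
  have eta: "0 < \<eta> / 4" using assms by simp
  obtain kap lam eps tau n del hx hy R A cx cy qx qy where
    tent: "pup_tent kap lam eps tau n del hx hy R A cx cy qx qy" and
    signs: "tent_signs (tent_x lam A hx del qx) (tent_y R qy) (tent_z eps tau)" and
    small: "\<bar>kap\<bar> < \<eta>/4" "\<bar>lam - 1/2\<bar> < \<eta>/4" "\<bar>eps\<bar> < \<eta>/4" "\<bar>tau\<bar> < \<eta>/4" "\<bar>n\<bar> < \<eta>/4" "\<bar>del\<bar> < \<eta>/4" "\<bar>hx - 1/2\<bar> < \<eta>/4" "\<bar>hy + 1/2\<bar> < \<eta>/4"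
    "\<bar>R - 1/2\<bar> < \<eta>/4" "\<bar>A - 1/2\<bar> < \<eta>/4" "\<bar>cx - 1/4\<bar> < \<eta>/4" "\<bar>cy + 1/2\<bar> < \<eta>/4" "\<bar>qx + 1/4\<bar> < \<eta>/4" "\<bar>qy + 1/2\<bar> < \<eta>/4"
    using pup_tent_exists[OF eta] by (elim exE conjE) (rule that, assumption+)
  define X where "X = tent_x lam A hx del qx"
  define Y where "Y = tent_y R qy"
  define Z where "Z = tent_z eps tau"
  define P where "P = vec3 (\<lambda>v. X v / 2 + 1/4) (\<lambda>v. Y v / 2 + 1/4) (\<lambda>v. Z v / 2)"
  define dx where "dx = shift_x lam A hx cx"
  define dy where "dy = shift_y kap n hy cy"
  define D :: "nat \<Rightarrow> real^2" where "D = (\<lambda>v. vector [dx v / 2, dy v / 2])"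
  have sm: "\<bar>r\<bar> < c \<Longrightarrow> r < c" "\<bar>r\<bar> < c \<Longrightarrow> - r < c" for r c :: real by simp_all
  note sm = small[THEN sm(1)] small[THEN sm(2)] assms
  have n_kap: "\<bar>n\<bar> \<le> \<eta>/4" "\<bar>kap\<bar> \<le> \<eta>/4" using small(1,5) by simp_all
  have eight: "v \<in> {0, 1, 2, 3, 4, 5, 6, 7}" if "v < 8" for v :: nat
    using that by auto
  have n2: "norm x \<le> \<bar>x $ 1\<bar> + \<bar>x $ 2\<bar>" for x :: "real^2"
    using norm_le_l1_cart[of x] by (simp add: sum_2)
  have n3: "norm x \<le> \<bar>x $ 1\<bar> + \<bar>x $ 2\<bar> + \<bar>x $ 3\<bar>" for x :: "real^3"
    using norm_le_l1_cart[of x] by (simp add: sum_3)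
  have f1: "linear (shear kap n)"
    by (rule linearI) (simp_all add: shear_def vec2_eq algebra_simps)
  have f2: "norm (shear kap n x - x) \<le> \<eta> * norm x" for x
  proof -
    have "norm (shear kap n x - x) \<le> \<bar>n * x $ 2 - kap * x $ 1\<bar>"
      using n2[of "shear kap n x - x"] by (simp add: shear_def algebra_simps)
    also have "\<dots> \<le> \<bar>n\<bar> * \<bar>x $ 2\<bar> + \<bar>kap\<bar> * \<bar>x $ 1\<bar>"
      using abs_triangle_ineq4[of "n * x $ 2" "kap * x $ 1"] by (simp add: abs_mult)
    also have "\<dots> \<le> \<eta>/4 * norm x + \<eta>/4 * norm x"
      using n_kap assms by (intro add_mono mult_mono component_le_norm_cart) auto
    also have "\<dots> \<le> \<eta> * norm x" using assms by (simp add: mult_right_mono)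
    finally show ?thesis .
  qed
  have f3: "norm (D v) \<le> \<eta>" if "v < 8" for v
  proof -
    have "\<forall>v\<in>{0, 1, 2, 3, 4, 5, 6, 7}. dx v \<le> \<eta> \<and> - dx v \<le> \<eta> \<and> dy v \<le> \<eta> \<and> - dy v \<le> \<eta>"
      unfolding dx_def dy_def shift_x_def shift_y_def by (simp del: One_nat_def, intro conjI; use sm in linarith)
    then have "\<bar>dx v\<bar> \<le> \<eta>" "\<bar>dy v\<bar> \<le> \<eta>" using eight[OF that] unfolding abs_le_iff by blast+
    then show ?thesis using n2[of "D v"] by (simp add: D_def)
  qed
  have f4: "norm (vec3 fold_x fold_y (\<lambda>_. 0) v - P v) \<le> \<eta>" if "v < 8" for v
  proof -
    have "\<forall>v\<in>{0, 1, 2, 3, 4, 5, 6, 7}. fold_x v - (X v / 2 + 1/4) \<le> \<eta>/4 \<and> - (fold_x v - (X v / 2 + 1/4)) \<le> \<eta>/4 \<and>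
        fold_y v - (Y v / 2 + 1/4) \<le> \<eta>/4 \<and> - (fold_y v - (Y v / 2 + 1/4)) \<le> \<eta>/4 \<and> Z v / 2 \<le> \<eta>/4 \<and> - (Z v / 2) \<le> \<eta>/4"
      unfolding X_def Y_def Z_def tent_x_def tent_y_def tent_z_def by (simp del: One_nat_def, intro conjI; use sm in linarith)
    then have "\<bar>fold_x v - (X v / 2 + 1/4)\<bar> \<le> \<eta>/4" "\<bar>fold_y v - (Y v / 2 + 1/4)\<bar> \<le> \<eta>/4" "\<bar>Z v / 2\<bar> \<le> \<eta>/4"
      using eight[OF that] unfolding abs_le_iff by blast+
    then have "\<bar>fold_x v - (X v / 2 + 1/4)\<bar> + \<bar>fold_y v - (Y v / 2 + 1/4)\<bar> + \<bar>Z v / 2\<bar> \<le> \<eta>" using assms by linarith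
    then show ?thesis using n3[of "vec3 fold_x fold_y (\<lambda>_. 0) v - P v"] by (simp add: P_def vec3_def)
  qed
  have f5: "norm (shear kap n (pos i j a) + D a - (shear kap n (pos i j b) + D b)) = norm (P a - P b)"
    if "t \<in> cell_facets i j" "a \<in> t" "b \<in> t" for i j t a b
  proof -
    let ?p = "unfold i (fold_x a) - unfold i (fold_x b)" and ?q = "unfold j (fold_y a) - unfold j (fold_y b)"
    have q1: "?p + (dx a - dx b) / 2 = (develop_x lam A hx cx i a - develop_x lam A hx cx i b) / 2"
      by (simp add: develop_x_def dx_def algebra_simps add_divide_distrib diff_divide_distrib)
    have q2: "- kap * ?p + (1 + n) * ?q + (dy a - dy b) / 2 = (develop_y kap n hy cy i j a - develop_y kap n hy cy i j b) / 2"
      by (simp add: develop_y_def dy_def algebra_simps add_divide_distrib diff_divide_distrib)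
    have "(?p + (dx a - dx b) / 2)\<^sup>2 + (- kap * ?p + (1 + n) * ?q + (dy a - dy b) / 2)\<^sup>2 =
      ((develop_x lam A hx cx i a - develop_x lam A hx cx i b)\<^sup>2 + (develop_y kap n hy cy i j a - develop_y kap n hy cy i j b)\<^sup>2) / 4"
      unfolding q1 q2 by (simp add: power_divide add_divide_distrib)
    also have "\<dots> = ((X a - X b)\<^sup>2 + (Y a - Y b)\<^sup>2 + (Z a - Z b)\<^sup>2) / 4"
      unfolding X_def Y_def Z_def pup_tent_edges[OF tent that] ..
    also have "\<dots> = (X a / 2 - X b / 2)\<^sup>2 + (Y a / 2 - Y b / 2)\<^sup>2 + (Z a / 2 - Z b / 2)\<^sup>2"
      by (simp add: diff_divide_distrib[symmetric] power_divide add_divide_distrib)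
    finally have "(?p + (dx a - dx b) / 2)\<^sup>2 + (- kap * ?p + (1 + n) * ?q + (dy a - dy b) / 2)\<^sup>2 =
      (X a / 2 - X b / 2)\<^sup>2 + (Y a / 2 - Y b / 2)\<^sup>2 + (Z a / 2 - Z b / 2)\<^sup>2" .
    moreover have "(shear kap n (pos i j a) + D a - (shear kap n (pos i j b) + D b)) $ 1 = ?p + (dx a - dx b) / 2"
      "(shear kap n (pos i j a) + D a - (shear kap n (pos i j b) + D b)) $ 2 = - kap * ?p + (1 + n) * ?q + (dy a - dy b) / 2"
      by (simp_all add: shear_def pos_def D_def field_simps)
    moreover have "(P a - P b) $ 1 = X a / 2 - X b / 2" "(P a - P b) $ 2 = Y a / 2 - Y b / 2" "(P a - P b) $ 3 = Z a / 2 - Z b / 2"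
      by (simp_all add: P_def vec3_def)
    ultimately show ?thesis
      by (simp only: norm_eq_sqrt_inner inner_vec_def sum_2 sum_3 inner_real_def power2_eq_square)
  qed
  have f6: "w = w'"
    if st: "s \<in> facets" "t \<in> facets" and w: "weights_on s w" "weights_on t w'" and eq: "comb w P = comb w' P" for s t w w'
  proof (rule tent_weights_eq[OF signs st w, folded X_def Y_def Z_def])
    have lin: "(\<Sum>v<8. u v * (F v / 2 + c)) = (\<Sum>v<8. u v * F v) / 2 + c" if "(\<Sum>v<8. u v) = 1" for u F and c :: real
      using that by (simp add: distrib_left sum.distrib sum_divide_distrib sum_distrib_right[symmetric])
    have e: "comb w P $ k = comb w' P $ k" for k using eq by simp
    show "(\<Sum>v<8. w v * X v) = (\<Sum>v<8. w' v * X v)" "(\<Sum>v<8. w v * Y v) = (\<Sum>v<8. w' v * Y v)"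
      using e[of 1] e[of 2] weights_onD(3)[OF w(1)] weights_onD(3)[OF w(2)] by (simp_all add: comb_nth P_def vec3_def lin)
    show "(\<Sum>v<8. w v * Z v) = (\<Sum>v<8. w' v * Z v)"
      using e[of 3] by (simp add: comb_nth P_def vec3_def sum_divide_distrib[symmetric])
  qed
  have g5: "\<forall>i j. \<forall>t\<in>cell_facets i j. \<forall>a\<in>t. \<forall>b\<in>t.
      norm (shear kap n (pos i j a) + D a - (shear kap n (pos i j b) + D b)) = norm (P a - P b)"
  proof (intro allI ballI)
    fix i j t a b assume "t \<in> cell_facets i j" "a \<in> t" "b \<in> t"
    then show "norm (shear kap n (pos i j a) + D a - (shear kap n (pos i j b) + D b)) = norm (P a - P b)" by (rule f5)
  qed
  have g6: "\<forall>s\<in>facets. \<forall>t\<in>facets. \<forall>w w'. weights_on s w \<longrightarrow> weights_on t w' \<longrightarrow> comb w P = comb w' P \<longrightarrow> w = w'"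
  proof (intro allI ballI impI)
    fix s t w w' assume "s \<in> facets" "t \<in> facets" "weights_on s w" "weights_on t w'" "comb w P = comb w' P"
    then show "w = w'" by (rule f6)
  qed
  have g2: "\<forall>x. norm (shear kap n x - x) \<le> \<eta> * norm x" by (rule allI) (rule f2)
  have g3: "\<forall>v<8. norm (D v) \<le> \<eta>" "\<forall>v<8. norm (vec3 fold_x fold_y (\<lambda>_. 0) v - P v) \<le> \<eta>"
    by (intro allI impI, erule f3, intro allI impI, erule f4)
  show ?thesis
    by (rule exI[of _ "shear kap n"], rule exI[of _ D], rule exI[of _ P]) (intro conjI f1 g2 g3 g5 g6)
qed

section \<open>Weights and convex hulls\<close>

lemma comb_const: "weights_on s w \<Longrightarrow> comb w (\<lambda>v. c) = c"
  unfolding comb_def by (simp add: scaleR_left.sum[symmetric] weights_onD(3))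

lemma comb_add: "comb w (\<lambda>v. f v + g v) = comb w f + comb w g"
  unfolding comb_def by (simp add: scaleR_add_right sum.distrib)

lemma comb_diff: "comb w (\<lambda>v. f v - g v) = comb w f - comb w g"
  unfolding comb_def by (simp add: scaleR_diff_right sum_subtractf)

lemma comb_linear: "linear f \<Longrightarrow> comb w (\<lambda>v. f (p v)) = f (comb w p)"
  unfolding comb_def by (simp add: linear_sum linear_scale)

lemma comb_cong:
  assumes "weights_on s w" "\<And>v. v \<in> s \<Longrightarrow> p v = q v"
  shows "comb w p = comb w q"
  unfolding comb_def
proof (rule sum.cong[OF refl])
  fix v show "w v *\<^sub>R p v = w v *\<^sub>R q v"
    using assms(2)[of v] weights_onD(2)[OF assms(1), of v] by (cases "v \<in> s") auto
qed

lemma norm_comb_le: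
  assumes w: "weights_on s w" and p: "\<And>v. v \<in> s \<Longrightarrow> norm (p v) \<le> c"
  shows "norm (comb w p) \<le> c"
proof -
  have "norm (comb w p) \<le> (\<Sum>v<8. w v * c)"
    unfolding comb_def
  proof (rule sum_norm_le)
    fix v show "norm (w v *\<^sub>R p v) \<le> w v * c"
      using p[of v] weights_onD(1,2)[OF w, of v] by (cases "v \<in> s") (auto intro: mult_left_mono)
  qed
  also have "\<dots> = (\<Sum>v<8. w v) * c" by (rule sum_distrib_right[symmetric])
  finally show ?thesis using weights_onD(3)[OF w] by simp
qed

lemma weights_on_vertex:
  assumes "a \<in> s" "s \<subseteq> {..<8}"
  shows "weights_on s (\<lambda>v. if v = a then 1 else 0)" "comb (\<lambda>v. if v = a then 1 else 0) p = p a"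
proof -
  have a: "a < 8" using assms by auto
  show "weights_on s (\<lambda>v. if v = a then 1 else 0)" unfolding weights_on_def using assms a by auto
  show "comb (\<lambda>v. if v = a then 1 else 0) p = p a"
    unfolding comb_def using a by (simp add: if_distrib[of "\<lambda>r. r *\<^sub>R _"] sum.delta cong: if_cong)
qed

lemma convex_hull_eq_comb:
  assumes s: "s \<subseteq> {..<8}"
  shows "convex hull (p ` s) = {comb w p | w. weights_on s w}"
proof (intro equalityI subsetI)
  fix x assume "x \<in> {comb w p | w. weights_on s w}"
  then obtain w where w: "weights_on s w" and x: "x = comb w p" by blast
  have 0: "(\<Sum>v<8. f v) = (\<Sum>v\<in>s. f v)" if "\<And>v. v \<notin> s \<Longrightarrow> f v = 0" for f :: "nat \<Rightarrow> 'b::comm_monoid_add"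
    by (rule sum.mono_neutral_right) (use s that in auto)
  have "x = (\<Sum>v\<in>s. w v *\<^sub>R p v)" unfolding x comb_def by (rule 0) (simp add: weights_onD(2)[OF w])
  also have "\<dots> \<in> convex hull (p ` s)"
  proof (rule convex_sum)
    show "finite s" using s finite_subset by blast
    show "(\<Sum>v\<in>s. w v) = 1" using weights_onD(3)[OF w] 0[of w] weights_onD(2)[OF w] by simp
  qed (auto simp: weights_onD(1)[OF w] convex_convex_hull intro: hull_inc)
  finally show "x \<in> convex hull (p ` s)" .
next
  have "convex hull (p ` s) \<subseteq> {comb w p | w. weights_on s w}"
  proof (rule hull_minimal)
    show "p ` s \<subseteq> {comb w p | w. weights_on s w}"
    proof
      fix x assume "x \<in> p ` s"
      then obtain a where a: "a \<in> s" "x = p a" by blast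
      then have "x = comb (\<lambda>v. if v = a then 1 else 0) p" using weights_on_vertex(2)[OF a(1) s, of p] by simp
      then show "x \<in> {comb w p | w. weights_on s w}" using weights_on_vertex(1)[OF a(1) s] by blast
    qed
    show "convex {comb w p | w. weights_on s w}"
    proof (rule convexI)
      fix x y and a b :: real
      assume "x \<in> {comb w p | w. weights_on s w}" "y \<in> {comb w p | w. weights_on s w}" and ab: "0 \<le> a" "0 \<le> b" "a + b = 1"
      then obtain w w' where w: "weights_on s w" "weights_on s w'" and xy: "x = comb w p" "y = comb w' p" by blast
      have "weights_on s (\<lambda>v. a * w v + b * w' v)"
        using w ab unfolding weights_on_def by (simp add: sum.distrib sum_distrib_left[symmetric])
      moreover have "a *\<^sub>R x + b *\<^sub>R y = comb (\<lambda>v. a * w v + b * w' v) p"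
        unfolding xy comb_def by (simp add: scaleR_sum_right scaleR_add_left sum.distrib)
      ultimately show "a *\<^sub>R x + b *\<^sub>R y \<in> {comb w p | w. weights_on s w}" by blast
    qed
  qed
  then show "x \<in> {comb w p | w. weights_on s w}" if "x \<in> convex hull (p ` s)" for x using that by blast
qed

text \<open>An affine dependence could be added, in small multiples, to the coordinates of the barycentre.\<close>

lemma independent_of_unique_weights:
  fixes p :: "nat \<Rightarrow> 'a::real_vector"
  assumes s: "s \<subseteq> {..<8}" and uniq: "\<And>w w'. weights_on s w \<Longrightarrow> weights_on s w' \<Longrightarrow> comb w p = comb w' p \<Longrightarrow> w = w'"
  shows "inj_on p s" and "\<not> affine_dependent (p ` s)"
proof -
  show inj: "inj_on p s"
  proof (rule inj_onI)
    fix a b assume ab: "a \<in> s" "b \<in> s" "p a = p b"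
    let ?d = "\<lambda>a v. if v = a then 1 else (0::real)"
    have "?d a = ?d b"
      using uniq[OF weights_on_vertex(1)[OF ab(1) s] weights_on_vertex(1)[OF ab(2) s]]
        weights_on_vertex(2)[OF ab(1) s, of p] weights_on_vertex(2)[OF ab(2) s, of p] ab(3) by simp
    then have "?d a a = ?d b a" by (rule fun_cong)
    then show "a = b" by (simp split: if_splits)
  qed
  have fin: "finite s" using s finite_subset by blast
  show "\<not> affine_dependent (p ` s)"
  proof
    assume "affine_dependent (p ` s)"
    then obtain U where U: "sum U (p ` s) = 0" "\<exists>v\<in>p ` s. U v \<noteq> 0" "(\<Sum>v\<in>p ` s. U v *\<^sub>R v) = 0"
      using affine_dependent_explicit_finite[of "p ` s"] fin by auto
    define u where "u = (\<lambda>v. if v \<in> s then U (p v) else 0)"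
    have u: "(\<Sum>v\<in>s. u v) = 0" "(\<Sum>v\<in>s. u v *\<^sub>R p v) = 0"
      using U(1,3) by (simp_all add: sum.reindex[OF inj] u_def)
    obtain a where a: "a \<in> s" "u a \<noteq> 0" using U(2) by (auto simp: u_def)
    have c: "card s > 0" using a fin by (auto simp: card_gt_0_iff)
    define M where "M = (\<Sum>v\<in>s. \<bar>u v\<bar>)"
    have uM: "\<bar>u v\<bar> \<le> M" if "v \<in> s" for v unfolding M_def by (rule member_le_sum[OF that]) (use fin in auto)
    have M: "M > 0" using uM[OF a(1)] a(2) by linarith
    define e where "e = 1 / (real (card s) * M)"
    have e: "e > 0" using c M by (simp add: e_def)
    have eu: "\<bar>e * u v\<bar> \<le> 1 / card s" if "v \<in> s" for v
    proof -
      have "\<bar>e * u v\<bar> = e * \<bar>u v\<bar>" using e by (simp add: abs_mult)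
      also have "\<dots> \<le> e * M" using uM[OF that] e by (intro mult_left_mono) auto
      also have "\<dots> = 1 / card s" using M by (simp add: e_def)
      finally show ?thesis .
    qed
    let ?w = "\<lambda>v. if v \<in> s then 1 / card s + e * u v else 0" and ?w' = "\<lambda>v. if v \<in> s then 1 / real (card s) else 0"
    have 0: "(\<Sum>v<8. if v \<in> s then f v else 0) = (\<Sum>v\<in>s. f v)" for f :: "nat \<Rightarrow> 'b::comm_monoid_add"
      using s by (simp add: sum.inter_restrict[symmetric] Int_absorb1)
    have "0 \<le> 1 / card s + e * u v" if "v \<in> s" for v using eu[OF that] unfolding abs_le_iff by linarith
    then have w: "weights_on s ?w"
      unfolding weights_on_def 0 using c u(1) by (simp add: sum.distrib sum_distrib_left[symmetric])
    have w': "weights_on s ?w'" unfolding weights_on_def 0 using c by auto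
    have "comb ?w p = (\<Sum>v\<in>s. (1 / card s + e * u v) *\<^sub>R p v)"
      unfolding comb_def 0[symmetric] by (rule sum.cong) auto
    also have "\<dots> = (\<Sum>v\<in>s. (1 / card s) *\<^sub>R p v) + e *\<^sub>R (\<Sum>v\<in>s. u v *\<^sub>R p v)"
      by (simp add: scaleR_add_left sum.distrib scaleR_sum_right)
    also have "\<dots> = comb ?w' p" unfolding u(2) comb_def 0[symmetric] by (simp, rule sum.cong) auto
    finally have "?w = ?w'" using uniq[OF w w'] by blast
    then have "?w a = ?w' a" by (rule fun_cong)
    then show False using a e by simp
  qed
qed

section \<open>Barycentric coordinates are Lipschitz\<close>

text \<open>Inverting the linear systems of the sixteen triangles; the constant 8 is the largest one that occurs.\<close>

lemma cell_weights_Lipschitz: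
  assumes t: "t \<in> cell_facets i j" and w: "weights_on t w" "weights_on t w'"
    and a: "\<bar>(\<Sum>v<8. w v * fold_x v) - (\<Sum>v<8. w' v * fold_x v)\<bar> \<le> a"
    and b: "\<bar>(\<Sum>v<8. w v * fold_y v) - (\<Sum>v<8. w' v * fold_y v)\<bar> \<le> b"
  shows "\<bar>w v - w' v\<bar> \<le> 8 * a + 8 * b"
proof -
  have sub: "t \<subseteq> {..<8}" using t facet_subset unfolding facets_def by blast
  define u where "u = (\<lambda>v. w v - w' v)"
  have eight: "(\<Sum>v<8. f v) = f 0 + f 1 + f 2 + f 3 + f 4 + f 5 + f 6 + f 7" for f :: "nat \<Rightarrow> real"
    by (simp add: eval_nat_numeral)
  have s: "u 0 + u 1 + u 2 + u 3 + u 4 + u 5 + u 6 + u 7 = 0"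
    using weights_onD(3)[OF w(1)] weights_onD(3)[OF w(2)] unfolding u_def eight by simp
  have x: "\<bar>u 1 / 2 + u 3 / 2 + u 4 * 3 / 8 + u 5 / 8 + u 6 / 2\<bar> \<le> a"
    using a unfolding u_def eight by (simp add: fold_x_def field_simps)
  have y: "\<bar>u 0 / 4 + u 1 / 4 + u 2 / 2 + u 4 / 2 + u 6 / 2\<bar> \<le> b"
    using b unfolding u_def eight by (simp add: fold_y_def field_simps)
  have z: "r \<notin> t \<Longrightarrow> u r = 0" for r using weights_onD(2)[OF w(1)] weights_onD(2)[OF w(2)] by (simp add: u_def)
  have "u 0 \<le> 8*a+8*b \<and> - u 0 \<le> 8*a+8*b \<and> u 1 \<le> 8*a+8*b \<and> - u 1 \<le> 8*a+8*b \<and> u 2 \<le> 8*a+8*b \<and> - u 2 \<le> 8*a+8*b \<and>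
    u 3 \<le> 8*a+8*b \<and> - u 3 \<le> 8*a+8*b \<and> u 4 \<le> 8*a+8*b \<and> - u 4 \<le> 8*a+8*b \<and> u 5 \<le> 8*a+8*b \<and> - u 5 \<le> 8*a+8*b \<and>
    u 6 \<le> 8*a+8*b \<and> - u 6 \<le> 8*a+8*b \<and> u 7 \<le> 8*a+8*b \<and> - u 7 \<le> 8*a+8*b"
    using t z[of 0] z[of 1] z[of 2] z[of 3] z[of 4] z[of 5] z[of 6] z[of 7] s x[unfolded abs_le_iff] y[unfolded abs_le_iff]
    unfolding cell_facets_def
    by (cases i; cases j; simp del: One_nat_def; elim disjE; simp del: One_nat_def; intro conjI; linarith)
  moreover have "v < 8 \<Longrightarrow> v = 0 \<or> v = 1 \<or> v = 2 \<or> v = 3 \<or> v = 4 \<or> v = 5 \<or> v = 6 \<or> v = 7" by linarith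
  moreover have "\<not> v < 8 \<Longrightarrow> u v = 0" using z sub by blast
  moreover have "0 \<le> a" "0 \<le> b" using a b by linarith+
  ultimately have "\<bar>u v\<bar> \<le> 8 * a + 8 * b" by (cases "v < 8") (auto simp: abs_le_iff)
  then show ?thesis by (simp add: u_def)
qed

lemma unfold_diff: "\<bar>unfold b x - unfold b y\<bar> = \<bar>x - y\<bar>"
  by (auto simp: unfold_def)

lemma bary_Lipschitz_facet:
  assumes t: "t \<in> cell_facets i j" and w: "weights_on t w" "weights_on t w'"
    and x: "x = l + comb w (pos i j)" and y: "y = l + comb w' (pos i j)" and l: "l \<in> square_lattice"
  shows "\<bar>bary x v - bary y v\<bar> \<le> 16 * dist x y"
proof -
  have bx: "bary x = w" by (rule bary_eq[of x i j t]) (use t w x l in \<open>simp add: located_def\<close>)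
  have b_y: "bary y = w'" by (rule bary_eq[of y i j t]) (use t w y l in \<open>simp add: located_def\<close>)
  have "\<bar>(\<Sum>v<8. w v * fold_x v) - (\<Sum>v<8. w' v * fold_x v)\<bar> = \<bar>(x - y) $ 1\<bar>"
    by (simp add: x y comb_pos_nth[OF w(1)] comb_pos_nth[OF w(2)] unfold_diff)
  moreover have "\<bar>(\<Sum>v<8. w v * fold_y v) - (\<Sum>v<8. w' v * fold_y v)\<bar> = \<bar>(x - y) $ 2\<bar>"
    by (simp add: x y comb_pos_nth[OF w(1)] comb_pos_nth[OF w(2)] unfold_diff)
  ultimately have "\<bar>w v - w' v\<bar> \<le> 8 * dist x y + 8 * dist x y"
    using component_le_norm_cart[of "x - y"] by (intro cell_weights_Lipschitz[OF t w]) (simp_all only: dist_norm)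
  then show ?thesis by (simp add: bx b_y)
qed

text \<open>Along a segment the finitely many translated triangles that meet it give a closed cover on whose members the
  coordinates are Lipschitz.\<close>

lemma bary_Lipschitz: "\<bar>bary x v - bary y v\<bar> \<le> 16 * dist x y"
proof -
  define g where "g = (\<lambda>s::real. x + s *\<^sub>R (y - x))"
  define L where "L = {l \<in> square_lattice. norm l \<le> norm x + norm (y - x) + 2}"
  define I where "I = {(i, j, t, l). t \<in> cell_facets i j \<and> l \<in> L}"
  define C where "C = (\<lambda>(i, j, t, l). {s. g s - l \<in> convex hull (pos i j ` t)})"
  have sub: "t \<in> cell_facets i j \<Longrightarrow> t \<subseteq> {..<8}" for i j t using facet_subset unfolding facets_def by blast
  have finL: "finite L"
  proof -
    define N where "N = \<lceil>norm x + norm (y - x) + 2\<rceil>"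
    have "L \<subseteq> (\<lambda>(m, n). vector [of_int m, of_int n]) ` ({-N..N} \<times> {-N..N})"
    proof
      fix l assume l: "l \<in> L"
      then obtain m n where mn: "l $ 1 = of_int m" "l $ 2 = of_int n"
        unfolding L_def square_lattice_iff by (auto elim!: Ints_cases)
      have "\<bar>l $ k\<bar> \<le> norm x + norm (y - x) + 2" for k using l component_le_norm_cart[of l k] unfolding L_def by auto
      from this[of 1] this[of 2] have "\<bar>of_int m\<bar> \<le> norm x + norm (y - x) + 2" "\<bar>of_int n\<bar> \<le> norm x + norm (y - x) + 2"
        unfolding mn by auto
      then have "\<bar>m\<bar> \<le> N" "\<bar>n\<bar> \<le> N" unfolding N_def by linarith+
      moreover have "l = vector [of_int m, of_int n]" by (simp add: vec2_eq mn)
      ultimately show "l \<in> (\<lambda>(m, n). vector [of_int m, of_int n]) ` ({-N..N} \<times> {-N..N})" by force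
    qed
    then show ?thesis by (rule finite_subset) simp
  qed
  have finI: "finite I"
  proof -
    have "I \<subseteq> UNIV \<times> UNIV \<times> facets \<times> L" unfolding I_def facets_def by auto
    moreover have "finite facets" unfolding facets_eq by simp
    ultimately show ?thesis
      using finL finite_subset[of I "(UNIV::bool set) \<times> (UNIV::bool set) \<times> facets \<times> L"] by simp
  qed
  have "(16 * dist x y)-lipschitz_on {0..1} (\<lambda>s. bary (g s) v)"
  proof (rule lipschitz_on_closed_Union[OF _ _ finI])
    fix k assume "k \<in> I"
    then obtain i j t l where k: "k = (i, j, t, l)" and t: "t \<in> cell_facets i j" and l: "l \<in> square_lattice"
      unfolding I_def L_def by auto
    show "closed (C k)"
    proof -
      have "finite t" using sub[OF t] finite_subset by blast
      then have "closed (convex hull (pos i j ` t))" by (intro compact_imp_closed finite_imp_compact_convex_hull) auto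
      then have "closed ((\<lambda>s. g s - l) -` (convex hull (pos i j ` t)))"
        by (rule closed_vimage) (auto simp: g_def intro!: continuous_intros)
      then show ?thesis by (simp add: C_def k vimage_def)
    qed
    show "(16 * dist x y)-lipschitz_on (C k) (\<lambda>s. bary (g s) v)"
    proof (rule lipschitz_onI)
      fix r s assume rs: "r \<in> C k" "s \<in> C k"
      obtain w w' where w: "weights_on t w" "weights_on t w'" and eq: "g r - l = comb w (pos i j)" "g s - l = comb w' (pos i j)"
        using rs unfolding C_def k by (auto simp: convex_hull_eq_comb[OF sub[OF t]])
      have "\<bar>bary (g r) v - bary (g s) v\<bar> \<le> 16 * dist (g r) (g s)"
        by (rule bary_Lipschitz_facet[OF t w _ _ l]) (simp_all add: eq[symmetric])
      also have "dist (g r) (g s) = dist x y * dist r s"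
        by (simp add: g_def dist_norm scaleR_diff_left[symmetric] norm_minus_commute)
      finally show "dist (bary (g r) v) (bary (g s) v) \<le> 16 * dist x y * dist r s" by (simp add: dist_real_def)
    qed simp
  next
    show "{0..1} \<subseteq> (\<Union>k\<in>I. C k)"
    proof
      fix s :: real assume s: "s \<in> {0..1}"
      obtain i j t where loc: "located (g s) i j t (bary (g s))" using located_bary by blast
      let ?w = "bary (g s)" let ?l = "g s - comb ?w (pos i j)"
      have t: "t \<in> cell_facets i j" and w: "weights_on t ?w" and l: "?l \<in> square_lattice" using loc unfolding located_def by auto
      have "norm (pos i j v) \<le> 2" for v
      proof -
        have "\<bar>pos i j v $ 1\<bar> \<le> 1" "\<bar>pos i j v $ 2\<bar> \<le> 1"
          using fold_bounds[of v] by (auto simp: pos_def unfold_def)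
        then show ?thesis using norm_le_l1_cart[of "pos i j v"] by (simp add: sum_2)
      qed
      then have "norm (comb ?w (pos i j)) \<le> 2" by (intro norm_comb_le[OF w])
      moreover have "norm (g s) \<le> norm x + norm (y - x)"
      proof -
        have "norm (g s) \<le> norm x + \<bar>s\<bar> * norm (y - x)" unfolding g_def using norm_triangle_ineq[of x "s *\<^sub>R (y - x)"] by simp
        also have "\<bar>s\<bar> * norm (y - x) \<le> 1 * norm (y - x)" using s by (intro mult_right_mono) auto
        finally show ?thesis by simp
      qed
      ultimately have "norm ?l \<le> norm x + norm (y - x) + 2" using norm_triangle_ineq4[of "g s" "comb ?w (pos i j)"] by linarith
      then have "(i, j, t, ?l) \<in> I" using t l unfolding I_def L_def by auto
      moreover have "s \<in> C (i, j, t, ?l)"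
        using w unfolding C_def by (auto simp: convex_hull_eq_comb[OF sub[OF t]])
      ultimately show "s \<in> (\<Union>k\<in>I. C k)" by blast
    qed
  qed simp
  then have "dist (bary (g 0) v) (bary (g 1) v) \<le> 16 * dist x y * dist (0::real) 1"
    by (rule lipschitz_onD) auto
  then show ?thesis by (simp add: g_def dist_real_def)
qed

text \<open>The map that is affine on triangles with prescribed values at the vertices.\<close>

definition interp :: "(nat \<Rightarrow> 'a::real_vector) \<Rightarrow> real^2 \<Rightarrow> 'a" where
  "interp p x = comb (bary x) p"

lemma bary_weights: "\<exists>t\<in>facets. weights_on t (bary x)"
  using located_bary[of x] unfolding located_def facets_def by blast

lemma interp_diff_le:
  fixes p :: "nat \<Rightarrow> 'a::real_normed_vector"
  assumes "\<And>v. v < 8 \<Longrightarrow> norm (p v - q v) \<le> c"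
  shows "norm (interp p x - interp q x) \<le> c"
proof -
  obtain t where t: "t \<in> facets" "weights_on t (bary x)" using bary_weights by blast
  have "interp p x - interp q x = comb (bary x) (\<lambda>v. p v - q v)" by (simp add: interp_def comb_diff)
  then show ?thesis using norm_comb_le[OF t(2), of "\<lambda>v. p v - q v" c] assms facet_subset[OF t(1)] by auto
qed

lemma interp_Lipschitz:
  fixes p :: "nat \<Rightarrow> 'a::real_normed_vector"
  assumes "\<And>v. v < 8 \<Longrightarrow> norm (p v) \<le> c"
  shows "norm (interp p x - interp p y) \<le> 128 * c * norm (x - y)"
proof -
  have "interp p x - interp p y = (\<Sum>v<8. (bary x v - bary y v) *\<^sub>R p v)"
    by (simp add: interp_def comb_def scaleR_diff_left sum_subtractf)
  also have "norm \<dots> \<le> (\<Sum>v<(8::nat). 16 * norm (x - y) * c)"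
  proof (rule sum_norm_le)
    fix v :: nat assume "v \<in> {..<8}"
    then have "norm (p v) \<le> c" using assms by auto
    moreover have "\<bar>bary x v - bary y v\<bar> \<le> 16 * norm (x - y)" using bary_Lipschitz[of x v y] by (simp add: dist_norm)
    ultimately show "norm ((bary x v - bary y v) *\<^sub>R p v) \<le> 16 * norm (x - y) * c"
      by (simp add: mult_mono)
  qed
  also have "\<dots> = 128 * c * norm (x - y)" by simp
  finally show ?thesis .
qed

lemma interp_periodic: "x - y \<in> square_lattice \<Longrightarrow> interp p x = interp p y"
  unfolding interp_def by (simp add: bary_periodic)

lemma interp_comb: "t \<in> cell_facets i j \<Longrightarrow> weights_on t w \<Longrightarrow> interp p (comb w (pos i j)) = comb w p"
  unfolding interp_def by (simp add: bary_comb)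

section \<open>Flat tori as quotients\<close>

lemma torus_proj_eq_iff:
  assumes "is_lattice \<Lambda>"
  shows "torus_proj \<Lambda> x = torus_proj \<Lambda> y \<longleftrightarrow> y - x \<in> \<Lambda>"
  unfolding torus_proj_def using eq_equiv_class_iff[OF is_lattice_equiv[OF assms], of x y] by (simp add: lattice_rel_def)

lemma torus_proj_self: "is_lattice \<Lambda> \<Longrightarrow> x \<in> torus_proj \<Lambda> x"
  using is_lattice_group(1) by (fastforce simp: torus_proj_def lattice_rel_def)

lemma torus_proj_mem_iff:
  assumes "is_lattice \<Lambda>"
  shows "a \<in> torus_proj \<Lambda> x \<longleftrightarrow> torus_proj \<Lambda> x = torus_proj \<Lambda> a"
  unfolding torus_proj_eq_iff[OF assms] by (simp add: torus_proj_def lattice_rel_def)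

lemma torus_proj_in: "torus_proj \<Lambda> x \<in> flat_torus \<Lambda>"
  by (auto simp: torus_proj_def flat_torus_def intro: quotientI)

lemma flat_torus_eq: "flat_torus \<Lambda> = range (torus_proj \<Lambda>)"
  by (auto simp: torus_proj_def flat_torus_def quotient_def)

lemma le_setdist_torus:
  assumes "is_lattice \<Lambda>" "\<And>a b. torus_proj \<Lambda> a = torus_proj \<Lambda> x \<Longrightarrow> torus_proj \<Lambda> b = torus_proj \<Lambda> y \<Longrightarrow> d \<le> dist a b"
  shows "d \<le> setdist (torus_proj \<Lambda> x) (torus_proj \<Lambda> y)"
  using torus_proj_self[OF assms(1)] assms(2)
  by (intro le_setdistI) (auto simp: torus_proj_mem_iff[OF assms(1)])

lemma setdist_torus_le_dist:
  assumes "is_lattice \<Lambda>"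
  shows "setdist (torus_proj \<Lambda> x) (torus_proj \<Lambda> y) \<le> dist x y"
  by (intro setdist_le_dist torus_proj_self assms)

lemma torus_topspace: "is_lattice \<Lambda> \<Longrightarrow> topspace (torus_topology \<Lambda>) = flat_torus \<Lambda>"
  unfolding torus_topology_def by (rule Metric_space.topspace_mtopology[OF Metric_space_flat_torus])

lemma openin_torus:
  assumes "is_lattice \<Lambda>"
  shows "openin (torus_topology \<Lambda>) U \<longleftrightarrow> U \<subseteq> flat_torus \<Lambda> \<and> (\<forall>p\<in>U. \<exists>r>0. \<forall>q\<in>flat_torus \<Lambda>. setdist p q < r \<longrightarrow> q \<in> U)"
  unfolding torus_topology_def Metric_space.openin_mtopology[OF Metric_space_flat_torus[OF assms]]
    Metric_space.mball_def[OF Metric_space_flat_torus[OF assms]] by blast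

lemma continuous_torus_proj:
  assumes "is_lattice \<Lambda>"
  shows "continuous_map euclidean (torus_topology \<Lambda>) (torus_proj \<Lambda>)"
  unfolding continuous_map_def torus_topspace[OF assms]
proof (intro conjI allI impI)
  show "torus_proj \<Lambda> \<in> topspace euclidean \<rightarrow> flat_torus \<Lambda>" by (simp add: torus_proj_in)
  fix U assume U: "openin (torus_topology \<Lambda>) U"
  have "open {x. torus_proj \<Lambda> x \<in> U}"
    unfolding open_dist
  proof (rule ballI)
    fix x assume "x \<in> {x. torus_proj \<Lambda> x \<in> U}"
    then have "torus_proj \<Lambda> x \<in> U" by simp
    then obtain r where r: "r > 0" "\<forall>q\<in>flat_torus \<Lambda>. setdist (torus_proj \<Lambda> x) q < r \<longrightarrow> q \<in> U"
      using U unfolding openin_torus[OF assms] by blast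
    have "torus_proj \<Lambda> y \<in> U" if "dist y x < r" for y
      using r(2) setdist_torus_le_dist[OF assms, of x y] that torus_proj_in[of \<Lambda> y] by (simp add: dist_commute)
    then show "\<exists>e>0. \<forall>y. dist y x < e \<longrightarrow> y \<in> {x. torus_proj \<Lambda> x \<in> U}" using r(1) by blast
  qed
  then show "openin euclidean {x \<in> topspace euclidean. torus_proj \<Lambda> x \<in> U}" by simp
qed

lemma continuous_map_torus_Lipschitz:
  fixes f :: "(real^2) set \<Rightarrow> 'a::metric_space"
  assumes L: "is_lattice \<Lambda>" and lip: "\<And>p q. p \<in> flat_torus \<Lambda> \<Longrightarrow> q \<in> flat_torus \<Lambda> \<Longrightarrow> dist (f p) (f q) \<le> C * setdist p q"
  shows "continuous_map (torus_topology \<Lambda>) euclidean f"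
  unfolding continuous_map_def torus_topspace[OF L]
proof (intro conjI allI impI)
  show "f \<in> flat_torus \<Lambda> \<rightarrow> topspace euclidean" by simp
  fix U :: "'a set" assume "openin euclidean U"
  then have U: "open U" by simp
  show "openin (torus_topology \<Lambda>) {p \<in> flat_torus \<Lambda>. f p \<in> U}"
    unfolding openin_torus[OF L]
  proof (intro conjI ballI)
    fix p assume p: "p \<in> {p \<in> flat_torus \<Lambda>. f p \<in> U}"
    then obtain e where e: "e > 0" "\<And>z. dist z (f p) < e \<Longrightarrow> z \<in> U" using U unfolding open_dist by blast
    have "f q \<in> U" if q: "q \<in> flat_torus \<Lambda>" "setdist p q < e / (\<bar>C\<bar> + 1)" for q
    proof (rule e(2))
      have "dist (f q) (f p) \<le> C * setdist p q" using lip[of p q] p q(1) by (simp add: dist_commute)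
      also have "\<dots> \<le> (\<bar>C\<bar> + 1) * setdist p q" by (intro mult_right_mono setdist_pos_le) auto
      also have "\<dots> < e" using q(2) by (simp add: pos_less_divide_eq mult.commute add_nonneg_pos)
      finally show "dist (f q) (f p) < e" .
    qed
    moreover have "e / (\<bar>C\<bar> + 1) > 0" using e(1) by (intro divide_pos_pos) auto
    ultimately show "\<exists>r>0. \<forall>q\<in>flat_torus \<Lambda>. setdist p q < r \<longrightarrow> q \<in> {p \<in> flat_torus \<Lambda>. f p \<in> U}" by blast
  qed simp
qed

section \<open>Isometries of triangles\<close>

text \<open>Linear extension of the edge vectors; polarisation turns equal edge lengths into equal inner products.\<close>

lemma triangle_isometry:
  fixes q :: "'i \<Rightarrow> real^2" and p :: "'i \<Rightarrow> real^3"
  assumes card: "card t = 3" and inj: "inj_on q t" and ind: "\<not> affine_dependent (q ` t)"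
    and len: "\<And>a b. a \<in> t \<Longrightarrow> b \<in> t \<Longrightarrow> norm (q a - q b) = norm (p a - p b)"
  shows "\<exists>f c. linear f \<and> (\<forall>v. norm (f v) = norm v) \<and> (\<forall>a\<in>t. p a = c + f (q a))"
proof -
  obtain a b c where t: "t = {a, b, c}" and ne: "a \<noteq> b" "a \<noteq> c" "b \<noteq> c"
    using card by (auto simp: card_3_iff)
  have q: "q a \<noteq> q b" "q a \<noteq> q c" "q b \<noteq> q c" using inj ne unfolding t inj_on_def by auto
  define u where "u = q b - q a"
  define v where "v = q c - q a"
  have "(\<lambda>x. - q a + x) ` {q b, q c} = {u, v}" by (auto simp: u_def v_def)
  then have ind: "independent {u, v}"
    using ind affine_dependent_iff_dependent[of "q a" "{q b, q c}"] q by (simp add: t)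
  have uv: "u \<noteq> v" using q by (simp add: u_def v_def)
  obtain f where f: "linear f" and fu: "f u = p b - p a" and fv: "f v = p c - p a"
    using linear_independent_extend[OF ind, of "\<lambda>x. if x = u then p b - p a else p c - p a"] uv by auto
  have span: "span {u, v} = UNIV"
    using card_ge_dim_independent[of "{u, v}" UNIV] ind uv by (auto simp: dim_UNIV)
  have iso: "norm (f x) = norm x" for x
  proof -
    have "x \<in> span {u, v}" using span by simp
    then obtain r s where x: "x = r *\<^sub>R u + s *\<^sub>R v"
      by (auto simp: span_insert span_singleton algebra_simps)
    have l: "norm u = norm (f u)" "norm v = norm (f v)" "norm (u - v) = norm (f u - f v)"
      using len[of b a] len[of c a] len[of b c] unfolding fu fv by (simp_all add: t u_def v_def)
    have uu: "inner u u = inner (f u) (f u)" "inner v v = inner (f v) (f v)" "inner (u - v) (u - v) = inner (f u - f v) (f u - f v)"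
      using l by (simp_all add: dot_square_norm)
    then have uv: "inner u v = inner (f u) (f v)"
      by (simp add: inner_diff_left inner_diff_right inner_commute)
    have fx: "f x = r *\<^sub>R f u + s *\<^sub>R f v" unfolding x using f by (simp add: linear_add linear_scale)
    have "inner (f x) (f x) = inner x x"
      unfolding fx unfolding x by (simp add: inner_add_left inner_add_right uu uv inner_commute[of v u] inner_commute[of "f v" "f u"])
    then show ?thesis by (simp add: norm_eq_sqrt_inner)
  qed
  have "p b = (p a - f (q a)) + f (q b)" "p c = (p a - f (q a)) + f (q c)"
    using fu fv f by (simp_all add: u_def v_def linear_diff algebra_simps)
  then have "\<forall>x\<in>t. p x = (p a - f (q a)) + f (q x)" by (simp add: t)
  then show ?thesis using f iso by blast
qed

section \<open>Developing a nearby torus\<close>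

text \<open>Binary codes tell the sixteen facets apart.\<close>

lemma cell_facet_code:
  assumes "t \<in> cell_facets i j"
  shows "(\<Sum>v\<in>t. 2 ^ v) \<in> (if j then if i then {148, 208, 224, 104} else {76, 140}
    else if i then {21, 161, 49, 50, 82, 42} else {137, 11, 7, 70 :: nat})"
  using assms unfolding cell_facets_def by (cases i; cases j; simp; elim disjE; simp)

lemma cell_facets_disjoint:
  assumes "t \<in> cell_facets i j" "t \<in> cell_facets i' j'"
  shows "i = i' \<and> j = j'"
proof -
  define x :: nat where "x = (\<Sum>v\<in>t. 2 ^ v)"
  show ?thesis
    using cell_facet_code[OF assms(1), folded x_def] cell_facet_code[OF assms(2), folded x_def]
    by (cases i; cases j; cases i'; cases j'; simp; elim disjE; simp)
qed

lemma cell_facetD: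
  assumes "t \<in> cell_facets i j"
  shows "t \<in> facets" "t \<subseteq> {..<8}" "card t = 3"
proof -
  show f: "t \<in> facets" unfolding facets_def using assms by blast
  show "t \<subseteq> {..<8}" "card t = 3" by (rule facet_subset[OF f], rule facet_card[OF f])
qed

text \<open>The constant 129 collects one \<open>\<eta>\<close> for \<open>S\<close> and the Lipschitz constant \<open>128 * \<eta>\<close> of the interpolated
  displacement, and makes \<open>\<Psi>\<close> below differ from the identity by a contraction.\<close>

locale development =
  fixes S :: "real^2 \<Rightarrow> real^2" and D :: "nat \<Rightarrow> real^2" and \<eta> :: real
  assumes S: "linear S" and S_near: "norm (S x - x) \<le> \<eta> * norm x"
    and D_small: "v < 8 \<Longrightarrow> norm (D v) \<le> \<eta>" and eta: "0 \<le> \<eta>" "129 * \<eta> < 1"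
begin

definition \<Psi> :: "real^2 \<Rightarrow> real^2" where "\<Psi> x = S x + interp D x"

definition \<Lambda> :: "(real^2) set" where "\<Lambda> = S ` square_lattice"

definition vert :: "bool \<Rightarrow> bool \<Rightarrow> nat \<Rightarrow> real^2" where "vert i j v = S (pos i j v) + D v"

definition K :: "(real^2) set set" where "K = {vert i j ` t | i j t. t \<in> cell_facets i j}"

lemma \<Psi>_near: "norm (\<Psi> x - \<Psi> y - (x - y)) \<le> 129 * \<eta> * norm (x - y)"
proof -
  have e: "\<Psi> x - \<Psi> y - (x - y) = (S (x - y) - (x - y)) + (interp D x - interp D y)"
    by (simp add: \<Psi>_def linear_diff[OF S])
  have "norm (\<Psi> x - \<Psi> y - (x - y)) \<le> norm (S (x - y) - (x - y)) + norm (interp D x - interp D y)"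
    unfolding e by (rule norm_triangle_ineq)
  also have "\<dots> \<le> \<eta> * norm (x - y) + 128 * \<eta> * norm (x - y)"
    by (intro add_mono S_near interp_Lipschitz D_small)
  finally show ?thesis by (simp add: algebra_simps)
qed

lemma \<Psi>_bounds:
  "(1 - 129 * \<eta>) * dist x y \<le> dist (\<Psi> x) (\<Psi> y)" "dist (\<Psi> x) (\<Psi> y) \<le> (1 + 129 * \<eta>) * dist x y"
  using \<Psi>_near[of x y] norm_triangle_ineq2[of "x - y" "(x - y) - (\<Psi> x - \<Psi> y)"]
    norm_triangle_ineq[of "\<Psi> x - \<Psi> y - (x - y)" "x - y"]
  by (simp_all add: dist_norm algebra_simps norm_minus_commute)

text \<open>A solution of \<open>\<Psi> x = y\<close> is a fixed point of the contraction \<open>x \<mapsto> y + x - \<Psi> x\<close>.\<close>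

lemma \<Psi>_surj: "\<exists>x. \<Psi> x = y"
proof -
  have "\<exists>!x. y + x - \<Psi> x = x"
  proof (rule banach_fix_type[of "129 * \<eta>"])
    show "\<forall>x z. dist (y + x - \<Psi> x) (y + z - \<Psi> z) \<le> 129 * \<eta> * dist x z"
    proof (intro allI)
      fix x z
      have "dist (y + x - \<Psi> x) (y + z - \<Psi> z) = norm (\<Psi> x - \<Psi> z - (x - z))"
        unfolding dist_norm by (subst norm_minus_commute) (simp add: algebra_simps)
      then show "dist (y + x - \<Psi> x) (y + z - \<Psi> z) \<le> 129 * \<eta> * dist x z" using \<Psi>_near[of x z] by (simp add: dist_norm)
    qed
  qed (use eta in auto)
  then obtain x where "y + x - \<Psi> x = x" by blast
  then show ?thesis by (intro exI[of _ x]) (simp add: algebra_simps)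
qed

lemma \<Psi>_inj: "\<Psi> x = \<Psi> y \<Longrightarrow> x = y"
proof -
  assume "\<Psi> x = \<Psi> y"
  then have "(1 - 129 * \<eta>) * dist x y \<le> 0" using \<Psi>_bounds(1)[of x y] by simp
  moreover have "0 < 1 - 129 * \<eta>" using eta by simp
  ultimately have "dist x y \<le> 0" by (simp add: mult_le_0_iff)
  then show "x = y" by simp
qed

lemma S_inj: "inj S"
  unfolding linear_injective_0[OF S]
proof (intro allI impI)
  fix x assume "S x = 0"
  then have "norm x \<le> \<eta> * norm x" using S_near[of x] by simp
  then have "(1 - \<eta>) * norm x \<le> 0" by (simp add: algebra_simps)
  moreover have "0 < 1 - \<eta>" using eta by simp
  ultimately have "norm x \<le> 0" by (simp add: mult_le_0_iff)
  then show "x = 0" by simp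
qed

lemma \<Psi>_shift: "l \<in> square_lattice \<Longrightarrow> \<Psi> (x + l) = \<Psi> x + S l"
  using interp_periodic[of "x + l" x D] by (simp add: \<Psi>_def linear_add[OF S])

lemma lattice: "is_lattice \<Lambda>"
proof -
  obtain a b where ab: "a \<noteq> b" "independent {a, b}" and sq: "square_lattice = {of_int m *\<^sub>R a + of_int n *\<^sub>R b | m n. True}"
    using is_lattice_square_lattice unfolding is_lattice_def by blast
  have "independent (S ` {a, b})" by (rule linear_independent_injective_image[OF S ab(2) inj_on_subset[OF S_inj subset_UNIV]])
  moreover have "S a \<noteq> S b" using ab(1) S_inj by (auto simp: inj_def)
  moreover have "\<Lambda> = {of_int m *\<^sub>R S a + of_int n *\<^sub>R S b | m n. True}"
  proof -
    have e: "S (of_int m *\<^sub>R a + of_int n *\<^sub>R b) = of_int m *\<^sub>R S a + of_int n *\<^sub>R S b" for m n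
      by (simp add: linear_add[OF S] linear_scale[OF S])
    have "\<Lambda> = {S (of_int m *\<^sub>R a + of_int n *\<^sub>R b) | m n. True}" unfolding \<Lambda>_def sq by blast
    then show ?thesis unfolding e .
  qed
  ultimately show ?thesis unfolding is_lattice_def by auto
qed

text \<open>\<open>\<Psi>\<close> descends to a bijection of the tori, and points of either torus are told apart by their weights.\<close>

lemma proj_\<Psi>_eq_iff: "torus_proj \<Lambda> (\<Psi> x) = torus_proj \<Lambda> (\<Psi> y) \<longleftrightarrow> bary x = bary y"
  unfolding torus_proj_eq_iff[OF lattice]
proof
  assume "\<Psi> y - \<Psi> x \<in> \<Lambda>"
  then obtain l where l: "l \<in> square_lattice" "\<Psi> y - \<Psi> x = S l" unfolding \<Lambda>_def by blast
  have "\<Psi> y = \<Psi> x + S l" using l(2) by (simp add: algebra_simps)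
  also have "\<dots> = \<Psi> (x + l)" using \<Psi>_shift[OF l(1)] by simp
  finally have "\<Psi> y = \<Psi> (x + l)" .
  from \<Psi>_inj[OF this] have "y - x = l" by simp
  then show "bary x = bary y" using bary_periodic[of y x] l(1) by simp
next
  assume "bary x = bary y"
  then have l: "y - x \<in> square_lattice" using bary_inj[of y x] by simp
  have "\<Psi> y - \<Psi> x = S (y - x)" using \<Psi>_shift[OF l, of x] by simp
  then show "\<Psi> y - \<Psi> x \<in> \<Lambda>" unfolding \<Lambda>_def using l by blast
qed

lemma \<Psi>_comb: "t \<in> cell_facets i j \<Longrightarrow> weights_on t w \<Longrightarrow> \<Psi> (comb w (pos i j)) = comb w (vert i j)"
  unfolding \<Psi>_def interp_comb vert_def comb_add comb_linear[OF S] ..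

lemma proj_comb_eq_iff:
  assumes "t \<in> cell_facets i j" "weights_on t w" "t' \<in> cell_facets i' j'" "weights_on t' w'"
  shows "torus_proj \<Lambda> (comb w (vert i j)) = torus_proj \<Lambda> (comb w' (vert i' j')) \<longleftrightarrow> w = w'"
  using proj_\<Psi>_eq_iff[of "comb w (pos i j)" "comb w' (pos i' j')"]
  by (simp add: \<Psi>_comb[OF assms(1,2)] \<Psi>_comb[OF assms(3,4)] bary_comb[OF assms(1,2)] bary_comb[OF assms(3,4)])

lemma weights_on_sub: "weights_on s w \<Longrightarrow> s \<subseteq> t \<Longrightarrow> weights_on t w"
  by (rule weights_on_mono) (auto dest: weights_onD(2))

lemma triangle_hull:
  assumes "t \<in> cell_facets i j" "s \<subseteq> t"
  shows "convex hull (vert i j ` s) = {comb w (vert i j) | w. weights_on s w}"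
  using assms cell_facetD(2) by (intro convex_hull_eq_comb) blast

lemma triangle_nondegenerate:
  assumes t: "t \<in> cell_facets i j"
  shows "inj_on (vert i j) t" "\<not> affine_dependent (vert i j ` t)"
proof -
  have u: "w = w'" if "weights_on t w" "weights_on t w'" "comb w (vert i j) = comb w' (vert i j)" for w w'
    using proj_comb_eq_iff[OF t that(1) t that(2)] that(3) by simp
  show "inj_on (vert i j) t" "\<not> affine_dependent (vert i j ` t)"
    using independent_of_unique_weights[OF cell_facetD(2)[OF t], of "vert i j"] u by blast+
qed

lemma proj_\<Psi>_facet: "\<exists>i j t. t \<in> cell_facets i j \<and> weights_on t (bary x) \<and> torus_proj \<Lambda> (\<Psi> x) = torus_proj \<Lambda> (comb (bary x) (vert i j))"
proof -
  obtain i j t where l: "located x i j t (bary x)" using located_bary by blast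
  then have t: "t \<in> cell_facets i j" "weights_on t (bary x)" unfolding located_def by auto
  have "torus_proj \<Lambda> (\<Psi> x) = torus_proj \<Lambda> (\<Psi> (comb (bary x) (pos i j)))"
    unfolding proj_\<Psi>_eq_iff bary_comb[OF t] ..
  then show ?thesis using t unfolding \<Psi>_comb[OF t] by blast
qed

lemma finite_K: "finite K"
proof -
  have "K \<subseteq> (\<lambda>(i, j, t). vert i j ` t) ` (UNIV \<times> UNIV \<times> facets)"
    unfolding K_def using cell_facetD(1) by force
  moreover have "finite facets" unfolding facets_eq by simp
  ultimately show ?thesis using finite_subset[of K "(\<lambda>(i, j, t). vert i j ` t) ` (UNIV \<times> UNIV \<times> facets)"] by simp
qed

lemma covered: "(\<Union>t\<in>K. torus_proj \<Lambda> ` (convex hull t)) = flat_torus \<Lambda>"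
proof
  show "(\<Union>t\<in>K. torus_proj \<Lambda> ` (convex hull t)) \<subseteq> flat_torus \<Lambda>" using torus_proj_in by blast
  show "flat_torus \<Lambda> \<subseteq> (\<Union>t\<in>K. torus_proj \<Lambda> ` (convex hull t))"
  proof
    fix p assume "p \<in> flat_torus \<Lambda>"
    then obtain x where p: "p = torus_proj \<Lambda> (\<Psi> x)" unfolding flat_torus_eq using \<Psi>_surj by (metis imageE)
    obtain i j t where t: "t \<in> cell_facets i j" "weights_on t (bary x)" "p = torus_proj \<Lambda> (comb (bary x) (vert i j))"
      using proj_\<Psi>_facet[of x] p by auto
    then have "comb (bary x) (vert i j) \<in> convex hull (vert i j ` t)" unfolding triangle_hull[OF t(1) order_refl] by blast
    moreover have "vert i j ` t \<in> K" unfolding K_def using t(1) by blast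
    ultimately show "p \<in> (\<Union>t\<in>K. torus_proj \<Lambda> ` (convex hull t))" using t(3) by blast
  qed
qed

text \<open>All conditions translate into statements about weights: by \<open>proj_comb_eq_iff\<close> the triangles intersect as the
  facets do as sets of vertices.\<close>

lemma triangulation: "torus_triangulation \<Lambda> K"
  unfolding torus_triangulation_def
proof (intro conjI ballI impI finite_K covered)
  fix k assume "k \<in> K"
  then obtain i j t where k: "k = vert i j ` t" and t: "t \<in> cell_facets i j" unfolding K_def by blast
  show "card k = 3" unfolding k using card_image[OF triangle_nondegenerate(1)[OF t]] cell_facetD(3)[OF t] by simp
  show "\<not> affine_dependent k" unfolding k by (rule triangle_nondegenerate(2)[OF t])
  show "inj_on (torus_proj \<Lambda>) (convex hull k)"
    unfolding k triangle_hull[OF t order_refl] 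
  proof (rule inj_onI)
    fix x y assume "x \<in> {comb w (vert i j) |w. weights_on t w}" "y \<in> {comb w (vert i j) |w. weights_on t w}"
      and eq: "torus_proj \<Lambda> x = torus_proj \<Lambda> y"
    then obtain w w' where w: "weights_on t w" "weights_on t w'" and xy: "x = comb w (vert i j)" "y = comb w' (vert i j)" by blast
    then show "x = y" using proj_comb_eq_iff[OF t w(1) t w(2)] eq by simp
  qed
next
  fix k k' assume "k \<in> K" "k' \<in> K" and ne: "k \<noteq> k'"
  then obtain i j t i' j' t' where k: "k = vert i j ` t" "k' = vert i' j' ` t'" and t: "t \<in> cell_facets i j" "t' \<in> cell_facets i' j'"
    unfolding K_def by blast
  let ?u = "t \<inter> t'"
  have "t \<noteq> t'" using ne t cell_facets_disjoint[of t i j i' j'] unfolding k by blast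
  moreover have "finite t" "finite t'" using cell_facetD(2)[OF t(1)] cell_facetD(2)[OF t(2)] finite_subset by blast+
  ultimately have "\<not> t \<subseteq> t'" "\<not> t' \<subseteq> t"
    using card_subset_eq[of t' t] card_subset_eq[of t t'] cell_facetD(3)[OF t(1)] cell_facetD(3)[OF t(2)] by auto
  then have u: "?u \<subset> t" "?u \<subset> t'" by blast+
  have sub: "vert i j ` ?u \<subset> k" "vert i' j' ` ?u \<subset> k'"
    unfolding k using image_strict_mono[OF triangle_nondegenerate(1)[OF t(1)] u(1)] image_strict_mono[OF triangle_nondegenerate(1)[OF t(2)] u(2)] by auto
  note h = triangle_hull[OF t(1) order_refl] triangle_hull[OF t(2) order_refl] triangle_hull[OF t(1) Int_lower1] triangle_hull[OF t(2) Int_lower2]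
  have wu: "weights_on ?u w" if "weights_on t w" "weights_on t' w" for w
    by (rule weights_on_mono[OF that(1)]) (use weights_onD(2)[OF that(1)] weights_onD(2)[OF that(2)] in blast)
  have uw: "weights_on t w" "weights_on t' w" if "weights_on ?u w" for w using weights_on_sub[OF that] by auto
  have common: "torus_proj \<Lambda> ` (convex hull k) \<inter> torus_proj \<Lambda> ` (convex hull k') = torus_proj \<Lambda> ` (convex hull (vert i j ` ?u))"
  proof (intro equalityI subsetI)
    fix p assume "p \<in> torus_proj \<Lambda> ` (convex hull k) \<inter> torus_proj \<Lambda> ` (convex hull k')"
    then obtain w w' where w: "weights_on t w" "p = torus_proj \<Lambda> (comb w (vert i j))" "weights_on t' w'" "p = torus_proj \<Lambda> (comb w' (vert i' j'))"
      unfolding k h by blast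
    have "w = w'" using proj_comb_eq_iff[OF t(1) w(1) t(2) w(3)] w(2,4) by simp
    then have "weights_on ?u w" using wu[OF w(1)] w(3) by simp
    then have "comb w (vert i j) \<in> {comb w (vert i j) |w. weights_on ?u w}" by blast
    then show "p \<in> torus_proj \<Lambda> ` (convex hull (vert i j ` ?u))" unfolding h w(2) by (rule imageI)
  next
    fix p assume "p \<in> torus_proj \<Lambda> ` (convex hull (vert i j ` ?u))"
    then obtain w where w: "weights_on ?u w" "p = torus_proj \<Lambda> (comb w (vert i j))" unfolding h by blast
    have p: "p = torus_proj \<Lambda> (comb w (vert i' j'))" using proj_comb_eq_iff[OF t(1) uw(1)[OF w(1)] t(2) uw(2)[OF w(1)]] w(2) by simp
    have "comb w (vert i j) \<in> {comb w (vert i j) |w. weights_on t w}" "comb w (vert i' j') \<in> {comb w (vert i' j') |w. weights_on t' w}"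
      using uw[OF w(1)] by blast+
    from imageI[OF this(1), of "torus_proj \<Lambda>"] imageI[OF this(2), of "torus_proj \<Lambda>"]
    show "p \<in> torus_proj \<Lambda> ` (convex hull k) \<inter> torus_proj \<Lambda> ` (convex hull k')" unfolding k h w(2)[symmetric] p[symmetric] by (rule IntI)
  qed
  have faces: "torus_proj \<Lambda> ` (convex hull (vert i j ` ?u)) = torus_proj \<Lambda> ` (convex hull (vert i' j' ` ?u))"
  proof -
    have e: "torus_proj \<Lambda> (comb w (vert i j)) = torus_proj \<Lambda> (comb w (vert i' j'))" if "weights_on ?u w" for w
      using proj_comb_eq_iff[OF t(1) uw(1)[OF that] t(2) uw(2)[OF that]] by simp
    have img: "f ` {comb w q | w. weights_on ?u w} = (\<lambda>w. f (comb w q)) ` {w. weights_on ?u w}" for f :: "real^2 \<Rightarrow> (real^2) set" and q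
      by blast
    show ?thesis unfolding h img by (rule image_cong[OF refl]) (simp add: e)
  qed
  show "\<exists>s' t'. s' \<subset> k \<and> t' \<subset> k' \<and> torus_proj \<Lambda> ` (convex hull k) \<inter> torus_proj \<Lambda> ` (convex hull k') = torus_proj \<Lambda> ` (convex hull s') \<and>
      torus_proj \<Lambda> ` (convex hull s') = torus_proj \<Lambda> ` (convex hull t')"
    by (rule exI[of _ "vert i j ` ?u"], rule exI[of _ "vert i' j' ` ?u"]) (intro conjI sub common faces)
qed

lemma card_vertices: "card (torus_vertices \<Lambda> K) = 8"
proof -
  define c where "c v = torus_proj \<Lambda> (vert True False v)" for v
  let ?d = "\<lambda>a v. if v = a then 1 else (0::real)"
  have iff: "torus_proj \<Lambda> (vert i j a) = torus_proj \<Lambda> (vert i' j' b) \<longleftrightarrow> a = b"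
    if t: "t \<in> cell_facets i j" "a \<in> t" "t' \<in> cell_facets i' j'" "b \<in> t'" for i j t a i' j' t' b
  proof -
    note 1 = weights_on_vertex[OF t(2) cell_facetD(2)[OF t(1)]] and 2 = weights_on_vertex[OF t(4) cell_facetD(2)[OF t(3)]]
    have "?d a = ?d b \<longleftrightarrow> a = b"
    proof
      assume "?d a = ?d b"
      from fun_cong[OF this, of a] show "a = b" by (simp split: if_splits)
    qed simp
    then show ?thesis using proj_comb_eq_iff[OF t(1) 1(1) t(3) 2(1)] unfolding 1(2) 2(2) by simp
  qed
  have all: "\<exists>t\<in>cell_facets True False. v \<in> t" if "v < 8" for v
  proof -
    have "v = 0 \<or> v = 1 \<or> v = 2 \<or> v = 3 \<or> v = 4 \<or> v = 5 \<or> v = 6 \<or> v = 7" using that by linarith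
    then show ?thesis by (auto simp: cell_facets_def)
  qed
  have "torus_vertices \<Lambda> K = c ` {..<8}"
  proof (intro equalityI subsetI)
    fix p assume "p \<in> torus_vertices \<Lambda> K"
    then obtain i j t v where t: "t \<in> cell_facets i j" "v \<in> t" and p: "p = torus_proj \<Lambda> (vert i j v)"
      unfolding torus_vertices_def K_def by blast
    have v: "v < 8" using t cell_facetD(2) by blast
    obtain t' where t': "t' \<in> cell_facets True False" "v \<in> t'" using all[OF v] by blast
    have "p = c v" unfolding p c_def using iff[OF t t'] by simp
    then show "p \<in> c ` {..<8}" using v by blast
  next
    fix p assume "p \<in> c ` {..<8}"
    then obtain v where v: "v < 8" "p = c v" by blast
    obtain t' where t': "t' \<in> cell_facets True False" "v \<in> t'" using all[OF v(1)] by blast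
    then have "vert True False ` t' \<in> K" unfolding K_def by blast
    then show "p \<in> torus_vertices \<Lambda> K" unfolding torus_vertices_def v(2) c_def using t'(2) by blast
  qed
  moreover have "inj_on c {..<8}"
  proof (rule inj_onI)
    fix a b assume ab: "a \<in> {..<8}" "b \<in> {..<8}" "c a = c b"
    obtain t where t: "t \<in> cell_facets True False" "a \<in> t" using all[of a] ab(1) by auto
    obtain t' where t': "t' \<in> cell_facets True False" "b \<in> t'" using all[of b] ab(2) by auto
    show "a = b" using iff[OF t t'] ab(3) unfolding c_def by simp
  qed
  ultimately show ?thesis by (simp add: card_image)
qed

text \<open>The piecewise affine map of the developed torus with prescribed vertex images.\<close>

definition fill :: "(nat \<Rightarrow> real^3) \<Rightarrow> (real^2) set \<Rightarrow> real^3" where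
  "fill P p = interp P (SOME x. torus_proj \<Lambda> (\<Psi> x) = p)"

lemma fill_proj: "fill P (torus_proj \<Lambda> (\<Psi> x)) = interp P x"
proof -
  have "torus_proj \<Lambda> (\<Psi> (SOME y. torus_proj \<Lambda> (\<Psi> y) = torus_proj \<Lambda> (\<Psi> x))) = torus_proj \<Lambda> (\<Psi> x)"
    by (rule someI) (rule refl)
  then show ?thesis unfolding fill_def interp_def proj_\<Psi>_eq_iff by simp
qed

lemma torus_cases:
  assumes "p \<in> flat_torus \<Lambda>"
  obtains x where "p = torus_proj \<Lambda> (\<Psi> x)"
  using assms \<Psi>_surj unfolding flat_torus_eq by (metis imageE)

lemma continuous_fill: "continuous_map (torus_topology \<Lambda>) euclidean (fill P)"
proof -
  define c where "c = Max ((\<lambda>v. norm (P v)) ` {..<8})"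
  have c: "norm (P v) \<le> c" if "v < 8" for v unfolding c_def by (rule Max_ge) (use that in auto)
  have c0: "0 \<le> c" using c[of 0] norm_ge_zero[of "P 0"] by linarith
  define C where "C = 128 * c / (1 - 129 * \<eta>)"
  have m: "0 < 1 - 129 * \<eta>" using eta by simp
  show ?thesis
  proof (rule continuous_map_torus_Lipschitz[OF lattice, of _ C])
    fix p q assume "p \<in> flat_torus \<Lambda>" "q \<in> flat_torus \<Lambda>"
    then obtain x y where p: "p = torus_proj \<Lambda> (\<Psi> x)" and q: "q = torus_proj \<Lambda> (\<Psi> y)" by (metis torus_cases)
    have le: "dist (fill P p) (fill P q) \<le> C * dist a b" if ab: "torus_proj \<Lambda> a = torus_proj \<Lambda> (\<Psi> x)" "torus_proj \<Lambda> b = torus_proj \<Lambda> (\<Psi> y)" for a b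
    proof -
      obtain x' y' where a: "a = \<Psi> x'" and b: "b = \<Psi> y'" using \<Psi>_surj by metis
      have "dist (fill P p) (fill P q) = norm (interp P x' - interp P y')"
        unfolding p q ab[symmetric] a b fill_proj dist_norm ..
      also have "\<dots> \<le> 128 * c * dist x' y'" unfolding dist_norm by (rule interp_Lipschitz) (rule c)
      also have "\<dots> = C * ((1 - 129 * \<eta>) * dist x' y')" using m by (simp add: C_def)
      also have "\<dots> \<le> C * dist a b" unfolding a b using m c0 by (intro mult_left_mono \<Psi>_bounds) (simp add: C_def)
      finally show ?thesis .
    qed
    show "dist (fill P p) (fill P q) \<le> C * setdist p q"
    proof (cases "C = 0")
      case True then show ?thesis using le[OF refl refl] by simp
    next
      case False
      then have C: "C > 0" using m c0 by (simp add: C_def less_le)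
      have "dist (fill P p) (fill P q) / C \<le> setdist p q"
        unfolding p q
      proof (rule le_setdist_torus[OF lattice])
        fix a b assume "torus_proj \<Lambda> a = torus_proj \<Lambda> (\<Psi> x)" "torus_proj \<Lambda> b = torus_proj \<Lambda> (\<Psi> y)"
        from le[OF this] show "dist (fill P (torus_proj \<Lambda> (\<Psi> x))) (fill P (torus_proj \<Lambda> (\<Psi> y))) / C \<le> dist a b"
          unfolding p q using C by (simp add: pos_divide_le_eq mult.commute)
      qed
      then show ?thesis using C by (simp add: pos_divide_le_eq mult.commute)
    qed
  qed
qed

lemma affine_isometric_fill:
  assumes len: "\<forall>i j. \<forall>t\<in>cell_facets i j. \<forall>a\<in>t. \<forall>b\<in>t. norm (vert i j a - vert i j b) = norm (P a - P b)"
    and k: "k \<in> K"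
  shows "affine_isometric_on_triangle \<Lambda> (fill P) k"
proof -
  obtain i j t where k: "k = vert i j ` t" and t: "t \<in> cell_facets i j" using k unfolding K_def by blast
  obtain f c where f: "linear f" "\<forall>v. norm (f v) = norm v" and fc: "\<forall>a\<in>t. P a = c + f (vert i j a)"
    using triangle_isometry[OF cell_facetD(3)[OF t] triangle_nondegenerate[OF t], of P] len t by blast
  have "fill P (torus_proj \<Lambda> x) = c + f x" if x: "x \<in> convex hull k" for x
  proof -
    obtain w where w: "weights_on t w" and xw: "x = comb w (vert i j)" using x unfolding k triangle_hull[OF t order_refl] by blast
    have "fill P (torus_proj \<Lambda> x) = comb w P" unfolding xw \<Psi>_comb[OF t w, symmetric] fill_proj interp_comb[OF t w] ..
    also have "\<dots> = comb w (\<lambda>a. c + f (vert i j a))" using fc by (intro comb_cong[OF w]) simp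
    also have "\<dots> = c + f x" unfolding comb_add comb_const[OF w] comb_linear[OF f(1)] xw ..
    finally show ?thesis .
  qed
  then show ?thesis unfolding affine_isometric_on_triangle_def using f by blast
qed

lemma piecewise_isometric_fill:
  assumes "\<forall>i j. \<forall>t\<in>cell_facets i j. \<forall>a\<in>t. \<forall>b\<in>t. norm (vert i j a - vert i j b) = norm (P a - P b)"
  shows "piecewise_isometric_map \<Lambda> (fill P)"
  unfolding piecewise_isometric_map_def using lattice continuous_fill triangulation affine_isometric_fill[OF assms] by blast

lemma compact_torus: "compact_space (torus_topology \<Lambda>)"
proof -
  have "compact (\<Union>k\<in>K. convex hull k)"
  proof (rule compact_UN[OF finite_K])
    fix k assume "k \<in> K"
    then have "finite k" using triangulation unfolding torus_triangulation_def by (metis card.infinite zero_neq_numeral)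
    then show "compact (convex hull k)" by (rule finite_imp_compact_convex_hull)
  qed
  then have "compactin euclidean (\<Union>k\<in>K. convex hull k)" by simp
  then have "compactin (torus_topology \<Lambda>) (torus_proj \<Lambda> ` (\<Union>k\<in>K. convex hull k))"
    by (rule image_compactin[OF _ continuous_torus_proj[OF lattice]])
  then show ?thesis unfolding compact_space_def torus_topspace[OF lattice] covered[symmetric] image_UN .
qed

text \<open>An injective continuous map from a compact space to a Hausdorff space is an embedding.\<close>

lemma embedding_fill:
  assumes sep: "\<forall>s\<in>facets. \<forall>t\<in>facets. \<forall>w w'. weights_on s w \<longrightarrow> weights_on t w' \<longrightarrow> comb w P = comb w' P \<longrightarrow> w = w'"
  shows "embedding_map (torus_topology \<Lambda>) euclidean (fill P)"
proof (rule injective_closed_imp_embedding_map[OF continuous_fill])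
  show "closed_map (torus_topology \<Lambda>) euclidean (fill P)"
    by (rule continuous_imp_closed_map[OF continuous_fill compact_torus]) simp
  show "inj_on (fill P) (topspace (torus_topology \<Lambda>))"
    unfolding torus_topspace[OF lattice]
  proof (rule inj_onI)
    fix p q assume "p \<in> flat_torus \<Lambda>" "q \<in> flat_torus \<Lambda>" and eq: "fill P p = fill P q"
    then obtain x y where p: "p = torus_proj \<Lambda> (\<Psi> x)" and q: "q = torus_proj \<Lambda> (\<Psi> y)" by (metis torus_cases)
    obtain s t where s: "s \<in> facets" "weights_on s (bary x)" and t: "t \<in> facets" "weights_on t (bary y)" using bary_weights by meson
    have "comb (bary x) P = comb (bary y) P" using eq unfolding p q fill_proj interp_def .
    then have "bary x = bary y" using sep s t by blast
    then show "p = q" unfolding p q proj_\<Psi>_eq_iff .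
  qed
qed

lemma vertex_paper_torus_fill:
  assumes "\<forall>i j. \<forall>t\<in>cell_facets i j. \<forall>a\<in>t. \<forall>b\<in>t. norm (vert i j a - vert i j b) = norm (P a - P b)"
    and "\<forall>s\<in>facets. \<forall>t\<in>facets. \<forall>w w'. weights_on s w \<longrightarrow> weights_on t w' \<longrightarrow> comb w P = comb w' P \<longrightarrow> w = w'"
  shows "vertex_paper_torus 8 \<Lambda> (fill P)"
  unfolding vertex_paper_torus_def paper_torus_def
  using piecewise_isometric_fill[OF assms(1)] embedding_fill[OF assms(2)] triangulation card_vertices affine_isometric_fill[OF assms(1)] by blast

lemma square_proj_eq_iff: "torus_proj square_lattice x = torus_proj square_lattice y \<longleftrightarrow> bary x = bary y"
  unfolding torus_proj_eq_iff[OF is_lattice_square_lattice] using bary_inj[of y x] bary_periodic[of y x] by auto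

text \<open>The map of tori induced by \<open>\<Psi>\<close>.\<close>

definition \<alpha> :: "(real^2) set \<Rightarrow> (real^2) set" where
  "\<alpha> p = torus_proj \<Lambda> (\<Psi> (SOME x. torus_proj square_lattice x = p))"

lemma \<alpha>_proj: "\<alpha> (torus_proj square_lattice x) = torus_proj \<Lambda> (\<Psi> x)"
proof -
  have "torus_proj square_lattice (SOME y. torus_proj square_lattice y = torus_proj square_lattice x) = torus_proj square_lattice x"
    by (rule someI) (rule refl)
  then show ?thesis unfolding \<alpha>_def proj_\<Psi>_eq_iff square_proj_eq_iff .
qed

text \<open>For \<open>c = 129 * \<eta>\<close> the bounds \<open>1 - c\<close> and \<open>1 + c\<close> for \<open>\<Psi>\<close> pass to distances of cosets, and
  \<open>1 / (1 + e) \<le> 1 - c\<close> holds when \<open>2 * c \<le> e \<le> 1\<close>.\<close>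

lemma bilipschitz_\<alpha>:
  assumes e: "258 * \<eta> \<le> e" "e \<le> 1"
  shows "torus_bilipschitz (1 + e) square_lattice \<Lambda> \<alpha>"
  unfolding torus_bilipschitz_def
proof (intro conjI ballI)
  show "\<alpha> \<in> flat_torus square_lattice \<rightarrow> flat_torus \<Lambda>" unfolding \<alpha>_def using torus_proj_in by blast
  fix p q assume "p \<in> flat_torus square_lattice" "q \<in> flat_torus square_lattice"
  then obtain x y where p: "p = torus_proj square_lattice x" and q: "q = torus_proj square_lattice y" unfolding flat_torus_eq by blast
  have e0: "0 \<le> e" using e eta by simp
  show "setdist (\<alpha> p) (\<alpha> q) \<le> (1 + e) * setdist p q"
  proof -
    have "setdist (\<alpha> p) (\<alpha> q) / (1 + e) \<le> dist a b"
      if ab: "torus_proj square_lattice a = p" "torus_proj square_lattice b = q" for a b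
    proof -
      have "setdist (\<alpha> p) (\<alpha> q) \<le> dist (\<Psi> a) (\<Psi> b)"
        unfolding ab[symmetric] \<alpha>_proj by (rule setdist_torus_le_dist[OF lattice])
      also have "\<dots> \<le> (1 + 129 * \<eta>) * dist a b" by (rule \<Psi>_bounds)
      also have "\<dots> \<le> (1 + e) * dist a b" using e eta by (intro mult_right_mono) auto
      finally show ?thesis using e0 by (simp add: pos_divide_le_eq mult.commute)
    qed
    then have "setdist (\<alpha> p) (\<alpha> q) / (1 + e) \<le> setdist p q"
      unfolding p q by (intro le_setdist_torus[OF is_lattice_square_lattice]) auto
    then show ?thesis using e0 by (simp add: pos_divide_le_eq mult.commute)
  qed
  have inv: "1 / (1 + e) \<le> 1 - 129 * \<eta>"
  proof -
    have "1 \<le> 1 + e * (1 - e) / 2" using e e0 by simp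
    also have "\<dots> = (1 - e / 2) * (1 + e)" by (simp add: field_simps)
    also have "\<dots> \<le> (1 - 129 * \<eta>) * (1 + e)" using e e0 by (intro mult_right_mono) auto
    finally show ?thesis using e0 by (simp add: pos_divide_le_eq)
  qed
  have "setdist p q / (1 + e) \<le> dist a b" if ab: "torus_proj \<Lambda> a = torus_proj \<Lambda> (\<Psi> x)" "torus_proj \<Lambda> b = torus_proj \<Lambda> (\<Psi> y)" for a b
  proof -
    obtain x' y' where a: "a = \<Psi> x'" and b: "b = \<Psi> y'" using \<Psi>_surj by metis
    have "p = torus_proj square_lattice x'" "q = torus_proj square_lattice y'"
      using ab unfolding a b p q proj_\<Psi>_eq_iff square_proj_eq_iff by auto
    then have "setdist p q \<le> dist x' y'" using setdist_torus_le_dist[OF is_lattice_square_lattice] by simp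
    then have "(1 / (1 + e)) * setdist p q \<le> (1 - 129 * \<eta>) * dist x' y'"
      using inv e0 eta by (intro mult_mono) auto
    also have "\<dots> \<le> dist a b" unfolding a b by (rule \<Psi>_bounds)
    finally show ?thesis by simp
  qed
  then show "setdist p q / (1 + e) \<le> setdist (\<alpha> p) (\<alpha> q)"
    unfolding p q \<alpha>_proj by (rule le_setdist_torus[OF lattice])
qed

end

section \<open>The fold map of the square torus\<close>

interpretation flat: development "\<lambda>x. x" "\<lambda>_. 0" 0
  by unfold_locales (simp_all add: linear_id[unfolded id_def])

lemma flat_\<Psi> [simp]: "flat.\<Psi> x = x" and flat_\<Lambda> [simp]: "flat.\<Lambda> = square_lattice"
  by (simp_all add: flat.\<Psi>_def flat.\<Lambda>_def interp_def comb_def)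

definition fold_vertex :: "nat \<Rightarrow> real^3" where
  "fold_vertex = vec3 fold_x fold_y (\<lambda>_. 0)"

definition fold_map :: "(real^2) set \<Rightarrow> real^3" where
  "fold_map = flat.fill fold_vertex"

definition flat_point :: "real \<Rightarrow> real \<Rightarrow> real^3" where
  "flat_point X Y = vector [X, Y, 0]"

lemma fold_map_proj: "fold_map (torus_proj square_lattice x) = interp fold_vertex x"
  using flat.fill_proj[of fold_vertex x] by (simp add: fold_map_def)

lemma norm_vec2: "norm (x :: real^2) = sqrt ((x $ 1)\<^sup>2 + (x $ 2)\<^sup>2)"
  and norm_vec3: "norm (y :: real^3) = sqrt ((y $ 1)\<^sup>2 + (y $ 2)\<^sup>2 + (y $ 3)\<^sup>2)"
  by (simp_all add: norm_eq_sqrt_inner inner_vec_def sum_2 sum_3 power2_eq_square)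

lemma piecewise_isometric_fold_map: "piecewise_isometric_map square_lattice fold_map"
proof -
  have "norm (flat.vert i j a - flat.vert i j b) = norm (fold_vertex a - fold_vertex b)" for i j a b
    by (auto simp: norm_vec2 norm_vec3 flat.vert_def fold_vertex_def vec3_def pos_def unfold_def power2_commute)
  then show ?thesis using flat.piecewise_isometric_fill[of fold_vertex] by (simp add: fold_map_def)
qed

lemma flat_point_nth [simp]: "flat_point X Y $ 1 = X" "flat_point X Y $ 2 = Y" "flat_point X Y $ 3 = 0"
  by (simp_all add: flat_point_def)

lemma vec3_eq: "(x::real^3) = y \<longleftrightarrow> x $ 1 = y $ 1 \<and> x $ 2 = y $ 2 \<and> x $ 3 = y $ 3"
  by (simp add: vec_eq_iff forall_3)

lemma comb_fold_vertex: "comb w fold_vertex = flat_point (\<Sum>v<8. w v * fold_x v) (\<Sum>v<8. w v * fold_y v)"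
  by (simp add: vec3_eq comb_nth fold_vertex_def vec3_def)

definition unfold_point :: "real \<Rightarrow> real \<Rightarrow> bool \<times> bool \<Rightarrow> real^2" where
  "unfold_point X Y = (\<lambda>(i, j). vector [unfold i X, unfold j Y])"

text \<open>A fibre consists of one point in each cell, which coincide only over the boundary of the square.\<close>

lemma fold_fibre:
  assumes "0 \<le> X" "X \<le> 1/2" "0 \<le> Y" "Y \<le> 1/2"
  shows "{p \<in> flat_torus square_lattice. fold_map p = flat_point X Y} = (\<lambda>c. torus_proj square_lattice (unfold_point X Y c)) ` UNIV"
proof (intro equalityI subsetI)
  fix p assume p: "p \<in> {p \<in> flat_torus square_lattice. fold_map p = flat_point X Y}"
  then obtain x where x: "p = torus_proj square_lattice x" unfolding flat_torus_eq by blast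
  obtain i j t where l: "located x i j t (bary x)" using located_bary by blast
  then have w: "weights_on t (bary x)" and d: "x - comb (bary x) (pos i j) \<in> square_lattice" unfolding located_def by auto
  have "flat_point (\<Sum>v<8. bary x v * fold_x v) (\<Sum>v<8. bary x v * fold_y v) = flat_point X Y"
    using p unfolding x by (simp add: fold_map_proj interp_def comb_fold_vertex)
  then have "comb (bary x) (pos i j) = unfold_point X Y (i, j)"
    by (simp add: vec3_eq vec2_eq unfold_point_def comb_pos_nth[OF w])
  then have "p = torus_proj square_lattice (unfold_point X Y (i, j))"
    using d square_lattice_diff[of 0 "x - unfold_point X Y (i, j)"]
    unfolding x torus_proj_eq_iff[OF is_lattice_square_lattice] by (simp add: is_lattice_group(1)[OF is_lattice_square_lattice])
  then show "p \<in> (\<lambda>c. torus_proj square_lattice (unfold_point X Y c)) ` UNIV" by blast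
next
  fix p assume "p \<in> (\<lambda>c. torus_proj square_lattice (unfold_point X Y c)) ` UNIV"
  then obtain i j where p: "p = torus_proj square_lattice (unfold_point X Y (i, j))" by auto
  obtain t w where t: "t \<in> cell_facets i j" "weights_on t w" and eq: "(\<Sum>v<8. w v * fold_x v) = X" "(\<Sum>v<8. w v * fold_y v) = Y"
    using cell_cover[OF assms] by blast
  have "comb w (pos i j) = unfold_point X Y (i, j)" by (simp add: vec2_eq unfold_point_def comb_pos_nth[OF t(2)] eq)
  then have "fold_map p = flat_point X Y"
    unfolding p fold_map_proj by (metis interp_comb[OF t] comb_fold_vertex eq)
  then show "p \<in> {p \<in> flat_torus square_lattice. fold_map p = flat_point X Y}" using torus_proj_in p by blast
qed

lemma fold_map_image: "fold_map ` flat_torus square_lattice = {flat_point X Y | X Y. 0 \<le> X \<and> X \<le> 1/2 \<and> 0 \<le> Y \<and> Y \<le> 1/2}"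
proof (intro equalityI subsetI)
  fix y assume "y \<in> fold_map ` flat_torus square_lattice"
  then obtain x where y: "y = flat_point (\<Sum>v<8. bary x v * fold_x v) (\<Sum>v<8. bary x v * fold_y v)"
    unfolding flat_torus_eq by (auto simp: fold_map_proj interp_def comb_fold_vertex)
  obtain t where "weights_on t (bary x)" using bary_weights by blast
  from fold_comb_bounds[OF this] show "y \<in> {flat_point X Y | X Y. 0 \<le> X \<and> X \<le> 1/2 \<and> 0 \<le> Y \<and> Y \<le> 1/2}" unfolding y by blast
next
  fix y assume "y \<in> {flat_point X Y | X Y. 0 \<le> X \<and> X \<le> 1/2 \<and> 0 \<le> Y \<and> Y \<le> 1/2}"
  then obtain X Y where y: "y = flat_point X Y" and "0 \<le> X" "X \<le> 1/2" "0 \<le> Y" "Y \<le> 1/2" by blast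
  from fold_fibre[OF this(2-5)] have "torus_proj square_lattice (unfold_point X Y (True, True)) \<in> {p \<in> flat_torus square_lattice. fold_map p = flat_point X Y}" by blast
  then show "y \<in> fold_map ` flat_torus square_lattice" unfolding y by force
qed

lemma flat_segments:
  "0 \<le> Y \<Longrightarrow> Y \<le> 1/2 \<Longrightarrow> flat_point X Y \<in> closed_segment (flat_point X 0) (flat_point X (1/2))"
  "0 \<le> X \<Longrightarrow> X \<le> 1/2 \<Longrightarrow> flat_point X Y \<in> closed_segment (flat_point 0 Y) (flat_point (1/2) Y)"
proof -
  assume "0 \<le> Y" "Y \<le> 1/2"
  then show "flat_point X Y \<in> closed_segment (flat_point X 0) (flat_point X (1/2))"
    unfolding closed_segment_def by (intro CollectI exI[of _ "2 * Y"]) (simp add: vec3_eq algebra_simps)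
next
  assume "0 \<le> X" "X \<le> 1/2"
  then show "flat_point X Y \<in> closed_segment (flat_point 0 Y) (flat_point (1/2) Y)"
    unfolding closed_segment_def by (intro CollectI exI[of _ "2 * X"]) (simp add: vec3_eq algebra_simps)
qed

lemma filled_square_fold_map: "is_filled_square (fold_map ` flat_torus square_lattice)"
proof -
  let ?Q = "{flat_point X Y | X Y. 0 \<le> X \<and> X \<le> 1/2 \<and> 0 \<le> Y \<and> Y \<le> 1/2}"
  let ?h = "convex hull {flat_point 0 0, flat_point (1/2) 0, flat_point 0 (1/2), flat_point (1/2) (1/2)}"
  have "?Q = ?h"
  proof
    have "y \<in> ?Q \<longleftrightarrow> 0 \<le> y $ 1 \<and> y $ 1 \<le> 1/2 \<and> 0 \<le> y $ 2 \<and> y $ 2 \<le> 1/2 \<and> y $ 3 = 0" for y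
      by (auto simp: vec3_eq)
    moreover have "0 \<le> a * r + b * s" "a * r + b * s \<le> 1/2" if "0 \<le> a" "0 \<le> b" "a + b = 1" "0 \<le> r" "r \<le> 1/2" "0 \<le> s" "s \<le> 1/2" for a b r s :: real
      using that by (simp, intro convex_bound_le) auto
    ultimately have "convex ?Q" by (intro convexI) simp
    then show "?h \<subseteq> ?Q" by (intro hull_minimal) (auto intro!: exI)
    show "?Q \<subseteq> ?h"
    proof
      fix y assume "y \<in> ?Q"
      then obtain X Y where y: "y = flat_point X Y" and b: "0 \<le> X" "X \<le> 1/2" "0 \<le> Y" "Y \<le> 1/2" by blast
      have c: "closed_segment a b \<subseteq> ?h" if "a \<in> ?h" "b \<in> ?h" for a b using that by (intro closed_segment_subset) auto
      have v: "flat_point 0 0 \<in> ?h" "flat_point (1/2) 0 \<in> ?h" "flat_point 0 (1/2) \<in> ?h" "flat_point (1/2) (1/2) \<in> ?h" by (auto intro: hull_inc)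
      have "flat_point X 0 \<in> ?h" "flat_point X (1/2) \<in> ?h"
        using c[OF v(1,2)] c[OF v(3,4)] flat_segments(2)[OF b(1,2)] by blast+
      then show "y \<in> ?h" unfolding y using c flat_segments(1)[OF b(3,4)] by blast
    qed
  qed
  moreover have "flat_point 0 0 + flat_point (1/2) 0 = flat_point (1/2) 0" "flat_point 0 0 + flat_point 0 (1/2) = flat_point 0 (1/2)"
    "flat_point 0 0 + flat_point (1/2) 0 + flat_point 0 (1/2) = flat_point (1/2) (1/2)" "flat_point (1/2) 0 \<noteq> 0"
    "norm (flat_point (1/2) 0) = norm (flat_point 0 (1/2))" "orthogonal (flat_point (1/2) 0) (flat_point 0 (1/2))"
    by (simp_all add: vec3_eq norm_vec3 orthogonal_def inner_vec_def sum_3)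
  ultimately show ?thesis
    unfolding is_filled_square_def fold_map_image
    by (intro exI[of _ "flat_point 0 0"] exI[of _ "flat_point (1/2) 0"] exI[of _ "flat_point 0 (1/2)"]) simp
qed

lemma generically_4_to_1_fold_map: "generically_to_one 4 square_lattice fold_map"
  unfolding generically_to_one_def
proof (rule exI[of _ "{closed_segment (flat_point 0 0) (flat_point 0 (1/2)), closed_segment (flat_point (1/2) 0) (flat_point (1/2) (1/2)),
    closed_segment (flat_point 0 0) (flat_point (1/2) 0), closed_segment (flat_point 0 (1/2)) (flat_point (1/2) (1/2))}"], intro conjI ballI)
  let ?S = "{closed_segment (flat_point 0 0) (flat_point 0 (1/2)), closed_segment (flat_point (1/2) 0) (flat_point (1/2) (1/2)),
    closed_segment (flat_point 0 0) (flat_point (1/2) 0), closed_segment (flat_point 0 (1/2)) (flat_point (1/2) (1/2))}"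
  show "finite ?S" by simp
  show "\<exists>a b. s = closed_segment a b" if "s \<in> ?S" for s using that by blast
  fix y assume y: "y \<in> fold_map ` flat_torus square_lattice - \<Union>?S"
  then obtain X Y where yX: "y = flat_point X Y" and b: "0 \<le> X" "X \<le> 1/2" "0 \<le> Y" "Y \<le> 1/2" unfolding fold_map_image by blast
  have out: "flat_point X Y \<notin> closed_segment (flat_point 0 0) (flat_point 0 (1/2))"
    "flat_point X Y \<notin> closed_segment (flat_point (1/2) 0) (flat_point (1/2) (1/2))"
    "flat_point X Y \<notin> closed_segment (flat_point 0 0) (flat_point (1/2) 0)"
    "flat_point X Y \<notin> closed_segment (flat_point 0 (1/2)) (flat_point (1/2) (1/2))"
    using y unfolding yX by blast+
  have X: "X \<noteq> 0" "X \<noteq> 1/2" using out flat_segments(1)[OF b(3,4), of X] by metis+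
  have Y: "Y \<noteq> 0" "Y \<noteq> 1/2" using out flat_segments(2)[OF b(1,2), of Y] by metis+
  have inj: "inj (\<lambda>c. torus_proj square_lattice (unfold_point X Y c))"
  proof (rule injI)
    fix c c' assume eq: "torus_proj square_lattice (unfold_point X Y c) = torus_proj square_lattice (unfold_point X Y c')"
    obtain i j where c: "c = (i, j)" by (cases c)
    obtain i' j' where c': "c' = (i', j')" by (cases c')
    have d: "unfold i' X - unfold i X \<in> \<int>" "unfold j' Y - unfold j Y \<in> \<int>"
      using eq unfolding torus_proj_eq_iff[OF is_lattice_square_lattice] square_lattice_iff c c' by (simp_all add: unfold_point_def)
    have "i' = i" using unfold_congruent(2)[OF d(1) b(1,2) b(1,2)] X by blast
    moreover have "j' = j" using unfold_congruent(2)[OF d(2) b(3,4) b(3,4)] Y by blast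
    ultimately show "c = c'" unfolding c c' by simp
  qed
  have eq: "{p \<in> flat_torus square_lattice. fold_map p = y} = (\<lambda>c. torus_proj square_lattice (unfold_point X Y c)) ` UNIV"
    unfolding yX by (rule fold_fibre[OF b])
  show "finite {p \<in> flat_torus square_lattice. fold_map p = y}" unfolding eq by simp
  have "card ((UNIV :: bool set) \<times> (UNIV :: bool set)) = 4" by (simp add: card_cartesian_product card_UNIV_bool)
  then have "card (UNIV :: (bool \<times> bool) set) = 4" by (simp only: UNIV_Times_UNIV)
  then show "card {p \<in> flat_torus square_lattice. fold_map p = y} = 4" unfolding eq card_image[OF inj] .
qed

section \<open>Approximation by paper tori\<close>

text \<open>The comparison map preserves weights, so the two maps differ at most by the displacement of the vertices.\<close>

lemma paper_tori_near_fold_map: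
  assumes "0 < \<epsilon>"
  shows "\<exists>\<Lambda>' \<phi>'. vertex_paper_torus 8 \<Lambda>' \<phi>' \<and> uniform_distance square_lattice fold_map \<Lambda>' \<phi>' < ereal \<epsilon>"
proof -
  define e where "e = min 1 (\<epsilon> / 2)"
  define \<eta> where "\<eta> = e / 258"
  have e: "0 < e" "e \<le> 1" "e < \<epsilon>" using assms by (auto simp: e_def)
  have small: "0 < \<eta>" "129 * \<eta> < 1" "258 * \<eta> \<le> e" "\<eta> \<le> e" using e by (auto simp: \<eta>_def)
  obtain S D P where S: "linear S" "\<forall>x. norm (S x - x) \<le> \<eta> * norm x" and D: "\<forall>v<8. norm (D v) \<le> \<eta>"
    and P: "\<forall>v<8. norm (vec3 fold_x fold_y (\<lambda>_. 0) v - P v) \<le> \<eta>"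
    and len: "\<forall>i j. \<forall>t\<in>cell_facets i j. \<forall>a\<in>t. \<forall>b\<in>t. norm (S (pos i j a) + D a - (S (pos i j b) + D b)) = norm (P a - (P b :: real^3))"
    and sep: "\<forall>s\<in>facets. \<forall>t\<in>facets. \<forall>w w'. weights_on s w \<longrightarrow> weights_on t w' \<longrightarrow> comb w P = comb w' P \<longrightarrow> w = w'"
    using paper_data_exist[OF small(1)] by (elim exE conjE) (rule that, assumption+)
  interpret development S D \<eta>
    by (rule development.intro) (use S D small in auto)
  have paper: "vertex_paper_torus 8 \<Lambda> (fill P)"
    by (rule vertex_paper_torus_fill[OF _ sep]) (unfold vert_def, rule len)
  have "linfty_dist square_lattice fold_map (fill P \<circ> \<alpha>) \<le> ereal e"
    unfolding linfty_dist_def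
  proof (rule SUP_least)
    fix p assume "p \<in> flat_torus square_lattice"
    then obtain x where p: "p = torus_proj square_lattice x" unfolding flat_torus_eq by blast
    have "dist (fold_map p) ((fill P \<circ> \<alpha>) p) = norm (interp fold_vertex x - interp P x)"
      unfolding p by (simp add: fold_map_proj \<alpha>_proj fill_proj dist_norm)
    also have "\<dots> \<le> \<eta>" by (rule interp_diff_le) (use P in \<open>simp add: fold_vertex_def\<close>)
    finally show "ereal (dist (fold_map p) ((fill P \<circ> \<alpha>) p)) \<le> ereal e" using small(4) by simp
  qed
  with bilipschitz_\<alpha>[OF small(3) e(2)]
  have ex: "\<exists>\<alpha>. torus_bilipschitz (1 + e) square_lattice \<Lambda> \<alpha> \<and> linfty_dist square_lattice fold_map (fill P \<circ> \<alpha>) \<le> ereal e"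
    by blast
  have "uniform_distance square_lattice fold_map \<Lambda> (fill P) \<le> ereal e"
    unfolding uniform_distance_def
    by (rule Inf_lower, rule CollectI, rule exI[of _ e], intro conjI refl ex) (use e in simp)
  also have "\<dots> < ereal \<epsilon>" using e by simp
  finally show ?thesis using paper by blast
qed

theorem corollary1p4:
  shows "\<exists>\<phi> :: (real^2) set \<Rightarrow> real^3.
    piecewise_isometric_map square_lattice \<phi> \<and>
    generically_to_one 4 square_lattice \<phi> \<and>
    is_filled_square (\<phi> ` flat_torus square_lattice) \<and>
    (\<forall>\<epsilon>::real. \<epsilon> > 0 \<longrightarrow>
       (\<exists>(\<Lambda>' :: (real^2) set) (\<phi>' :: (real^2) set \<Rightarrow> real^3).
          vertex_paper_torus 8 \<Lambda>' \<phi>' \<and>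
          uniform_distance square_lattice \<phi> \<Lambda>' \<phi>' < ereal \<epsilon>))"
  using piecewise_isometric_fold_map generically_4_to_1_fold_map filled_square_fold_map paper_tori_near_fold_map by blast

end
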